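(* Let $u\in H^1_0(\Omega)$ solve $A(u,v)=(f,v)$ for all $v\in H^1_0(\Omega)$ and let $u_h\in V_h$ solve $A_h(u_h,v_h)=(f_h,v_h)$ for all $v_h\in V_h$. For $E\in\mathcal T_h$ let $\mathfrak S^E=S^E((\Pi^0_p-\mathrm I)u_h,(\Pi^0_p-\mathrm I)u_h)$ and $\Psi^E=\Psi^E_1+\Psi^E_2+\Psi^E_3+\Psi^E_4$ with $$\Psi_1^E=\|(\Pi^0_{p-1}-\mathrm I)(\boldsymbol\kappa\,\Pi^0_{p-1}\nabla u_h)\|_{0,E}^2,\qquad \Psi_2^E=h_E^2\|(\Pi^0_p-\mathrm I)(\boldsymbol\beta\cdot\Pi^0_{p-1}\nabla u_h)\|_{0,E}^2,$$ $$\Psi_3^E=\|(\Pi^0_{p-1}-\mathrm I)(\boldsymbol\beta\,\Pi^0_p u_h)\|_{0,E}^2,\qquad \Psi_4^E=h_E^2\|(\Pi^0_p-\mathrm I)(\mu\,\Pi^0_p u_h)\|_{0,E}^2.$$ Then there is a constant $C$, independent of $h$, $E$, $u$ and $u_h$, such that for every $E\in\mathcal T_h$ $$\Psi^E\le C\Big(|\!|\!|u-u_h|\!|\!|_E^2+\mathfrak S^E+\|(\Pi^0_{p-1}-\mathrm I)\boldsymbol\kappa\nabla u\|_{0,E}^2+h_E^2\|(\Pi^0_p-\mathrm I)\boldsymbol\beta\cdot\nabla u\|_{0,E}^2+\|(\Pi^0_{p-1}-\mathrm I)\boldsymbol\beta u\|_{0,E}^2+h_E^2\|(\Pi^0_p-\mathrm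 I)\mu u\|_{0,E}^2\Big).$$
   Context: **Continuous problem.** $\Omega\subset\mathbb R^d$ is a polygonal ($d=2$) or polyhedral ($d=3$) domain. $\gamma,f\in L^\infty(\Omega)$, $\boldsymbol\beta\in[W^{1,\infty}(\Omega)]^d$, and $\boldsymbol\kappa\in[L^\infty(\Omega)]^{d\times d}$ is symmetric with constants $\kappa_*,\kappa^*>0$ such that $\kappa_*|\xi|^2\le\xi\cdot\boldsymbol\kappa(x)\xi\le\kappa^*|\xi|^2$ for a.e. $x\in\Omega$ and all $\xi\in\mathbb R^d$. Set $\mu:=\gamma-\frac12\nabla\cdot\boldsymbol\beta$; there is a constant $\mu_0$ with $\mu\ge\mu_0>0$ a.e. in $\Omega$. Write $(\cdot,\cdot)_\omega$ for the $L^2(\omega)$ inner product, $(\cdot,\cdot)=(\cdot,\cdot)_\Omega$, and $\|\cdot\|_{r,\omega}$, $|\cdot|_{r,\omega}$ for the $H^r(\omega)$ norm and seminorm. Define $a(u,v)=(\boldsymbol\kappa\nabla u,\nabla v)+(\mu u,v)$, $b(u,v)=\frac12[(\boldsymbol\beta\cdot\nabla u,v)-(u,\boldsymbol\beta\cdot\nabla v)]$, $A=a+b$. The energy norm is $|\!|\!|v|\!|\!|_\omega^2:=\|\sqrt{\boldsymbol\kappa}\nabla v\|_{0,\omega}^2+\|\sqrt\mu\,v\|_{0,\omega}^2$. **Meshes.** $\{\mathcal T_h\}$ is a family of partitions of $\Omega$ into non-overlapping simple polygonal/polyhedral elements $E$ (simple: boundary not self-intersecting) of diameter $h_E$ and maximum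 size $h$. Each $\partial E$ consists of a uniformly bounded number of interfaces $s$ of diameter $h_s$ (line segments if $d=2$; planar polygons with a uniformly bounded number of straight edges if $d=3$), each either contained in $\partial\Omega$ or shared with another element; consecutive co-planar interfaces are allowed. Mesh regularity: there is $\rho>0$, uniform over the family, such that (1) every $E$ is star-shaped with respect to a ball of radius $\rho h_E$; (2) $h_s\ge\rho h_E$ for every interface $s$ of $E$; (3) if $d=3$, every interface, viewed as a 2-dimensional element, satisfies (1) and (2). **Virtual element space of order $p\ge1$.** $\mathcal P_\ell(\omega)$ denotes polynomials of total degree at most $\ell$ on $\omega$. $\Pi^0_\ell$ is the $L^2(E)$-orthogonal projection onto $\mathcal P_\ell(E)$ on each $E$ (componentwise on vector fields), and $\mathrm I$ is the identity. Scaled monomials on $\omega$ are $m_\alpha=((x-x_\omega)/h_\omega)^\alpha$, $x_\omega$ the barycentre, $h_\omega$ the diameter; moments of $v$ are $|\omega|^{-1}(v,m_\alpha)_\omega$. For $d=2$: on each edge put $V_h^s=\mathcal P_p(s)$; let $\mathcal W_h^E=\{v\in H^1(E):\Delta v\in\mathcal P_p(E),\ v|_s\in V_h^s\ \forall s\subset\partial E\}$ (with continuous trace on $\partial E$). The degrees of freedom $\mathrm{DoF}(V_h^E)$ are the values at the vertices of $E$, the moments of order up to $p-2$ on each edge, and the moments of order up to $p-2$ on $E$ (none if $p=1$). Let $\Pi^*_p:\mathcal W_h^E\to\mathcal P_p(E)$ be a fixed projection (identity on $\mathcal P_p(E)$) depending only on $\mathrm{DoF}(V_h^E)$ and $L^2$-stable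 uniformly in $E$ and $h$. Then $V_h^E=\{v\in\mathcal W_h^E:(v,m_\alpha)_E=(\Pi^*_pv,m_\alpha)_E\ \text{for all } m_\alpha \text{ with } p-1\le|\alpha|\le p\}$. For $d=3$: $V_h^s$ is the two-dimensional virtual element space just defined on each face $s$, $\mathcal W_h^E$ and $V_h^E$ are defined by the same formulas, and $\mathrm{DoF}(V_h^E)$ are the vertex values and the moments of order up to $p-2$ on each edge, each face, and $E$. Finally $V_h=\{v\in H^1_0(\Omega):v|_E\in V_h^E\ \forall E\in\mathcal T_h\}$. **Discrete problem.** For each $E$, $S^E_1,S^E_0$ are computable (evaluable from the data, the degrees of freedom and the polynomial components of the arguments only), symmetric, positive definite bilinear forms on $V_h^E/\mathcal P_p(E)$, identified with $\{v_h\in V_h^E:\Pi^0_pv_h=0\}$, satisfying, with a constant $C_{\rm stab}$ independent of $E$ and $h$, for all $v_h$ in that space, $C_{\rm stab}^{-1}\int_E|\sqrt{\boldsymbol\kappa}\nabla v_h|^2\le S^E_1(v_h,v_h)\le C_{\rm stab}\int_E|\sqrt{\boldsymbol\kappa}\nabla v_h|^2$ and $C_{\rm stab}^{-1}\int_E\mu v_h^2\le S^E_0(v_h,v_h)\le C_{\rm stab}\int_E\mu v_h^2$. Put $S^E=s_1S^E_1+s_0S^E_0$ with fixed constants $s_1,s_0>0$. Define $a_h^E(u_h,v_h)=(\boldsymbol\kappa\Pi^0_{p-1}\nabla u_h,\Pi^0_{p-1}\nabla v_h)_E+(\mu\Pi^0_pu_h,\Pi^0_pv_h)_E+S^E((\mathrm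 I-\Pi^0_p)u_h,(\mathrm I-\Pi^0_p)v_h)$, $b_h^E(u_h,v_h)=\frac12[(\boldsymbol\beta\cdot\Pi^0_{p-1}\nabla u_h,\Pi^0_pv_h)_E-(\Pi^0_pu_h,\boldsymbol\beta\cdot\Pi^0_{p-1}\nabla v_h)_E]$, $A_h=\sum_E(a_h^E+b_h^E)$, and $f_h=\Pi^0_{p-1}f$. *)

theory Defs
  imports "HOL-Analysis.Analysis"
begin

text \<open>Elements of the function spaces are represented by total functions on the ambient space; only
  their values on the open set \<open>U\<close> matter, and those only up to null sets.\<close>

definition ip :: "(real^'n) set \<Rightarrow> (real^'n \<Rightarrow> 'b::euclidean_space) \<Rightarrow> (real^'n \<Rightarrow> 'b) \<Rightarrow> real" where
  "ip U f g = (\<integral>x. f x \<bullet> g x \<partial>(lebesgue_on U))"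

definition L2norm :: "(real^'n) set \<Rightarrow> (real^'n \<Rightarrow> 'b::euclidean_space) \<Rightarrow> real" where
  "L2norm U f = sqrt (\<integral>x. (norm (f x))\<^sup>2 \<partial>(lebesgue_on U))"

definition L2 :: "(real^'n) set \<Rightarrow> (real^'n \<Rightarrow> 'b::euclidean_space) set" where
  "L2 U = {f \<in> borel_measurable (lebesgue_on U). integrable (lebesgue_on U) (\<lambda>x. (norm (f x))\<^sup>2)}"

definition Linf :: "(real^'n) set \<Rightarrow> (real^'n \<Rightarrow> 'b::euclidean_space) set" where
  "Linf U = {f \<in> borel_measurable (lebesgue_on U). \<exists>M. AE x in lebesgue_on U. norm (f x) \<le> M}"

definition grad :: "(real^'n \<Rightarrow> real) \<Rightarrow> real^'n \<Rightarrow> real^'n" where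
  "grad \<phi> x = (THE D. GDERIV \<phi> x :> D)"

text \<open>As in Gilbarg and Trudinger, test functions for first-order weak derivatives are continuously
  differentiable functions with compact support in \<open>U\<close>; by mollification they give the same weak
  derivatives and the same closure in \<open>H\<^sup>1\<close> as the infinitely differentiable ones.\<close>

definition test_fun :: "(real^'n) set \<Rightarrow> (real^'n \<Rightarrow> real) set" where
  "test_fun U = {\<phi>. (\<forall>x. GDERIV \<phi> x :> grad \<phi> x) \<and> continuous_on UNIV (grad \<phi>) \<and>
                     (\<exists>K. compact K \<and> K \<subseteq> U \<and> (\<forall>x. x \<notin> K \<longrightarrow> \<phi> x = 0))}"

definition has_wgrad :: "(real^'n) set \<Rightarrow> (real^'n \<Rightarrow> real) \<Rightarrow> (real^'n \<Rightarrow> real^'n) \<Rightarrow> bool" where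
  "has_wgrad U v G \<longleftrightarrow>
     (\<forall>K. compact K \<and> K \<subseteq> U \<longrightarrow>
        integrable (lebesgue_on K) v \<and> integrable (lebesgue_on K) G) \<and>
     (\<forall>\<phi>\<in>test_fun U.
        (\<integral>x. v x *\<^sub>R grad \<phi> x \<partial>(lebesgue_on U)) = - (\<integral>x. \<phi> x *\<^sub>R G x \<partial>(lebesgue_on U)))"

definition wgrad :: "(real^'n) set \<Rightarrow> (real^'n \<Rightarrow> real) \<Rightarrow> real^'n \<Rightarrow> real^'n" where
  "wgrad U v = (SOME G. has_wgrad U v G)"

definition wdiv :: "(real^'n) set \<Rightarrow> (real^'n \<Rightarrow> real^'n) \<Rightarrow> real^'n \<Rightarrow> real" where
  "wdiv U b x = (\<Sum>i\<in>UNIV. wgrad U (\<lambda>y. b y $ i) x $ i)"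

definition H1 :: "(real^'n) set \<Rightarrow> (real^'n \<Rightarrow> real) set" where
  "H1 U = {v \<in> L2 U. \<exists>G\<in>L2 U. has_wgrad U v G}"

definition H10 :: "(real^'n) set \<Rightarrow> (real^'n \<Rightarrow> real) set" where
  "H10 U = {v \<in> H1 U. \<exists>\<phi>::nat \<Rightarrow> real^'n \<Rightarrow> real. (\<forall>k. \<phi> k \<in> test_fun U) \<and>
     (\<lambda>k. (L2norm U (\<lambda>x. v x - \<phi> k x))\<^sup>2 + (L2norm U (\<lambda>x. wgrad U v x - grad (\<phi> k) x))\<^sup>2)
        \<longlonglongrightarrow> 0}"

definition W1inf_vec :: "(real^'n) set \<Rightarrow> (real^'n \<Rightarrow> real^'n) set" where
  "W1inf_vec U = {b \<in> Linf U. \<forall>i. \<exists>G\<in>Linf U. has_wgrad U (\<lambda>x. b x $ i) G}"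

text \<open>The boundary trace of \<open>v \<in> H\<^sup>1(U)\<close> is the continuous function \<open>g\<close>: as usual, the boundary values are
  understood modulo \<open>H\<^sup>1\<^sub>0(U)\<close>.  On the star-shaped elements below, which are Lipschitz,
  \<open>g\<close> is unique on the boundary and is the trace of \<open>v\<close> in the sense of the trace theorem.\<close>

definition has_trace :: "(real^'n) set \<Rightarrow> (real^'n \<Rightarrow> real) \<Rightarrow> (real^'n \<Rightarrow> real) \<Rightarrow> bool" where
  "has_trace U v g \<longleftrightarrow> continuous_on (frontier U) g \<and>
     (\<exists>w\<in>H1 U. continuous_on (closure U) w \<and> (\<forall>x\<in>frontier U. w x = g x) \<and>
               (\<lambda>x. v x - w x) \<in> H10 U)"

definition trace_of :: "(real^'n) set \<Rightarrow> (real^'n \<Rightarrow> real) \<Rightarrow> real^'n \<Rightarrow> real" where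
  "trace_of U v = (SOME g. has_trace U v g)"

text \<open>At most one \<open>B\<close> satisfies the condition, and one does for symmetric positive semidefinite \<open>A\<close>.\<close>

definition msqrt :: "real^'n^'n \<Rightarrow> real^'n^'n" where
  "msqrt A = (SOME B. transpose B = B \<and> (\<forall>\<xi>. 0 \<le> \<xi> \<bullet> (B *v \<xi>)) \<and> B ** B = A)"

text \<open>A polynomial on a set with nonempty interior is identified with its extension to the whole
  space.\<close>

definition poly_fun :: "nat \<Rightarrow> (real^'n \<Rightarrow> real) set" where
  "poly_fun l = {q. \<exists>c::('n \<Rightarrow> nat) \<Rightarrow> real.
     q = (\<lambda>x. \<Sum>\<alpha> | sum \<alpha> UNIV \<le> l. c \<alpha> * (\<Prod>i\<in>UNIV. (x $ i) ^ \<alpha> i))}"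

definition proj :: "nat \<Rightarrow> (real^'n) set \<Rightarrow> (real^'n \<Rightarrow> real) \<Rightarrow> real^'n \<Rightarrow> real" where
  "proj l E v = (THE q. q \<in> poly_fun l \<and> (\<forall>r\<in>poly_fun l. ip E (\<lambda>x. v x - q x) r = 0))"

definition projv :: "nat \<Rightarrow> (real^'n) set \<Rightarrow> (real^'n \<Rightarrow> real^'n) \<Rightarrow> real^'n \<Rightarrow> real^'n" where
  "projv l E G x = (\<chi> i. proj l E (\<lambda>y. G y $ i) x)"

definition barycentre :: "(real^'n) set \<Rightarrow> real^'n" where
  "barycentre U = (1 / measure lebesgue U) *\<^sub>R (\<integral>x. x \<partial>(lebesgue_on U))"

definition smono :: "(real^'n) set \<Rightarrow> ('n \<Rightarrow> nat) \<Rightarrow> real^'n \<Rightarrow> real" where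
  "smono U \<alpha> x = (\<Prod>i\<in>UNIV. ((x $ i - barycentre U $ i) / diameter U) ^ \<alpha> i)"

definition moment :: "(real^'n) set \<Rightarrow> ('n \<Rightarrow> nat) \<Rightarrow> (real^'n \<Rightarrow> real) \<Rightarrow> real" where
  "moment U \<alpha> v = ip U v (smono U \<alpha>) / measure lebesgue U"

text \<open>A Cartesian coordinate system on the affine hull of a lower-dimensional set, used to view an
  edge (\<open>'m = 1\<close>) or a planar face (\<open>'m = 2\<close>) as a subset of a Euclidean space of its own dimension.
  Distance-preserving maps between Euclidean spaces are affine.\<close>

definition chart :: "(real^'n) set \<Rightarrow> real^'m \<Rightarrow> real^'n" where
  "chart s = (SOME \<phi>. (\<forall>x y. dist (\<phi> x) (\<phi> y) = dist x y) \<and> range \<phi> = affine hull s)"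

definition edge_moment :: "(real^'n) set \<Rightarrow> (1 \<Rightarrow> nat) \<Rightarrow> (real^'n \<Rightarrow> real) \<Rightarrow> real" where
  "edge_moment e \<alpha> g = moment (chart e -` e) \<alpha> (g \<circ> chart e)"

definition face_moment :: "(real^'n) set \<Rightarrow> (2 \<Rightarrow> nat) \<Rightarrow> (real^'n \<Rightarrow> real) \<Rightarrow> real" where
  "face_moment s \<alpha> g = moment (chart s -` s) \<alpha> (g \<circ> chart s)"

definition polytopal_domain :: "(real^'n) set \<Rightarrow> bool" where
  "polytopal_domain U \<longleftrightarrow> open U \<and> connected U \<and> bounded U \<and> U \<noteq> {} \<and>
     (\<exists>F. finite F \<and> (\<forall>c\<in>F. polytope c \<and> aff_dim c = int CARD('n) - 1) \<and> frontier U = \<Union>F)"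

text \<open>Elements are open sets, interfaces and edges are closed.  Interfaces and (in three dimensions)
  their edges are part of the mesh, since consecutive co-planar interfaces are allowed.  In two
  dimensions the interfaces are themselves the edges and the field \<open>iface_edges\<close> is not used.\<close>

record ('n::finite) mesh =
  elems :: "(real^'n) set set"
  ifaces :: "(real^'n) set \<Rightarrow> (real^'n) set set"
  iface_edges :: "(real^'n) set \<Rightarrow> (real^'n) set set"

text \<open>The boundary, made up of the non-overlapping pieces in \<open>S\<close>, is not self-intersecting: it is an
  embedded circle or sphere.  For the elements below, which are star-shaped with respect to a ball,
  a boundary of any other topological type cannot occur anyway.\<close>

definition simple_cell :: "(real^'n) set \<Rightarrow> (real^'n) set set \<Rightarrow> bool" where
  "simple_cell E S \<longleftrightarrow> E \<noteq> {} \<and> finite S \<and>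
     (\<Union>S) homeomorphic (sphere 0 1 :: (real^'n) set) \<and> E = inside (\<Union>S) \<and>
     pairwise (\<lambda>s t. s \<inter> t \<subseteq> rel_frontier s \<inter> rel_frontier t) S"

definition is_segment :: "(real^'n) set \<Rightarrow> bool" where
  "is_segment e \<longleftrightarrow> (\<exists>a b. a \<noteq> b \<and> e = closed_segment a b)"

definition simple_polygon :: "(real^'n) set \<Rightarrow> (real^'n) set set \<Rightarrow> bool" where
  "simple_polygon E S \<longleftrightarrow> simple_cell E S \<and> (\<forall>s\<in>S. is_segment s)"

definition face_dom :: "(real^'n) set \<Rightarrow> (real^2) set" where
  "face_dom s = interior (chart s -` s)"

definition face_edges :: "('n::finite) mesh \<Rightarrow> (real^'n) set \<Rightarrow> (real^2) set set" where
  "face_edges T s = (\<lambda>e. chart s -` e) ` iface_edges T s"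

definition planar_polygon :: "('n::finite) mesh \<Rightarrow> (real^'n) set \<Rightarrow> bool" where
  "planar_polygon T s \<longleftrightarrow> aff_dim s = 2 \<and> s = chart s ` closure (face_dom s) \<and>
     (\<forall>e\<in>iface_edges T s. e \<subseteq> s) \<and> simple_polygon (face_dom s) (face_edges T s)"

definition star_ball :: "real \<Rightarrow> (real^'n) set \<Rightarrow> bool" where
  "star_ball r E \<longleftrightarrow> (\<exists>c. ball c r \<subseteq> E \<and> (\<forall>x\<in>E. \<forall>y\<in>ball c r. closed_segment x y \<subseteq> E))"

definition regular_cell :: "real \<Rightarrow> (real^'n) set \<Rightarrow> (real^'n) set set \<Rightarrow> bool" where
  "regular_cell \<rho> E S \<longleftrightarrow> star_ball (\<rho> * diameter E) E \<and> (\<forall>s\<in>S. \<rho> * diameter E \<le> diameter s)"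

definition is_mesh :: "(real^'n) set \<Rightarrow> ('n::finite) mesh \<Rightarrow> bool" where
  "is_mesh U T \<longleftrightarrow> finite (elems T) \<and> pairwise disjnt (elems T) \<and>
     closure U = (\<Union>E\<in>elems T. closure E) \<and>
     (\<forall>E\<in>elems T. E \<subseteq> U \<and>
        (if CARD('n) = 2 then simple_polygon E (ifaces T E)
         else simple_cell E (ifaces T E) \<and> (\<forall>s\<in>ifaces T E. planar_polygon T s)) \<and>
        (\<forall>s\<in>ifaces T E. s \<subseteq> frontier U \<or> (\<exists>E'\<in>elems T. E' \<noteq> E \<and> s \<in> ifaces T E')))"

definition regular_mesh :: "real \<Rightarrow> nat \<Rightarrow> ('n::finite) mesh \<Rightarrow> bool" where
  "regular_mesh \<rho> N T \<longleftrightarrow>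
     (\<forall>E\<in>elems T. card (ifaces T E) \<le> N \<and> regular_cell \<rho> E (ifaces T E) \<and>
        (CARD('n) = 3 \<longrightarrow> (\<forall>s\<in>ifaces T E. card (iface_edges T s) \<le> N \<and>
                                regular_cell \<rho> (face_dom s) (face_edges T s))))"

definition lap_in_poly :: "nat \<Rightarrow> (real^'n) set \<Rightarrow> (real^'n \<Rightarrow> real) \<Rightarrow> bool" where
  "lap_in_poly p E v \<longleftrightarrow>
     (\<exists>q\<in>poly_fun p. \<forall>\<phi>\<in>test_fun E. ip E (wgrad E v) (grad \<phi>) = - ip E q \<phi>)"

text \<open>\<open>Vs s\<close> is the space prescribed on the interface \<open>s\<close>, as a set of functions on the ambient space
  whose restriction to \<open>s\<close> belongs to that space.\<close>

definition vem_W :: "nat \<Rightarrow> (real^'n) set \<Rightarrow> (real^'n) set set \<Rightarrow>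
    ((real^'n) set \<Rightarrow> (real^'n \<Rightarrow> real) set) \<Rightarrow> (real^'n \<Rightarrow> real) set" where
  "vem_W p E S Vs = {v \<in> H1 E. lap_in_poly p E v \<and> (\<exists>g. has_trace E v g \<and> (\<forall>s\<in>S. g \<in> Vs s))}"

definition vem_V :: "nat \<Rightarrow> (real^'n) set \<Rightarrow> (real^'n \<Rightarrow> real) set \<Rightarrow>
    ((real^'n \<Rightarrow> real) \<Rightarrow> real^'n \<Rightarrow> real) \<Rightarrow> (real^'n \<Rightarrow> real) set" where
  "vem_V p E W P = {v \<in> W. \<forall>\<alpha>. p - 1 \<le> sum \<alpha> UNIV \<and> sum \<alpha> UNIV \<le> p \<longrightarrow>
                               ip E v (smono E \<alpha>) = ip E (P v) (smono E \<alpha>)}"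

definition edge_space :: "nat \<Rightarrow> (real^'n) set \<Rightarrow> (real^'n \<Rightarrow> real) set" where
  "edge_space p s = {g. \<exists>q\<in>poly_fun p. \<forall>x\<in>s. g x = q x}"

definition face_W :: "nat \<Rightarrow> ('n::finite) mesh \<Rightarrow> (real^'n) set \<Rightarrow> (real^2 \<Rightarrow> real) set" where
  "face_W p T s = vem_W p (face_dom s) (face_edges T s) (edge_space p)"

text \<open>\<open>PF s\<close> is the projection \<open>\<Pi>\<^sup>*\<close> of the face \<open>s\<close> (three dimensions only) in its chart,
  \<open>PE E\<close> the one of the element \<open>E\<close>.\<close>

definition iface_space :: "nat \<Rightarrow> ('n::finite) mesh \<Rightarrow>
    ((real^'n) set \<Rightarrow> (real^2 \<Rightarrow> real) \<Rightarrow> real^2 \<Rightarrow> real) \<Rightarrow> (real^'n) set \<Rightarrow> (real^'n \<Rightarrow> real) set" where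
  "iface_space p T PF s =
     (if CARD('n) = 2 then edge_space p s
      else {g. g \<circ> chart s \<in> vem_V p (face_dom s) (face_W p T s) (PF s)})"

definition elem_W :: "nat \<Rightarrow> ('n::finite) mesh \<Rightarrow>
    ((real^'n) set \<Rightarrow> (real^2 \<Rightarrow> real) \<Rightarrow> real^2 \<Rightarrow> real) \<Rightarrow> (real^'n) set \<Rightarrow> (real^'n \<Rightarrow> real) set" where
  "elem_W p T PF E = vem_W p E (ifaces T E) (iface_space p T PF)"

definition elem_V :: "nat \<Rightarrow> ('n::finite) mesh \<Rightarrow>
    ((real^'n) set \<Rightarrow> (real^2 \<Rightarrow> real) \<Rightarrow> real^2 \<Rightarrow> real) \<Rightarrow>
    ((real^'n) set \<Rightarrow> (real^'n \<Rightarrow> real) \<Rightarrow> real^'n \<Rightarrow> real) \<Rightarrow> (real^'n) set \<Rightarrow> (real^'n \<Rightarrow> real) set" where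
  "elem_V p T PF PE E = vem_V p E (elem_W p T PF E) (PE E)"

definition global_V :: "(real^'n) set \<Rightarrow> nat \<Rightarrow> ('n::finite) mesh \<Rightarrow>
    ((real^'n) set \<Rightarrow> (real^2 \<Rightarrow> real) \<Rightarrow> real^2 \<Rightarrow> real) \<Rightarrow>
    ((real^'n) set \<Rightarrow> (real^'n \<Rightarrow> real) \<Rightarrow> real^'n \<Rightarrow> real) \<Rightarrow> (real^'n \<Rightarrow> real) set" where
  "global_V U p T PF PE = {v \<in> H10 U. \<forall>E\<in>elems T. v \<in> elem_V p T PF PE E}"

text \<open>The degrees of freedom, as a set of functionals.  The condition \<open>|\<alpha>| + 2 \<le> p\<close> leaves no moments
  when \<open>p = 1\<close>.\<close>

definition dofs :: "nat \<Rightarrow> (real^'n) set \<Rightarrow> (real^'n) set set \<Rightarrow> (real^'n) set set \<Rightarrow>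
    ((real^'n \<Rightarrow> real) \<Rightarrow> real) set" where
  "dofs p E Edges Faces =
     {(\<lambda>v. trace_of E v x) |x. x \<in> (\<Union>e\<in>Edges. rel_frontier e)} \<union>
     {(\<lambda>v. edge_moment e \<alpha> (trace_of E v)) |e \<alpha>. e \<in> Edges \<and> sum \<alpha> UNIV + 2 \<le> p} \<union>
     {(\<lambda>v. face_moment s \<alpha> (trace_of E v)) |s \<alpha>. s \<in> Faces \<and> sum \<alpha> UNIV + 2 \<le> p} \<union>
     {moment E \<alpha> |\<alpha>. sum \<alpha> UNIV + 2 \<le> p}"

definition elem_dofs :: "nat \<Rightarrow> ('n::finite) mesh \<Rightarrow> (real^'n) set \<Rightarrow> ((real^'n \<Rightarrow> real) \<Rightarrow> real) set" where
  "elem_dofs p T E =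
     (if CARD('n) = 2 then dofs p E (ifaces T E) {}
      else dofs p E (\<Union>s\<in>ifaces T E. iface_edges T s) (ifaces T E))"

definition face_dofs :: "nat \<Rightarrow> ('n::finite) mesh \<Rightarrow> (real^'n) set \<Rightarrow> ((real^2 \<Rightarrow> real) \<Rightarrow> real) set" where
  "face_dofs p T s = dofs p (face_dom s) (face_edges T s) {}"

definition vem_projection :: "nat \<Rightarrow> real \<Rightarrow> (real^'n) set \<Rightarrow> (real^'n \<Rightarrow> real) set \<Rightarrow>
    ((real^'n \<Rightarrow> real) \<Rightarrow> real) set \<Rightarrow> ((real^'n \<Rightarrow> real) \<Rightarrow> real^'n \<Rightarrow> real) \<Rightarrow> bool" where
  "vem_projection p C E W D P \<longleftrightarrow>
     (\<forall>v\<in>W. P v \<in> poly_fun p) \<and>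
     (\<forall>q\<in>poly_fun p. P q = q) \<and>
     (\<forall>v\<in>W. \<forall>w\<in>W. \<forall>a b. P (\<lambda>x. a * v x + b * w x) = (\<lambda>x. a * P v x + b * P w x)) \<and>
     (\<forall>v\<in>W. \<forall>w\<in>W. (\<forall>d\<in>D. d v = d w) \<longrightarrow> P v = P w) \<and>
     (\<forall>v\<in>W. L2norm E (P v) \<le> C * L2norm E v)"

definition vem_projections :: "nat \<Rightarrow> real \<Rightarrow> ('n::finite) mesh \<Rightarrow>
    ((real^'n) set \<Rightarrow> (real^2 \<Rightarrow> real) \<Rightarrow> real^2 \<Rightarrow> real) \<Rightarrow>
    ((real^'n) set \<Rightarrow> (real^'n \<Rightarrow> real) \<Rightarrow> real^'n \<Rightarrow> real) \<Rightarrow> bool" where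
  "vem_projections p C T PF PE \<longleftrightarrow>
     (\<forall>E\<in>elems T. vem_projection p C E (elem_W p T PF E) (elem_dofs p T E) (PE E) \<and>
        (CARD('n) = 3 \<longrightarrow>
          (\<forall>s\<in>ifaces T E. vem_projection p C (face_dom s) (face_W p T s) (face_dofs p T s) (PF s))))"

definition mu_of :: "(real^'n) set \<Rightarrow> (real^'n \<Rightarrow> real) \<Rightarrow> (real^'n \<Rightarrow> real^'n) \<Rightarrow> real^'n \<Rightarrow> real" where
  "mu_of U \<gamma> \<beta> x = \<gamma> x - 1/2 * wdiv U \<beta> x"

definition a_form :: "(real^'n) set \<Rightarrow> (real^'n \<Rightarrow> real^'n^'n) \<Rightarrow> (real^'n \<Rightarrow> real) \<Rightarrow>
    (real^'n \<Rightarrow> real) \<Rightarrow> (real^'n \<Rightarrow> real) \<Rightarrow> real" where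
  "a_form U \<kappa> \<mu> u v = ip U (\<lambda>x. \<kappa> x *v wgrad U u x) (wgrad U v) + ip U (\<lambda>x. \<mu> x * u x) v"

definition b_form :: "(real^'n) set \<Rightarrow> (real^'n \<Rightarrow> real^'n) \<Rightarrow>
    (real^'n \<Rightarrow> real) \<Rightarrow> (real^'n \<Rightarrow> real) \<Rightarrow> real" where
  "b_form U \<beta> u v =
     1/2 * (ip U (\<lambda>x. \<beta> x \<bullet> wgrad U u x) v - ip U u (\<lambda>x. \<beta> x \<bullet> wgrad U v x))"

definition energy_norm :: "(real^'n) set \<Rightarrow> (real^'n \<Rightarrow> real^'n^'n) \<Rightarrow> (real^'n \<Rightarrow> real) \<Rightarrow>
    (real^'n \<Rightarrow> real) \<Rightarrow> real" where
  "energy_norm U \<kappa> \<mu> v = sqrt ((L2norm U (\<lambda>x. msqrt (\<kappa> x) *v wgrad U v x))\<^sup>2 +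
                              (L2norm U (\<lambda>x. sqrt (\<mu> x) * v x))\<^sup>2)"

definition resid :: "nat \<Rightarrow> (real^'n) set \<Rightarrow> (real^'n \<Rightarrow> real) \<Rightarrow> real^'n \<Rightarrow> real" where
  "resid p E v = (\<lambda>x. v x - proj p E v x)"

text \<open>\<open>K\<close> is the domain of the form and \<open>Q\<close> the quadratic functional to which it is equivalent.  The
  form can be evaluated from the degrees of freedom of its arguments: it does not distinguish
  arguments with equal degrees of freedom.  (The polynomial components of all elements of \<open>K\<close> vanish.)\<close>

definition stab_form :: "(real^'n) set \<Rightarrow> (real^'n \<Rightarrow> real) set \<Rightarrow> ((real^'n \<Rightarrow> real) \<Rightarrow> real) set \<Rightarrow> real \<Rightarrow>
    ((real^'n \<Rightarrow> real) \<Rightarrow> real) \<Rightarrow> ((real^'n \<Rightarrow> real) \<Rightarrow> (real^'n \<Rightarrow> real) \<Rightarrow> real) \<Rightarrow> bool" where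
  "stab_form E K D C Q S \<longleftrightarrow>
     (\<forall>u\<in>K. \<forall>v\<in>K. \<forall>w\<in>K. \<forall>a b. S (\<lambda>x. a * u x + b * v x) w = a * S u w + b * S v w) \<and>
     (\<forall>v\<in>K. \<forall>w\<in>K. S v w = S w v) \<and>
     (\<forall>v\<in>K. \<not> (AE x in lebesgue_on E. v x = 0) \<longrightarrow> 0 < S v v) \<and>
     (\<forall>v\<in>K. \<forall>v'\<in>K. \<forall>w\<in>K. (\<forall>d\<in>D. d v = d v') \<longrightarrow> S v w = S v' w) \<and>
     (\<forall>v\<in>K. Q v / C \<le> S v v \<and> S v v \<le> C * Q v)"

definition stab_kernel :: "nat \<Rightarrow> (real^'n) set \<Rightarrow> (real^'n \<Rightarrow> real) set \<Rightarrow> (real^'n \<Rightarrow> real) set" where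
  "stab_kernel p E V = {v \<in> V. proj p E v = (\<lambda>x. 0)}"

definition ah_form :: "nat \<Rightarrow> (real^'n) set \<Rightarrow> (real^'n \<Rightarrow> real^'n^'n) \<Rightarrow> (real^'n \<Rightarrow> real) \<Rightarrow>
    ((real^'n \<Rightarrow> real) \<Rightarrow> (real^'n \<Rightarrow> real) \<Rightarrow> real) \<Rightarrow> (real^'n \<Rightarrow> real) \<Rightarrow> (real^'n \<Rightarrow> real) \<Rightarrow> real" where
  "ah_form p E \<kappa> \<mu> S u v =
     ip E (\<lambda>x. \<kappa> x *v projv (p - 1) E (wgrad E u) x) (projv (p - 1) E (wgrad E v)) +
     ip E (\<lambda>x. \<mu> x * proj p E u x) (proj p E v) + S (resid p E u) (resid p E v)"

definition bh_form :: "nat \<Rightarrow> (real^'n) set \<Rightarrow> (real^'n \<Rightarrow> real^'n) \<Rightarrow>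
    (real^'n \<Rightarrow> real) \<Rightarrow> (real^'n \<Rightarrow> real) \<Rightarrow> real" where
  "bh_form p E \<beta> u v =
     1/2 * (ip E (\<lambda>x. \<beta> x \<bullet> projv (p - 1) E (wgrad E u) x) (proj p E v) -
            ip E (proj p E u) (\<lambda>x. \<beta> x \<bullet> projv (p - 1) E (wgrad E v) x))"

definition weak_solution :: "(real^'n) set \<Rightarrow> (real^'n \<Rightarrow> real^'n^'n) \<Rightarrow> (real^'n \<Rightarrow> real^'n) \<Rightarrow>
    (real^'n \<Rightarrow> real) \<Rightarrow> (real^'n \<Rightarrow> real) \<Rightarrow> (real^'n \<Rightarrow> real) \<Rightarrow> bool" where
  "weak_solution U \<kappa> \<beta> \<mu> f u \<longleftrightarrow>
     u \<in> H10 U \<and> (\<forall>v\<in>H10 U. a_form U \<kappa> \<mu> u v + b_form U \<beta> u v = ip U f v)"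

definition discrete_solution :: "nat \<Rightarrow> ('n::finite) mesh \<Rightarrow> (real^'n \<Rightarrow> real) set \<Rightarrow>
    (real^'n \<Rightarrow> real^'n^'n) \<Rightarrow> (real^'n \<Rightarrow> real^'n) \<Rightarrow> (real^'n \<Rightarrow> real) \<Rightarrow>
    ((real^'n) set \<Rightarrow> (real^'n \<Rightarrow> real) \<Rightarrow> (real^'n \<Rightarrow> real) \<Rightarrow> real) \<Rightarrow>
    (real^'n \<Rightarrow> real) \<Rightarrow> (real^'n \<Rightarrow> real) \<Rightarrow> bool" where
  "discrete_solution p T V \<kappa> \<beta> \<mu> S f u \<longleftrightarrow>
     u \<in> V \<and> (\<forall>v\<in>V. (\<Sum>E\<in>elems T. ah_form p E \<kappa> \<mu> (S E) u v + bh_form p E \<beta> u v) =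
                     (\<Sum>E\<in>elems T. ip E (proj (p - 1) E f) v))"

definition osc :: "nat \<Rightarrow> (real^'n) set \<Rightarrow> (real^'n \<Rightarrow> real) \<Rightarrow> real" where
  "osc l E w = L2norm E (\<lambda>x. proj l E w x - w x)"

definition oscv :: "nat \<Rightarrow> (real^'n) set \<Rightarrow> (real^'n \<Rightarrow> real^'n) \<Rightarrow> real" where
  "oscv l E w = L2norm E (\<lambda>x. projv l E w x - w x)"

definition Psi1 :: "nat \<Rightarrow> (real^'n) set \<Rightarrow> (real^'n \<Rightarrow> real^'n^'n) \<Rightarrow> (real^'n \<Rightarrow> real) \<Rightarrow> real" where
  "Psi1 p E \<kappa> v = (oscv (p - 1) E (\<lambda>x. \<kappa> x *v projv (p - 1) E (wgrad E v) x))\<^sup>2"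

definition Psi2 :: "nat \<Rightarrow> (real^'n) set \<Rightarrow> (real^'n \<Rightarrow> real^'n) \<Rightarrow> (real^'n \<Rightarrow> real) \<Rightarrow> real" where
  "Psi2 p E \<beta> v = (diameter E)\<^sup>2 * (osc p E (\<lambda>x. \<beta> x \<bullet> projv (p - 1) E (wgrad E v) x))\<^sup>2"

definition Psi3 :: "nat \<Rightarrow> (real^'n) set \<Rightarrow> (real^'n \<Rightarrow> real^'n) \<Rightarrow> (real^'n \<Rightarrow> real) \<Rightarrow> real" where
  "Psi3 p E \<beta> v = (oscv (p - 1) E (\<lambda>x. proj p E v x *\<^sub>R \<beta> x))\<^sup>2"

definition Psi4 :: "nat \<Rightarrow> (real^'n) set \<Rightarrow> (real^'n \<Rightarrow> real) \<Rightarrow> (real^'n \<Rightarrow> real) \<Rightarrow> real" where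
  "Psi4 p E \<mu> v = (diameter E)\<^sup>2 * (osc p E (\<lambda>x. \<mu> x * proj p E v x))\<^sup>2"

definition Psi :: "nat \<Rightarrow> (real^'n) set \<Rightarrow> (real^'n \<Rightarrow> real^'n^'n) \<Rightarrow> (real^'n \<Rightarrow> real^'n) \<Rightarrow>
    (real^'n \<Rightarrow> real) \<Rightarrow> (real^'n \<Rightarrow> real) \<Rightarrow> real" where
  "Psi p E \<kappa> \<beta> \<mu> v = Psi1 p E \<kappa> v + Psi2 p E \<beta> v + Psi3 p E \<beta> v + Psi4 p E \<mu> v"

end

theory Submission
  imports Defs
begin

text \<open>
  Up to a factor \<open>h\<^sub>E\<^sup>2\<close> in two of them, the four terms of \<open>\<Psi>\<^sup>E\<close> are the squared \<open>L\<^sup>2\<close>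
  distances to the polynomials of discrete fields: a coefficient times \<open>\<Pi>\<^sup>0\<^sub>p u\<^sub>h\<close> or \<open>\<Pi>\<^sup>0\<^sub>p\<^sub>-\<^sub>1 \<nabla>u\<^sub>h\<close>.
  Since the orthogonal projection is the best approximation, \<open>osc(a)\<^sup>2 \<le> 2 osc(b)\<^sup>2 + 2\<parallel>a - b\<parallel>\<^sup>2\<close>
  for any two fields (\<open>osc_perturb\<close>, \<open>oscv_perturb\<close>).  With \<open>b\<close> the corresponding field of the exact
  solution, \<open>osc(b)\<close> is one of the data terms on the right-hand side.  The coefficients being bounded, it
  remains to bound \<open>\<Pi>\<^sup>0\<^sub>p u\<^sub>h - u\<close> and \<open>\<Pi>\<^sup>0\<^sub>p\<^sub>-\<^sub>1 \<nabla>u\<^sub>h - \<nabla>u\<close>; both are split at \<open>u\<^sub>h\<close>.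

  The parts \<open>u - u\<^sub>h\<close> and \<open>\<nabla>(u - u\<^sub>h)\<close> are bounded by the energy norm (\<open>energy_norm_lower\<close>).
  The part \<open>\<Pi>\<^sup>0\<^sub>p\<^sub>-\<^sub>1 \<nabla>u\<^sub>h - \<nabla>u\<^sub>h\<close> is at most \<open>\<nabla>(\<Pi>\<^sup>0\<^sub>p u\<^sub>h - u\<^sub>h)\<close> in norm, again by best
  approximation, because \<open>\<nabla>\<Pi>\<^sup>0\<^sub>p u\<^sub>h\<close> is a polynomial of degree \<open>p - 1\<close> (\<open>projv_grad_best\<close>).
  Finally \<open>\<Pi>\<^sup>0\<^sub>p u\<^sub>h - u\<^sub>h\<close> lies in the space on which the stabilisation is equivalent to the energy,
  so it and its gradient are bounded by \<open>S\<^sup>E\<close>.  The factors \<open>h\<^sub>E\<close> are at most the diameter of \<open>\<Omega>\<close>.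

  Four facts support this argument.  The energy norm is meaningful because elliptic symmetric matrices have
  square roots (\<open>ex_msqrt\<close>).  Projections onto polynomials exist and are unique (\<open>proj_ex1\<close>).  Weak
  gradients are unique up to null sets (\<open>has_wgrad_unique\<close>); hence they are linear, compatible with
  restriction to an element, and agree with classical gradients for polynomials.  And the local virtual
  element space is a vector space that contains the polynomials of degree \<open>p\<close> (\<open>elem_V_facts\<close>), which puts
  \<open>\<Pi>\<^sup>0\<^sub>p u\<^sub>h - u\<^sub>h\<close> into it; in three dimensions this also uses that the charts of the faces are affine
  and so preserve polynomial degree.

  All norms are compared through their squares, with \<open>|a + b|\<^sup>2 \<le> 2|a|\<^sup>2 + 2|b|\<^sup>2\<close> in place of the triangle
  inequality.
\<close>

section \<open>Square roots of elliptic matrices\<close>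

lemma inner_sym_matrix:
  fixes A :: "real^'n^'n"
  assumes "transpose A = A"
  shows "(A *v x) \<bullet> y = x \<bullet> (A *v y)"
  by (metis assms dot_lmul_matrix transpose_matrix_vector)

text \<open>Positivity of the form at \<open>x - X x / c\<close> gives \<open>|X x|\<^sup>2 \<le> c (x \<bullet>
  X x)\<close>, which bounds the operator norm by the largest value of the quadratic form.\<close>

lemma norm_sym_le:
  fixes X :: "'a::real_inner \<Rightarrow> 'a"
  assumes lin: "linear X" and sym: "\<And>x y. X x \<bullet> y = x \<bullet> X y"
    and pos: "\<And>x. 0 \<le> x \<bullet> X x" and le: "\<And>x. x \<bullet> X x \<le> c * (norm x)\<^sup>2" and c: "0 < c"
  shows "norm (X x) \<le> c * norm x"
proof -
  define y where "y = X x"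
  have "0 \<le> (x - (1/c) *\<^sub>R y) \<bullet> X (x - (1/c) *\<^sub>R y)" by (rule pos)
  also have "\<dots> = x \<bullet> y - 2 * (1/c) * (y \<bullet> y) + (1/c)\<^sup>2 * (y \<bullet> X y)"
    using sym[of x y] sym[of y x]
    by (simp add: linear_diff[OF lin] linear_scale[OF lin] inner_diff_left inner_diff_right y_def
        power2_eq_square inner_commute algebra_simps)
  also have "\<dots> \<le> x \<bullet> y - 2 * (1/c) * (y \<bullet> y) + (1/c)\<^sup>2 * (c * (norm y)\<^sup>2)"
    using mult_left_mono[OF le[of y], of "(1/c)\<^sup>2"] by simp
  also have "\<dots> = x \<bullet> y - (1/c) * (norm y)\<^sup>2"
    using c by (simp add: power2_norm_eq_inner[symmetric] power2_eq_square field_simps)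
  finally have "(norm y)\<^sup>2 \<le> c * (x \<bullet> y)" using c by (simp add: field_simps)
  also have "\<dots> \<le> c * (norm x * norm y)"
    using c norm_cauchy_schwarz by (intro mult_left_mono) auto
  finally have "norm y * norm y \<le> (c * norm x) * norm y" by (simp add: power2_eq_square algebra_simps)
  then show ?thesis
    using c by (cases "norm y = 0") (auto simp: y_def mult_le_cancel_right)
qed

text \<open>Divided by \<open>a + b\<close>, the matrix \<open>A\<close> equals \<open>1 - X\<close>, where
  \<open>X\<close> is positive semidefinite and has norm at most \<open>r = b / (a + b) < 1\<close>.
  A square root \<open>1 - Y\<close> of \<open>1 - X\<close> is found as the fixed point of a
  contraction on the closed set of symmetric \<open>Y\<close> with norm at most \<open>r\<close>;
  positivity of \<open>1 - Y\<close> follows from \<open>r < 1\<close>.\<close>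

lemma ex_msqrt:
  fixes A :: "real^'n^'n"
  assumes sym: "transpose A = A" and ab: "0 < a" "0 < b"
    and ell: "\<And>\<xi>. a * (norm \<xi>)\<^sup>2 \<le> \<xi> \<bullet> (A *v \<xi>)" "\<And>\<xi>. \<xi> \<bullet> (A *v \<xi>) \<le> b * (norm \<xi>)\<^sup>2"
  shows "\<exists>B. transpose B = B \<and> (\<forall>\<xi>. 0 \<le> \<xi> \<bullet> (B *v \<xi>)) \<and> B ** B = A"
proof -
  \<comment> \<open>Dividing by \<open>a + b\<close> rather than by \<open>b\<close> keeps \<open>r\<close> strictly between 0 and 1 even if \<open>a = b\<close>.\<close>
  define r where "r = b / (a + b)"
  have r: "0 < r" "r < 1" using ab by (auto simp: r_def)
  define X' where "X' x = x - (1 / (a + b)) *\<^sub>R (A *v x)" for x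
  have linX: "linear X'" unfolding X'_def
    by (intro linear_compose_sub linear_id[unfolded id_def] linear_compose_scale_right) simp
  have symX: "X' x \<bullet> y = x \<bullet> X' y" for x y
    by (simp add: X'_def inner_diff_left inner_diff_right inner_sym_matrix[OF sym])
  have eqX: "x \<bullet> X' x = x \<bullet> x - (x \<bullet> (A *v x)) / (a + b)" for x
    by (simp add: X'_def inner_diff_right)
  have posX: "0 \<le> x \<bullet> X' x" for x
  proof -
    have "x \<bullet> (A *v x) \<le> b * (x \<bullet> x) + a * (x \<bullet> x)"
      using ell(2)[of x] ab by (simp add: power2_norm_eq_inner add_increasing2)
    then show ?thesis using ab by (simp add: eqX field_simps)
  qed
  have leX: "x \<bullet> X' x \<le> r * (norm x)\<^sup>2" for x
  proof -
    have "x \<bullet> x - r * (x \<bullet> x) = a * (x \<bullet> x) / (a + b)" using ab by (simp add: r_def field_simps)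
    also have "\<dots> \<le> (x \<bullet> (A *v x)) / (a + b)"
      using ell(1)[of x] ab by (intro divide_right_mono) (auto simp: power2_norm_eq_inner)
    finally show ?thesis by (simp add: eqX power2_norm_eq_inner)
  qed
  have nX: "norm (X' x) \<le> r * norm x" for x
    by (rule norm_sym_le[OF linX symX posX leX r(1)])
  have bX: "bounded_linear X'" using linX by (simp add: linear_conv_bounded_linear)
  define X where "X = Blinfun X'"
  have X [simp]: "blinfun_apply X x = X' x" for x
    by (simp add: X_def bounded_linear_Blinfun_apply[OF bX])
  have normX: "norm X \<le> r" using r nX by (intro norm_blinfun_bound) auto
  \<comment> \<open>A solution \<open>Y\<close> of \<open>Y = (X + Y\<^sup>2) / 2\<close> satisfies \<open>(1 - Y)\<^sup>2 = 1 - X\<close>.\<close>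
  define F where "F Y = (1/2) *\<^sub>R (X + (Y o\<^sub>L Y))" for Y :: "(real^'n) \<Rightarrow>\<^sub>L (real^'n)"
  define K where "K = {Y :: (real^'n) \<Rightarrow>\<^sub>L (real^'n). norm Y \<le> r \<and> (\<forall>x y. blinfun_apply Y x \<bullet> y = x \<bullet> blinfun_apply Y y)}"
  have "closed K" unfolding K_def
    by (intro closed_Collect_conj closed_Collect_all closed_Collect_le closed_Collect_eq continuous_intros)
  then have K1: "complete K" by (simp add: complete_eq_closed)
  have K2: "0 \<in> K" using r by (auto simp: K_def)
  have K3: "F ` K \<subseteq> K"
  proof clarify
    fix Y assume Y: "Y \<in> K"
    then have nY: "norm Y \<le> r" and sY: "\<And>x y. blinfun_apply Y x \<bullet> y = x \<bullet> blinfun_apply Y y" by (auto simp: K_def)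
    have "norm (X + (Y o\<^sub>L Y)) \<le> norm X + norm (Y o\<^sub>L Y)" by (rule norm_triangle_ineq)
    also have "\<dots> \<le> r + r * r"
      using normX nY r norm_blinfun_compose[of Y Y] mult_mono[OF nY nY] by simp
    also have "\<dots> \<le> r + r * 1" using r by (intro add_left_mono mult_left_mono) auto
    finally have "norm (F Y) \<le> r" by (simp add: F_def)
    then show "F Y \<in> K"
      using sY by (simp add: K_def F_def blinfun.add_left blinfun.scaleR_left inner_add_left inner_add_right symX)
  qed
  have K4: "dist (F Y) (F Z) \<le> r * dist Y Z" if "Y \<in> K" "Z \<in> K" for Y Z
  proof -
    have n: "norm Y \<le> r" "norm Z \<le> r" using that by (auto simp: K_def)
    have "F Y - F Z = (1/2) *\<^sub>R ((Y o\<^sub>L (Y - Z)) + ((Y - Z) o\<^sub>L Z))"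
      by (rule blinfun_eqI) (simp add: F_def blinfun.bilinear_simps scaleR_diff_right algebra_simps)
    then have "norm (F Y - F Z) \<le> (1/2) * (norm (Y o\<^sub>L (Y - Z)) + norm ((Y - Z) o\<^sub>L Z))"
      by (simp add: norm_triangle_ineq)
    also have "\<dots> \<le> (1/2) * (r * norm (Y - Z) + norm (Y - Z) * r)"
      using n r norm_blinfun_compose[of Y "Y - Z"] norm_blinfun_compose[of "Y - Z" Z]
        mult_right_mono[OF n(1), of "norm (Y - Z)"] mult_left_mono[OF n(2), of "norm (Y - Z)"]
      by (simp add: algebra_simps)
    finally show ?thesis by (simp add: dist_norm)
  qed
  have "\<exists>!Y\<in>K. F Y = Y"
    by (rule Banach_fix[OF K1 _ _ r(2) K3 K4]) (use K2 r in auto)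
  then obtain Y where YK: "Y \<in> K" and FY: "F Y = Y" by blast
  have Y2: "blinfun_apply Y (blinfun_apply Y x) = 2 *\<^sub>R blinfun_apply Y x - X' x" for x
  proof -
    have "(2::real) *\<^sub>R blinfun_apply Y x = 2 *\<^sub>R blinfun_apply (F Y) x" by (simp add: FY)
    then show ?thesis by (simp add: F_def blinfun.bilinear_simps)
  qed
  have sY: "blinfun_apply Y x \<bullet> y = x \<bullet> blinfun_apply Y y" for x y using YK by (auto simp: K_def)
  define R where "R x = sqrt (a + b) *\<^sub>R (x - blinfun_apply Y x)" for x
  have linR: "linear R" unfolding R_def
    by (intro linear_compose_sub linear_id[unfolded id_def] linear_compose_scale_right)
      (simp add: linear_conv_bounded_linear blinfun.bounded_linear_right)
  define B where "B = matrix R"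
  have B: "B *v x = R x" for x using matrix_vector_mul(2)[OF linR] by (simp add: B_def fun_eq_iff)
  have symR: "R x \<bullet> y = x \<bullet> R y" for x y by (simp add: R_def inner_diff_left inner_diff_right sY)
  have "transpose B = B"
  proof -
    have "transpose B *v x = B *v x" for x
    proof (rule vector_eq_ldot[THEN iffD1], intro allI)
      fix z show "z \<bullet> (transpose B *v x) = z \<bullet> (B *v x)"
        by (metis B dot_lmul_matrix inner_commute symR transpose_matrix_vector)
    qed
    then show ?thesis by (simp add: matrix_eq)
  qed
  moreover have "0 \<le> \<xi> \<bullet> (B *v \<xi>)" for \<xi>
  proof -
    have "\<xi> \<bullet> blinfun_apply Y \<xi> \<le> norm \<xi> * norm (blinfun_apply Y \<xi>)" by (rule norm_cauchy_schwarz)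
    also have "\<dots> \<le> norm \<xi> * (r * norm \<xi>)"
      using YK norm_blinfun[of Y \<xi>] mult_right_mono[of "norm Y" r "norm \<xi>"]
      by (intro mult_left_mono) (auto simp: K_def)
    also have "\<dots> \<le> norm \<xi> * (1 * norm \<xi>)" using r by (intro mult_left_mono mult_right_mono) auto
    finally show ?thesis
      using ab by (simp add: B R_def inner_diff_right dot_square_norm power2_eq_square)
  qed
  moreover have "B ** B = A"
  proof -
    have "(B ** B) *v x = A *v x" for x
    proof -
      have "(B ** B) *v x = R (R x)" by (simp add: matrix_vector_mul_assoc[symmetric] B)
      also have "R (R x) = sqrt (a + b) *\<^sub>R sqrt (a + b) *\<^sub>R (x - blinfun_apply Y x - blinfun_apply Y (x - blinfun_apply Y x))"
        by (simp only: R_def[of x] linear_scale[OF linR]) (simp only: R_def)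
      also have "\<dots> = (a + b) *\<^sub>R (x - blinfun_apply Y x - blinfun_apply Y (x - blinfun_apply Y x))"
        using ab by (simp only: scaleR_scaleR) simp
      also have "\<dots> = (a + b) *\<^sub>R (x - X' x)"
        by (simp add: blinfun.bilinear_simps Y2 scaleR_2)
      also have "\<dots> = A *v x" using ab by (simp add: X'_def)
      finally show ?thesis .
    qed
    then show ?thesis by (simp add: matrix_eq)
  qed
  ultimately show ?thesis by blast
qed

lemma norm_msqrt_mult:
  fixes A :: "real^'n^'n"
  assumes "transpose A = A" "0 < a" "0 < b"
    and "\<And>\<xi>. a * (norm \<xi>)\<^sup>2 \<le> \<xi> \<bullet> (A *v \<xi>)" "\<And>\<xi>. \<xi> \<bullet> (A *v \<xi>) \<le> b * (norm \<xi>)\<^sup>2"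
  shows "(norm (msqrt A *v \<xi>))\<^sup>2 = \<xi> \<bullet> (A *v \<xi>)"
proof -
  have "transpose (msqrt A) = msqrt A \<and> (\<forall>\<xi>. 0 \<le> \<xi> \<bullet> (msqrt A *v \<xi>)) \<and> msqrt A ** msqrt A = A"
    unfolding msqrt_def by (rule someI_ex, rule ex_msqrt[OF assms])
  then show ?thesis
    by (metis inner_sym_matrix matrix_vector_mul_assoc power2_norm_eq_inner)
qed

lemma norm_elliptic_mult:
  fixes A :: "real^'n^'n"
  assumes "transpose A = A" "0 < a" "0 < b"
    and "\<And>\<xi>. a * (norm \<xi>)\<^sup>2 \<le> \<xi> \<bullet> (A *v \<xi>)" "\<And>\<xi>. \<xi> \<bullet> (A *v \<xi>) \<le> b * (norm \<xi>)\<^sup>2"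
  shows "norm (A *v \<xi>) \<le> b * norm \<xi>"
proof (rule norm_sym_le)
  show "0 \<le> x \<bullet> (A *v x)" for x
    using assms(4)[of x] assms(2) by (smt (verit) mult_nonneg_nonneg zero_le_power2)
qed (use assms inner_sym_matrix in auto)

section \<open>Square-integrable functions\<close>

text \<open>Lebesgue measure is complete, so measurability passes to functions that agree almost everywhere.
  This is what makes the pointwise values of \<open>wgrad\<close> and \<open>msqrt\<close>, which
  are obtained by choice, harmless in integrals.\<close>

lemma measurable_AE_lebesgue_on:
  fixes f g :: "real^'n \<Rightarrow> 'b::euclidean_space"
  assumes U: "U \<in> sets lebesgue" and f: "f \<in> borel_measurable (lebesgue_on U)"
    and eq: "AE x in lebesgue_on U. f x = g x"
  shows "g \<in> borel_measurable (lebesgue_on U)"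
proof -
  have "(\<lambda>x. if x \<in> U then f x else 0) \<in> borel_measurable lebesgue"
    using f U by (simp add: borel_measurable_if)
  moreover have "AE x in lebesgue. (if x \<in> U then f x else 0) = (if x \<in> U then g x else 0)"
    using eq U by (subst (asm) AE_restrict_space_iff) (auto elim: eventually_mono)
  ultimately have "(\<lambda>x. if x \<in> U then g x else 0) \<in> borel_measurable lebesgue"
    by (rule borel_measurable_AE)
  then show ?thesis by (rule borel_measurable_if_D)
qed

lemma AE_lebesgue_on_subset:
  assumes "AE x in lebesgue_on V. P x" "U \<subseteq> V" "U \<in> sets lebesgue" "V \<in> sets lebesgue"
  shows "AE x in lebesgue_on U. P x"
proof -
  have "AE x in lebesgue. x \<in> V \<longrightarrow> P x" using assms by (subst (asm) AE_restrict_space_iff) auto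
  then have "AE x in lebesgue. x \<in> U \<longrightarrow> P x" using assms(2) by (auto elim: eventually_mono)
  then show ?thesis using assms(3) by (subst AE_restrict_space_iff) auto
qed

lemma integral_AE_lebesgue_on:
  fixes f g :: "real^'n \<Rightarrow> 'b::euclidean_space"
  assumes "U \<in> sets lebesgue" "f \<in> borel_measurable (lebesgue_on U)" "AE x in lebesgue_on U. f x = g x"
  shows "integral\<^sup>L (lebesgue_on U) f = integral\<^sup>L (lebesgue_on U) g"
  using measurable_AE_lebesgue_on[OF assms] assms by (intro integral_cong_AE) auto

lemma L2_measurable: "f \<in> L2 U \<Longrightarrow> f \<in> borel_measurable (lebesgue_on U)"
  and L2_integrable: "f \<in> L2 U \<Longrightarrow> integrable (lebesgue_on U) (\<lambda>x. (norm (f x))\<^sup>2)"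
  by (auto simp: L2_def)

lemma L2norm_sq: "(L2norm U f)\<^sup>2 = (\<integral>x. (norm (f x))\<^sup>2 \<partial>(lebesgue_on U))"
  by (simp add: L2norm_def)

text \<open>All coefficient bounds are applied in this form.\<close>

lemma L2_dominated:
  fixes f :: "real^'n \<Rightarrow> 'b::euclidean_space" and g :: "real^'n \<Rightarrow> 'c::euclidean_space"
  assumes f: "f \<in> borel_measurable (lebesgue_on U)" and g: "g \<in> L2 U"
    and le: "AE x in lebesgue_on U. norm (f x) \<le> M * norm (g x)"
  shows "f \<in> L2 U" "(L2norm U f)\<^sup>2 \<le> M\<^sup>2 * (L2norm U g)\<^sup>2"
proof -
  have le2: "AE x in lebesgue_on U. (norm (f x))\<^sup>2 \<le> M\<^sup>2 * (norm (g x))\<^sup>2"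
    using le by eventually_elim (metis norm_ge_zero power_mono power_mult_distrib)
  have ig: "integrable (lebesgue_on U) (\<lambda>x. M\<^sup>2 * (norm (g x))\<^sup>2)" using L2_integrable[OF g] by simp
  have "integrable (lebesgue_on U) (\<lambda>x. (norm (f x))\<^sup>2)"
    using ig by (rule Bochner_Integration.integrable_bound) (use f le2 in \<open>auto elim: eventually_mono\<close>)
  then show "f \<in> L2 U" using f by (simp add: L2_def)
  then show "(L2norm U f)\<^sup>2 \<le> M\<^sup>2 * (L2norm U g)\<^sup>2"
    using integral_mono_AE[OF L2_integrable ig le2] by (simp add: L2norm_sq)
qed

lemma L2_AE:
  fixes f g :: "real^'n \<Rightarrow> 'b::euclidean_space"
  assumes U: "U \<in> sets lebesgue" and f: "f \<in> L2 U" and eq: "AE x in lebesgue_on U. f x = g x"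
  shows "g \<in> L2 U" "L2norm U f = L2norm U g"
proof -
  have g: "g \<in> borel_measurable (lebesgue_on U)"
    by (rule measurable_AE_lebesgue_on[OF U L2_measurable[OF f] eq])
  show "g \<in> L2 U"
    by (rule L2_dominated(1)[OF g f, of 1]) (use eq in \<open>auto elim: eventually_mono\<close>)
  show "L2norm U f = L2norm U g"
    unfolding L2norm_def using f g eq
    by (intro arg_cong[where f=sqrt] integral_cong_AE) (auto simp: L2_def elim: eventually_mono)
qed

lemma norm_add_sq_le: "(norm (a + b))\<^sup>2 \<le> 2 * (norm a)\<^sup>2 + 2 * (norm (b::'a::real_normed_vector))\<^sup>2"
proof -
  have "(norm (a + b))\<^sup>2 \<le> (norm a + norm b)\<^sup>2" by (intro power_mono norm_triangle_ineq) auto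
  also have "\<dots> \<le> 2 * (norm a)\<^sup>2 + 2 * (norm b)\<^sup>2"
    using sum_squares_bound[of "norm a" "norm b"] by (simp add: power2_sum)
  finally show ?thesis .
qed

lemma L2_add:
  fixes f g :: "real^'n \<Rightarrow> 'b::euclidean_space"
  assumes f: "f \<in> L2 U" and g: "g \<in> L2 U"
  shows "(\<lambda>x. f x + g x) \<in> L2 U"
    "(L2norm U (\<lambda>x. f x + g x))\<^sup>2 \<le> 2 * (L2norm U f)\<^sup>2 + 2 * (L2norm U g)\<^sup>2"
proof -
  have m: "(\<lambda>x. f x + g x) \<in> borel_measurable (lebesgue_on U)"
    using L2_measurable[OF f] L2_measurable[OF g] by measurable
  have i: "integrable (lebesgue_on U) (\<lambda>x. 2 * (norm (f x))\<^sup>2 + 2 * (norm (g x))\<^sup>2)"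
    using L2_integrable[OF f] L2_integrable[OF g] by simp
  have "integrable (lebesgue_on U) (\<lambda>x. (norm (f x + g x))\<^sup>2)"
    using i by (rule Bochner_Integration.integrable_bound) (use m norm_add_sq_le in auto)
  then show "(\<lambda>x. f x + g x) \<in> L2 U" using m by (simp add: L2_def)
  then show "(L2norm U (\<lambda>x. f x + g x))\<^sup>2 \<le> 2 * (L2norm U f)\<^sup>2 + 2 * (L2norm U g)\<^sup>2"
    using integral_mono[OF L2_integrable i norm_add_sq_le] L2_integrable[OF f] L2_integrable[OF g]
    by (simp add: L2norm_sq)
qed

lemma L2_scale:
  fixes f :: "real^'n \<Rightarrow> 'b::euclidean_space"
  assumes f: "f \<in> L2 U"
  shows "(\<lambda>x. c *\<^sub>R f x) \<in> L2 U" "(L2norm U (\<lambda>x. c *\<^sub>R f x))\<^sup>2 = c\<^sup>2 * (L2norm U f)\<^sup>2"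
  using f by (auto simp: L2_def L2norm_sq power_mult_distrib)

lemma L2_diff:
  fixes f g :: "real^'n \<Rightarrow> 'b::euclidean_space"
  assumes f: "f \<in> L2 U" and g: "g \<in> L2 U"
  shows "(\<lambda>x. f x - g x) \<in> L2 U"
    "(L2norm U (\<lambda>x. f x - g x))\<^sup>2 \<le> 2 * (L2norm U f)\<^sup>2 + 2 * (L2norm U g)\<^sup>2"
  using L2_add[OF f L2_scale(1)[OF g, of "-1"]] L2_scale(2)[OF g, of "-1"] by auto

lemma L2_zero: "(\<lambda>x. 0) \<in> L2 U"
  by (simp add: L2_def)

lemma L2norm_commute: "L2norm U (\<lambda>x. f x - g x) = L2norm U (\<lambda>x. g x - f x)"
  by (simp add: L2norm_def norm_minus_commute)

lemma L2_sum:
  fixes f :: "'i \<Rightarrow> real^'n \<Rightarrow> 'b::euclidean_space"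
  assumes "\<And>i. i \<in> A \<Longrightarrow> f i \<in> L2 U"
  shows "(\<lambda>x. \<Sum>i\<in>A. f i x) \<in> L2 U"
  using assms by (induction A rule: infinite_finite_induct) (auto simp: L2_zero L2_add)

lemma L2_inner_integrable:
  fixes f g :: "real^'n \<Rightarrow> 'b::euclidean_space"
  assumes f: "f \<in> L2 U" and g: "g \<in> L2 U"
  shows "integrable (lebesgue_on U) (\<lambda>x. f x \<bullet> g x)"
proof -
  have m: "(\<lambda>x. f x \<bullet> g x) \<in> borel_measurable (lebesgue_on U)"
    using L2_measurable[OF f] L2_measurable[OF g] by measurable
  have i: "integrable (lebesgue_on U) (\<lambda>x. (norm (f x))\<^sup>2 + (norm (g x))\<^sup>2)"
    using L2_integrable[OF f] L2_integrable[OF g] by simp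
  have le: "\<bar>f x \<bullet> g x\<bar> \<le> (norm (f x))\<^sup>2 + (norm (g x))\<^sup>2" for x
  proof -
    have "\<bar>f x \<bullet> g x\<bar> \<le> norm (f x) * norm (g x)" by (rule Cauchy_Schwarz_ineq2)
    moreover have "2 * norm (f x) * norm (g x) \<le> (norm (f x))\<^sup>2 + (norm (g x))\<^sup>2"
      by (rule sum_squares_bound)
    moreover have "0 \<le> norm (f x) * norm (g x)" by simp
    ultimately show ?thesis by linarith
  qed
  show ?thesis using i m by (rule Bochner_Integration.integrable_bound) (use le in auto)
qed

lemma ip_diff_left:
  fixes f g h :: "real^'n \<Rightarrow> 'b::euclidean_space"
  assumes "f \<in> L2 U" "g \<in> L2 U" "h \<in> L2 U"
  shows "ip U (\<lambda>x. f x - g x) h = ip U f h - ip U g h"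
  using assms by (simp add: ip_def inner_diff_left L2_inner_integrable)

lemma ip_lincomb_scaleR:
  fixes f g h :: "real^'n \<Rightarrow> 'b::euclidean_space"
  assumes "f \<in> L2 U" "g \<in> L2 U" "h \<in> L2 U"
  shows "ip U (\<lambda>x. a *\<^sub>R f x + b *\<^sub>R g x) h = a * ip U f h + b * ip U g h"
  using assms by (simp add: ip_def inner_add_left L2_inner_integrable)

lemma ip_lincomb_left:
  fixes f g h :: "real^'n \<Rightarrow> real"
  assumes "f \<in> L2 U" "g \<in> L2 U" "h \<in> L2 U"
  shows "ip U (\<lambda>x. a * f x + b * g x) h = a * ip U f h + b * ip U g h"
  using ip_lincomb_scaleR[OF assms] by simp

lemma ip_commute: "ip U f g = ip U g f"
  by (simp add: ip_def inner_commute)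

lemma ip_self: "ip U f f = (L2norm U f)\<^sup>2"
  by (simp add: ip_def L2norm_sq power2_norm_eq_inner)

lemma L2_component:
  fixes f :: "real^'n \<Rightarrow> real^'m"
  shows "f \<in> L2 U \<longleftrightarrow> (\<forall>i. (\<lambda>x. f x $ i) \<in> L2 U)"
proof safe
  fix i assume f: "f \<in> L2 U"
  then have "(\<lambda>x. f x \<bullet> axis i 1) \<in> borel_measurable (lebesgue_on U)"
    by (intro borel_measurable_inner) (auto simp: L2_def)
  then show "(\<lambda>x. f x $ i) \<in> L2 U"
    by (intro L2_dominated(1)[OF _ f, of _ 1]) (auto simp: inner_axis component_le_norm_cart intro!: AE_I2)
next
  assume f: "\<forall>i. (\<lambda>x. f x $ i) \<in> L2 U"
  have "(\<lambda>x. \<Sum>i\<in>UNIV. (f x $ i) *\<^sub>R axis i (1::real)) \<in> L2 U"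
  proof (rule L2_sum)
    fix i
    have "(\<lambda>x. (f x $ i) *\<^sub>R axis i (1::real) :: real^'m) \<in> borel_measurable (lebesgue_on U)"
      using f by (intro borel_measurable_scaleR) (auto simp: L2_def)
    then show "(\<lambda>x. (f x $ i) *\<^sub>R axis i (1::real)  :: real^'m) \<in> L2 U"
      by (rule L2_dominated(1)[OF _ f[rule_format, of i], of _ 1]) (auto simp: norm_axis_1)
  qed
  moreover have "(\<lambda>x. \<Sum>i\<in>UNIV. (f x $ i) *\<^sub>R axis i (1::real)) = f"
    by (simp add: fun_eq_iff vec_eq_iff axis_def if_distrib cong: if_cong)
  ultimately show "f \<in> L2 U" by simp
qed

lemma L2norm_components:
  fixes f :: "real^'n \<Rightarrow> real^'m"
  assumes "f \<in> L2 U"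
  shows "(L2norm U f)\<^sup>2 = (\<Sum>i\<in>UNIV. (L2norm U (\<lambda>x. f x $ i))\<^sup>2)"
proof -
  have "(L2norm U f)\<^sup>2 = (\<integral>x. (\<Sum>i\<in>UNIV. (norm (f x $ i))\<^sup>2) \<partial>(lebesgue_on U))"
    unfolding L2norm_sq by (simp add: power2_norm_eq_inner inner_vec_def flip: power2_eq_square)
  also have "\<dots> = (\<Sum>i\<in>UNIV. (L2norm U (\<lambda>x. f x $ i))\<^sup>2)"
    using assms unfolding L2norm_sq
    by (intro Bochner_Integration.integral_sum) (metis L2_component L2_integrable)
  finally show ?thesis .
qed

lemma L2_subset:
  fixes f :: "real^'n \<Rightarrow> 'b::euclidean_space"
  assumes f: "f \<in> L2 V" and UV: "U \<subseteq> V" and U: "U \<in> sets lebesgue" and V: "V \<in> sets lebesgue"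
  shows "f \<in> L2 U"
proof -
  have "set_integrable lebesgue V (\<lambda>x. (norm (f x))\<^sup>2)"
    using f V by (simp add: set_integrable_def L2_def integrable_restrict_space)
  then have "set_integrable lebesgue U (\<lambda>x. (norm (f x))\<^sup>2)"
    using U UV by (rule set_integrable_subset)
  then have "integrable (lebesgue_on U) (\<lambda>x. (norm (f x))\<^sup>2)"
    using U by (simp add: set_integrable_def integrable_restrict_space)
  moreover have "f \<in> borel_measurable (lebesgue_on U)"
    using f UV by (auto simp: L2_def intro: measurable_restrict_mono)
  ultimately show ?thesis by (simp add: L2_def)
qed

lemma L2_integrable_finite:
  fixes f :: "real^'n \<Rightarrow> 'b::euclidean_space"
  assumes f: "f \<in> L2 U" and U: "U \<in> lmeasurable"
  shows "integrable (lebesgue_on U) f"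
proof -
  interpret finite_measure "lebesgue_on U" using U by (rule finite_measure_lebesgue_on)
  have "integrable (lebesgue_on U) (\<lambda>x. 1 + (norm (f x))\<^sup>2)"
    using L2_integrable[OF f] by simp
  moreover have "norm (f x) \<le> norm (1 + (norm (f x))\<^sup>2)" for x
    using sum_squares_bound[of "norm (f x)" 1] norm_ge_zero[of "f x"] by (simp del: norm_ge_zero)
  ultimately show ?thesis
    using Bochner_Integration.integrable_bound[OF _ L2_measurable[OF f]] by blast
qed

lemma L2_continuous_bounded:
  fixes f :: "real^'n \<Rightarrow> 'b::euclidean_space"
  assumes f: "continuous_on UNIV f" and U: "bounded U" "U \<in> sets lebesgue"
  shows "f \<in> L2 U"
proof -
  have "compact (f ` closure U)"
    using U f by (intro compact_continuous_image) (auto intro: continuous_on_subset)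
  then obtain B where B: "\<And>x. x \<in> closure U \<Longrightarrow> norm (f x) \<le> B"
    by (meson bounded_iff compact_imp_bounded imageI)
  have m: "f \<in> borel_measurable (lebesgue_on U)"
    using f by (intro continuous_imp_measurable_on_sets_lebesgue[OF _ U(2)])
      (auto intro: continuous_on_subset)
  have Um: "U \<in> lmeasurable" using U by (simp add: bounded_set_imp_lmeasurable)
  interpret finite_measure "lebesgue_on U" using Um by (rule finite_measure_lebesgue_on)
  have one: "(\<lambda>x. 1::real) \<in> L2 U" by (simp add: L2_def)
  have "norm (f x) \<le> B" if "x \<in> U" for x using B closure_subset that by blast
  then show ?thesis
    by (intro L2_dominated(1)[OF m one, of B]) (auto intro!: AE_I2)
qed

lemma integral_lebesgue_on_subset:
  fixes f :: "real^'n \<Rightarrow> 'b::euclidean_space"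
  assumes "U \<subseteq> V" "U \<in> sets lebesgue" "V \<in> sets lebesgue" "\<And>x. x \<in> V - U \<Longrightarrow> f x = 0"
  shows "integral\<^sup>L (lebesgue_on U) f = integral\<^sup>L (lebesgue_on V) f"
proof -
  have "integral\<^sup>L (lebesgue_on U) f = integral\<^sup>L (lebesgue_on V) (\<lambda>x. if x \<in> U then f x else 0)"
    by (rule integral_restrict[OF assms(1-3), symmetric])
  also have "\<dots> = integral\<^sup>L (lebesgue_on V) f"
    using assms(4) by (intro Bochner_Integration.integral_cong) auto
  finally show ?thesis .
qed

section \<open>Polynomials in several variables\<close>

definition vmonom :: "('n::finite \<Rightarrow> nat) \<Rightarrow> real^'n \<Rightarrow> real" where
  "vmonom \<alpha> x = (\<Prod>i\<in>UNIV. (x $ i) ^ \<alpha> i)"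

lemma finite_multi_indices: "finite {\<alpha> :: 'n::finite \<Rightarrow> nat. sum \<alpha> UNIV \<le> l}"
proof (rule finite_subset)
  show "{\<alpha> :: 'n \<Rightarrow> nat. sum \<alpha> UNIV \<le> l} \<subseteq> (\<Pi>\<^sub>E i \<in> UNIV. {..l})"
  proof clarify
    fix \<alpha> :: "'n \<Rightarrow> nat" assume a: "sum \<alpha> UNIV \<le> l"
    have "\<alpha> i \<le> sum \<alpha> UNIV" for i by (rule member_le_sum) auto
    then show "\<alpha> \<in> (\<Pi>\<^sub>E i \<in> UNIV. {..l})" using a by (auto intro: order_trans)
  qed
qed (auto intro: finite_PiE)

lemma poly_fun_iff:
  "q \<in> poly_fun l \<longleftrightarrow> (\<exists>c. q = (\<lambda>x. \<Sum>\<alpha> | sum \<alpha> UNIV \<le> l. c \<alpha> * vmonom \<alpha> x))"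
  by (simp add: poly_fun_def vmonom_def)

lemma vmonom_in_poly_fun:
  assumes "sum \<alpha> UNIV \<le> l" shows "vmonom \<alpha> \<in> poly_fun l"
proof -
  have "(\<Sum>\<beta> | sum \<beta> UNIV \<le> l. (if \<beta> = \<alpha> then 1 else 0) * vmonom \<beta> x) = vmonom \<alpha> x" for x
    using assms sum.delta[OF finite_multi_indices[of l], of \<alpha> "\<lambda>\<beta>. vmonom \<beta> x"]
    by (simp add: if_distrib[of "\<lambda>c. c * _"] cong: if_cong)
  then show ?thesis unfolding poly_fun_iff
    by (intro exI[of _ "\<lambda>\<beta>. if \<beta> = \<alpha> then 1 else 0"]) simp
qed

lemma poly_fun_lincomb:
  assumes "q \<in> poly_fun l" "r \<in> poly_fun l"
  shows "(\<lambda>x. a * q x + b * r x) \<in> poly_fun l"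
proof -
  obtain c d where "q = (\<lambda>x. \<Sum>\<alpha> | sum \<alpha> UNIV \<le> l. c \<alpha> * vmonom \<alpha> x)"
    "r = (\<lambda>x. \<Sum>\<alpha> | sum \<alpha> UNIV \<le> l. d \<alpha> * vmonom \<alpha> x)"
    using assms by (auto simp: poly_fun_iff)
  then show ?thesis unfolding poly_fun_iff
    by (intro exI[of _ "\<lambda>\<alpha>. a * c \<alpha> + b * d \<alpha>"])
      (simp add: sum_distrib_left sum.distrib[symmetric] algebra_simps)
qed

lemma poly_fun_zero: "(\<lambda>x. 0) \<in> poly_fun l"
  unfolding poly_fun_iff by (intro exI[of _ "\<lambda>_. 0"]) simp

lemma poly_fun_add: "q \<in> poly_fun l \<Longrightarrow> r \<in> poly_fun l \<Longrightarrow> (\<lambda>x. q x + r x) \<in> poly_fun l"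
  and poly_fun_scale: "q \<in> poly_fun l \<Longrightarrow> (\<lambda>x. a * q x) \<in> poly_fun l"
  and poly_fun_diff: "q \<in> poly_fun l \<Longrightarrow> r \<in> poly_fun l \<Longrightarrow> (\<lambda>x. q x - r x) \<in> poly_fun l"
  using poly_fun_lincomb[of q l r 1 1] poly_fun_lincomb[of q l "\<lambda>x. 0" a 0]
    poly_fun_lincomb[of q l r 1 "-1"] poly_fun_zero by auto

lemma poly_fun_sum:
  assumes "\<And>i. i \<in> A \<Longrightarrow> q i \<in> poly_fun l" shows "(\<lambda>x. \<Sum>i\<in>A. q i x) \<in> poly_fun l"
  using assms by (induction A rule: infinite_finite_induct) (auto intro: poly_fun_zero poly_fun_add)

lemma poly_fun_induct [consumes 1, case_names zero monom lincomb]: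
  assumes q: "q \<in> poly_fun l" and zero: "P (\<lambda>x. 0)"
    and monom: "\<And>\<alpha>. sum \<alpha> UNIV \<le> l \<Longrightarrow> P (vmonom \<alpha>)"
    and lincomb: "\<And>f g a. P f \<Longrightarrow> P g \<Longrightarrow> P (\<lambda>x. a * f x + g x)"
  shows "P q"
proof -
  obtain c where qc: "q = (\<lambda>x. \<Sum>\<alpha> | sum \<alpha> UNIV \<le> l. c \<alpha> * vmonom \<alpha> x)"
    using q by (auto simp: poly_fun_iff)
  have "P (\<lambda>x. \<Sum>\<alpha>\<in>A. c \<alpha> * vmonom \<alpha> x)" if "A \<subseteq> {\<alpha>. sum \<alpha> UNIV \<le> l}" for A
    using finite_subset[OF that finite_multi_indices] that
    by (induction A) (auto intro!: lincomb monom zero)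
  then show ?thesis by (simp add: qc)
qed

lemma poly_fun_mono:
  assumes "q \<in> poly_fun l" "l \<le> k" shows "q \<in> poly_fun k"
  using assms(1)
  by (induction rule: poly_fun_induct)
    (use assms(2) in \<open>auto intro: poly_fun_zero poly_fun_add poly_fun_scale vmonom_in_poly_fun\<close>)

lemma vmonom_mult: "vmonom \<alpha> x * vmonom \<beta> x = vmonom (\<lambda>i. \<alpha> i + \<beta> i) x"
  by (simp add: vmonom_def power_add prod.distrib)

lemma poly_fun_mult:
  assumes "q \<in> poly_fun l" "r \<in> poly_fun k" shows "(\<lambda>x. q x * r x) \<in> poly_fun (l + k)"
  using assms(1)
proof (induction rule: poly_fun_induct)
  case (monom \<alpha>)
  show ?case using assms(2)
  proof (induction rule: poly_fun_induct)
    case zero then show ?case by (simp add: poly_fun_zero)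
  next
    case (monom \<beta>)
    then show ?case using \<open>sum \<alpha> UNIV \<le> l\<close>
      by (auto simp: vmonom_mult sum.distrib intro!: vmonom_in_poly_fun)
  next
    case (lincomb f g a)
    then show ?case using poly_fun_lincomb[OF lincomb, of a 1] by (simp add: algebra_simps)
  qed
next
  case (lincomb f g a)
  then show ?case using poly_fun_lincomb[OF lincomb, of a 1] by (simp add: algebra_simps)
qed (simp add: poly_fun_zero)

lemma poly_fun_const: "(\<lambda>x. a) \<in> poly_fun l"
  using poly_fun_scale[OF vmonom_in_poly_fun[of "\<lambda>_. 0" l], of a] by (simp add: vmonom_def)

lemma vmonom_step:
  assumes "0 < \<alpha> j" shows "vmonom \<alpha> x = x $ j * vmonom (\<alpha>(j := \<alpha> j - 1)) x"
proof -
  have "vmonom \<alpha> x = x $ j ^ \<alpha> j * (\<Prod>i\<in>UNIV - {j}. x $ i ^ \<alpha> i)"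
    unfolding vmonom_def by (rule prod.remove) auto
  moreover have "vmonom (\<alpha>(j := \<alpha> j - 1)) x = x $ j ^ (\<alpha> j - 1) * (\<Prod>i\<in>UNIV - {j}. x $ i ^ \<alpha> i)"
    unfolding vmonom_def by (subst prod.remove[of _ j]) (auto intro!: prod.cong)
  moreover have "x $ j ^ \<alpha> j = x $ j * x $ j ^ (\<alpha> j - 1)"
    using assms by (simp add: power_eq_if)
  ultimately show ?thesis by simp
qed

lemma sum_decrement:
  fixes \<alpha> :: "'n::finite \<Rightarrow> nat"
  assumes "0 < \<alpha> j" shows "sum \<alpha> UNIV = Suc (sum (\<alpha>(j := \<alpha> j - 1)) UNIV)"
proof -
  have "sum \<alpha> UNIV = \<alpha> j + sum \<alpha> (UNIV - {j})" by (rule sum.remove) auto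
  moreover have "sum (\<alpha>(j := \<alpha> j - 1)) UNIV = \<alpha> j - 1 + sum \<alpha> (UNIV - {j})"
    by (subst sum.remove[of _ j]) (auto intro!: sum.cong)
  ultimately show ?thesis using assms by simp
qed

lemma poly_fun_coord: "(\<lambda>x. x $ j) \<in> poly_fun (Suc l)"
proof -
  have "vmonom (\<lambda>i. if i = j then 1 else 0) = (\<lambda>x. x $ j)"
  proof
    fix x :: "real^'a"
    have "vmonom ((\<lambda>i. if i = j then 1 else 0)(j := 0)) x = 1"
      unfolding vmonom_def by (rule prod.neutral) auto
    then show "vmonom (\<lambda>i. if i = j then 1 else 0) x = x $ j"
      using vmonom_step[of "\<lambda>i. if i = j then 1 else 0" j x] by simp
  qed
  then show ?thesis using vmonom_in_poly_fun[of "\<lambda>i. if i = j then 1 else 0" "Suc l"] by simp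
qed

lemma poly_fun_power:
  assumes "q \<in> poly_fun l" shows "(\<lambda>x. q x ^ k) \<in> poly_fun (k * l)"
proof (induction k)
  case (Suc k)
  show ?case using poly_fun_mult[OF assms Suc] by simp
qed (simp add: poly_fun_const)

lemma poly_fun_prod:
  assumes "finite A" "\<And>i. i \<in> A \<Longrightarrow> q i \<in> poly_fun (d i)"
  shows "(\<lambda>x. \<Prod>i\<in>A. q i x) \<in> poly_fun (sum d A)"
  using assms
proof (induction A rule: finite_induct)
  case (insert i A)
  show ?case using poly_fun_mult[of "q i" "d i" "\<lambda>x. \<Prod>i\<in>A. q i x" "sum d A"] insert by simp
qed (simp add: poly_fun_const)

text \<open>Needed to pass between a planar face and its chart.\<close>

lemma poly_fun_affine_comp:
  fixes \<phi> :: "real^'m \<Rightarrow> real^'n"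
  assumes q: "q \<in> poly_fun l" and \<phi>: "\<And>i. (\<lambda>x. \<phi> x $ i) \<in> poly_fun 1"
  shows "q \<circ> \<phi> \<in> poly_fun l"
  using q
proof (induction rule: poly_fun_induct)
  case (monom \<alpha>)
  have "(\<lambda>x. \<Prod>i\<in>UNIV. (\<phi> x $ i) ^ \<alpha> i) \<in> poly_fun (sum \<alpha> UNIV)"
  proof (rule poly_fun_prod)
    show "(\<lambda>x. (\<phi> x $ i) ^ \<alpha> i) \<in> poly_fun (\<alpha> i)" for i
      using poly_fun_power[OF \<phi>[of i], of "\<alpha> i"] by simp
  qed simp
  then show ?case using monom by (simp add: comp_def vmonom_def poly_fun_mono)
next
  case (lincomb f g a)
  then show ?case using poly_fun_lincomb[OF lincomb, of a 1] by (simp add: comp_def)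
qed (simp add: comp_def poly_fun_zero)

lemma GDERIV_coord: "GDERIV (\<lambda>x. x $ j) x :> (axis j 1 :: real^'n)"
proof -
  have "(\<lambda>h. h \<bullet> (axis j 1 :: real^'n)) = (\<lambda>h. h $ j)" by (simp add: inner_axis fun_eq_iff)
  then show ?thesis unfolding gderiv_def
    by (auto intro!: bounded_linear_imp_has_derivative bounded_linear_vec_nth)
qed

text \<open>Induction on the degree by splitting off one coordinate.  The constant case is recorded separately
  because the natural number \<open>0 - 1\<close> is \<open>0\<close>: the product rule would
  otherwise raise the degree of the gradient of a linear monomial.\<close>

lemma vmonom_gradient:
  "\<exists>D. (\<forall>x. GDERIV (vmonom \<alpha>) x :> D x) \<and> (sum \<alpha> UNIV = 0 \<longrightarrow> D = (\<lambda>x. 0)) \<and>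
       (\<forall>i. (\<lambda>x. D x $ i) \<in> poly_fun (sum \<alpha> UNIV - 1))"
proof (induction "sum \<alpha> UNIV" arbitrary: \<alpha>)
  case 0
  then have "vmonom \<alpha> = (\<lambda>x. 1)" by (simp add: vmonom_def fun_eq_iff)
  then have "GDERIV (vmonom \<alpha>) x :> 0" for x using GDERIV_const[of 1 x] by metis
  then show ?case by (intro exI[of _ "\<lambda>x. 0"]) (simp add: poly_fun_zero)
next
  case (Suc k)
  then obtain j where j: "0 < \<alpha> j"
    by (metis gr0I nat.simps(3) sum.neutral)
  define \<beta> where "\<beta> = \<alpha>(j := \<alpha> j - 1)"
  have k: "k = sum \<beta> UNIV" using sum_decrement[of \<alpha> j] j Suc(2) by (simp add: \<beta>_def)
  obtain D where "(\<forall>x. GDERIV (vmonom \<beta>) x :> D x) \<and> (k = 0 \<longrightarrow> D = (\<lambda>x. 0)) \<and>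
      (\<forall>i. (\<lambda>x. D x $ i) \<in> poly_fun (k - 1))"
    using Suc(1)[OF k] unfolding k[symmetric] by (elim exE)
  then have D: "GDERIV (vmonom \<beta>) x :> D x" "k = 0 \<Longrightarrow> D = (\<lambda>x. 0)"
    "(\<lambda>x. D x $ i) \<in> poly_fun (k - 1)" for x i by auto
  have eq: "vmonom \<alpha> = (\<lambda>x. x $ j * vmonom \<beta> x)"
    using vmonom_step[of \<alpha> j] j by (simp add: \<beta>_def fun_eq_iff)
  have vb: "vmonom \<beta> \<in> poly_fun k" using k by (simp add: vmonom_in_poly_fun)
  show ?case
  proof (intro exI[of _ "\<lambda>x. (x $ j) *\<^sub>R D x + vmonom \<beta> x *\<^sub>R axis j 1"] conjI allI)
    show "GDERIV (vmonom \<alpha>) x :> (x $ j) *\<^sub>R D x + vmonom \<beta> x *\<^sub>R axis j 1" for x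
      unfolding eq by (rule GDERIV_mult[OF GDERIV_coord D(1)])
    show "sum \<alpha> UNIV = 0 \<longrightarrow> (\<lambda>x. (x $ j) *\<^sub>R D x + vmonom \<beta> x *\<^sub>R axis j 1) = (\<lambda>x. 0)"
      using Suc(2) by presburger
    fix i
    have "(\<lambda>x. x $ j * D x $ i) \<in> poly_fun k"
    proof (cases k)
      case 0 then show ?thesis using D(2) by (simp add: poly_fun_zero)
    next
      case (Suc m)
      then show ?thesis using poly_fun_mult[OF poly_fun_coord[of j 0] D(3)[of i]] by simp
    qed
    moreover have "(\<lambda>x. vmonom \<beta> x * (axis j 1 :: real^'a) $ i) \<in> poly_fun k"
      using poly_fun_scale[OF vb, of "(axis j 1 :: real^'a) $ i"] by (simp add: mult.commute)
    ultimately show "(\<lambda>x. ((x $ j) *\<^sub>R D x + vmonom \<beta> x *\<^sub>R axis j 1) $ i) \<in> poly_fun (sum \<alpha> UNIV - 1)"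
      using Suc(2)[symmetric] by (simp add: poly_fun_add)
  qed
qed

lemma poly_fun_gradient:
  assumes "q \<in> poly_fun l"
  shows "\<exists>D. (\<forall>x. GDERIV q x :> D x) \<and> (\<forall>i. (\<lambda>x. D x $ i) \<in> poly_fun (l - 1))"
  using assms
proof (induction rule: poly_fun_induct)
  case zero
  show ?case by (intro exI[of _ "\<lambda>x. 0"]) (simp add: GDERIV_const poly_fun_zero)
next
  case (monom \<alpha>)
  then show ?case using vmonom_gradient[of \<alpha>] by (meson diff_le_mono poly_fun_mono)
next
  case (lincomb f g a)
  then obtain D E where D: "\<And>x. GDERIV f x :> D x" "\<And>i. (\<lambda>x. D x $ i) \<in> poly_fun (l - 1)"
    and E: "\<And>x. GDERIV g x :> E x" "\<And>i. (\<lambda>x. E x $ i) \<in> poly_fun (l - 1)" by blast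
  have "GDERIV (\<lambda>x. a * f x + g x) x :> a *\<^sub>R D x + E x" for x
    using GDERIV_add[OF GDERIV_mult[OF GDERIV_const[of a] D(1)] E(1), of x] by simp
  then show ?case using D(2) E(2)
    by (intro exI[of _ "\<lambda>x. a *\<^sub>R D x + E x"]) (simp add: poly_fun_add poly_fun_scale)
qed

lemma poly_fun_real_polynomial: "q \<in> poly_fun l \<Longrightarrow> real_polynomial_function q"
proof (induction rule: poly_fun_induct)
  case (monom \<alpha>)
  have "real_polynomial_function (\<lambda>x :: real^'a. \<Prod>i\<in>UNIV. (x $ i) ^ \<alpha> i)"
    by (intro real_polynomial_function_prod real_polynomial_function_power
        real_polynomial_function.intros(1) bounded_linear_vec_nth) auto
  then show ?case by (simp add: vmonom_def[abs_def])
qed (auto intro!: real_polynomial_function.intros(2-4))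

lemma poly_fun_continuous: "q \<in> poly_fun l \<Longrightarrow> continuous_on S q"
  by (simp add: poly_fun_real_polynomial continuous_on_polymonial_function real_polynomial_function_eq[symmetric])

lemma poly_fun_L2:
  "q \<in> poly_fun l \<Longrightarrow> bounded U \<Longrightarrow> U \<in> sets lebesgue \<Longrightarrow> q \<in> L2 U"
  by (intro L2_continuous_bounded poly_fun_continuous)

text \<open>On every line through a point of \<open>E\<close> the function is a polynomial in one variable that
  vanishes on an interval.\<close>

lemma poly_fun_identity:
  assumes q: "q \<in> poly_fun l" and E: "open E" "E \<noteq> {}" and z: "\<And>x. x \<in> E \<Longrightarrow> q x = 0"
  shows "q = (\<lambda>x. 0)"
proof
  fix y
  obtain a where a: "a \<in> E" using E by auto
  obtain e where e: "0 < e" "ball a e \<subseteq> E" using E a openE by blast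
  define g where "g t = a + t *\<^sub>R (y - a)" for t :: real
  have "polynomial_function g" unfolding g_def
    by (intro polynomial_function_add polynomial_function_const polynomial_function_bounded_linear bounded_linear_scaleR_left)
  then have "real_polynomial_function (q \<circ> g)"
    using poly_fun_real_polynomial[OF q] by (rule real_polynomial_function_compose)
  then obtain c n where cn: "q \<circ> g = (\<lambda>t. \<Sum>i\<le>n. c i * t ^ i)"
    by (auto simp: real_polynomial_function_iff_sum)
  define d where "d = e / (norm (y - a) + 1)"
  have d: "0 < d" using e by (simp add: d_def add_nonneg_pos)
  have root: "(\<Sum>i\<le>n. c i * t ^ i) = 0" if "t \<in> {0<..<d}" for t
  proof -
    have "norm (t *\<^sub>R (y - a)) = t * norm (y - a)" using that by simp
    also have "\<dots> \<le> t * (norm (y - a) + 1)" using that by simp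
    also have "\<dots> < d * (norm (y - a) + 1)" using that by (intro mult_strict_right_mono) (auto simp: add_nonneg_pos)
    also have "\<dots> = e" by (simp add: d_def add_nonneg_eq_0_iff)
    finally have "g t \<in> E" using e by (auto simp: g_def dist_norm)
    then show ?thesis using z cn by (metis comp_apply)
  qed
  have "\<forall>i\<le>n. c i = 0"
  proof (rule ccontr)
    assume "\<not> (\<forall>i\<le>n. c i = 0)"
    then have "finite {t. (\<Sum>i\<le>n. c i * t ^ i) = 0}" using polyfun_finite_roots[of c n] by auto
    then have "finite {0<..<d}" by (rule finite_subset[rotated]) (use root in auto)
    then show False using d by (simp add: infinite_Ioo)
  qed
  then have "(q \<circ> g) 1 = 0" by (simp add: cn)
  then show "q y = 0" by (simp add: g_def)
qed

section \<open>Orthogonal projection onto polynomials\<close>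

lemma L2norm_zero_AE:
  fixes f :: "real^'n \<Rightarrow> 'b::euclidean_space"
  assumes "f \<in> L2 U" "(L2norm U f)\<^sup>2 = 0" shows "AE x in lebesgue_on U. f x = 0"
  using assms L2_integrable[OF assms(1)]
  by (auto simp: L2norm_sq integral_nonneg_eq_0_iff_AE)

lemma ip_null_right:
  fixes f g :: "real^'n \<Rightarrow> 'b::euclidean_space"
  assumes "f \<in> L2 U" "(L2norm U f)\<^sup>2 = 0" shows "ip U g f = 0"
  unfolding ip_def
  by (rule integral_eq_zero_AE) (use L2norm_zero_AE[OF assms] in \<open>auto elim: eventually_mono\<close>)

lemma ip_orth_sum:
  fixes w :: "real^'n \<Rightarrow> real"
  assumes "w \<in> L2 U" "\<And>\<alpha>. \<alpha> \<in> A \<Longrightarrow> m \<alpha> \<in> L2 U" "\<And>\<alpha>. \<alpha> \<in> A \<Longrightarrow> ip U w (m \<alpha>) = 0"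
  shows "ip U w (\<lambda>x. \<Sum>\<alpha>\<in>A. d \<alpha> * m \<alpha> x) = 0"
proof -
  have "ip U w (\<lambda>x. \<Sum>\<alpha>\<in>A. d \<alpha> * m \<alpha> x) = (\<integral>x. (\<Sum>\<alpha>\<in>A. d \<alpha> * (w x * m \<alpha> x)) \<partial>lebesgue_on U)"
    by (simp add: ip_def sum_distrib_left algebra_simps)
  also have "\<dots> = (\<Sum>\<alpha>\<in>A. \<integral>x. d \<alpha> * (w x * m \<alpha> x) \<partial>lebesgue_on U)"
    using L2_inner_integrable[OF assms(1,2)] by (intro Bochner_Integration.integral_sum) auto
  also have "\<dots> = 0" using assms(3) by (simp add: ip_def)
  finally show ?thesis .
qed

text \<open>Gram--Schmidt, one function at a time; the functions may be linearly dependent up to null sets.\<close>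

lemma ex_orthogonal_projection:
  fixes v :: "real^'n \<Rightarrow> real"
  assumes "finite A" "\<And>\<alpha>. \<alpha> \<in> A \<Longrightarrow> m \<alpha> \<in> L2 U" "v \<in> L2 U"
  shows "\<exists>c. \<forall>\<beta>\<in>A. ip U (\<lambda>x. v x - (\<Sum>\<alpha>\<in>A. c \<alpha> * m \<alpha> x)) (m \<beta>) = 0"
  using assms
proof (induction A arbitrary: v rule: finite_induct)
  case (insert b A)
  have comb: "(\<lambda>x. \<Sum>\<alpha>\<in>A. c \<alpha> * m \<alpha> x) \<in> L2 U" for c
    using insert.prems(1) L2_scale(1)[of "m _" U] by (intro L2_sum) auto
  obtain c where c: "\<forall>\<beta>\<in>A. ip U (\<lambda>x. v x - (\<Sum>\<alpha>\<in>A. c \<alpha> * m \<alpha> x)) (m \<beta>) = 0"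
    using insert.IH[of v] insert.prems by auto
  obtain d where d: "\<forall>\<beta>\<in>A. ip U (\<lambda>x. m b x - (\<Sum>\<alpha>\<in>A. d \<alpha> * m \<alpha> x)) (m \<beta>) = 0"
    using insert.IH[of "m b"] insert.prems by auto
  define r where "r = (\<lambda>x. v x - (\<Sum>\<alpha>\<in>A. c \<alpha> * m \<alpha> x))"
  define s where "s = (\<lambda>x. m b x - (\<Sum>\<alpha>\<in>A. d \<alpha> * m \<alpha> x))"
  have r: "r \<in> L2 U" and s: "s \<in> L2 U"
    unfolding r_def s_def using insert.prems comb by (auto intro: L2_diff)
  define t where "t = ip U r s / ip U s s"
  define w where "w = (\<lambda>x. r x - t * s x)"
  have w: "w \<in> L2 U" unfolding w_def using L2_diff(1)[OF r L2_scale(1)[OF s, of t]] by simp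
  have ip_w: "ip U w h = ip U r h - t * ip U s h" if "h \<in> L2 U" for h
    using ip_lincomb_left[OF r s that, of 1 "-t"] by (simp add: w_def)
  have wA: "ip U w (m \<beta>) = 0" if "\<beta> \<in> A" for \<beta>
    using c d that insert.prems by (simp add: ip_w r_def s_def)
  \<comment> \<open>If \<open>s\<close> is a null function, then \<open>t = 0\<close> and both terms vanish.\<close>
  have "ip U w s = 0"
    using ip_null_right[OF s, of r] by (auto simp: ip_w[OF s] t_def ip_self)
  moreover have "ip U w (\<lambda>x. \<Sum>\<alpha>\<in>A. d \<alpha> * m \<alpha> x) = 0"
    using w wA insert.prems by (intro ip_orth_sum) auto
  moreover have "ip U w (m b) = ip U w s + ip U w (\<lambda>x. \<Sum>\<alpha>\<in>A. d \<alpha> * m \<alpha> x)"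
    using ip_lincomb_left[OF s comb[of d] w, of 1 1] by (simp add: s_def ip_commute[of U w])
  ultimately have "ip U w (m b) = 0" by simp
  moreover have weq: "w = (\<lambda>x. v x - (\<Sum>\<alpha>\<in>insert b A. (if \<alpha> = b then t else c \<alpha> - t * d \<alpha>) * m \<alpha> x))"
  proof
    fix x
    have "(\<Sum>\<alpha>\<in>A. (if \<alpha> = b then t else c \<alpha> - t * d \<alpha>) * m \<alpha> x) =
      (\<Sum>\<alpha>\<in>A. c \<alpha> * m \<alpha> x) - t * (\<Sum>\<alpha>\<in>A. d \<alpha> * m \<alpha> x)"
      unfolding sum_distrib_left sum_subtractf[symmetric]
      using insert.hyps by (intro sum.cong) (auto simp: algebra_simps)
    then show "w x = v x - (\<Sum>\<alpha>\<in>insert b A. (if \<alpha> = b then t else c \<alpha> - t * d \<alpha>) * m \<alpha> x)"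
      using insert.hyps by (simp add: w_def r_def s_def algebra_simps)
  qed
  moreover have "\<forall>\<beta>\<in>insert b A. ip U w (m \<beta>) = 0" using wA \<open>ip U w (m b) = 0\<close> by simp
  ultimately show ?case by (intro exI[of _ "\<lambda>\<alpha>. if \<alpha> = b then t else c \<alpha> - t * d \<alpha>"]) (simp only: weq)
qed simp

context
  fixes E :: "(real^'n) set"
  assumes E: "open E" "E \<noteq> {}" "bounded E"
begin

lemma lebesgue_E: "E \<in> sets lebesgue"
  using E by auto

lemma poly_fun_L2_E: "q \<in> poly_fun l \<Longrightarrow> q \<in> L2 E"
  by (rule poly_fun_L2[OF _ E(3) lebesgue_E])

lemma poly_fun_norm_zero:
  assumes q: "q \<in> poly_fun l" and z: "(L2norm E q)\<^sup>2 = 0"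
  shows "q = (\<lambda>x. 0)"
proof (rule poly_fun_identity[OF q E(1,2)])
  define N where "N = {x \<in> E. q x \<noteq> 0}"
  have "N = E \<inter> q -` (- {0})" by (auto simp: N_def)
  then have "open N"
    using E(1) continuous_on_open_vimage[OF E(1), of q] poly_fun_continuous[OF q]
    by (metis inf_commute open_Compl closed_singleton)
  moreover have "AE x in lebesgue. x \<in> E \<longrightarrow> q x = 0"
    using L2norm_zero_AE[OF poly_fun_L2_E[OF q] z] lebesgue_E
    by (subst (asm) AE_restrict_space_iff) auto
  then have "AE x in lebesgue. x \<notin> N" by (auto simp: N_def elim: eventually_mono)
  then have "negligible N"
    using \<open>open N\<close> by (simp add: negligible_iff_null_sets AE_iff_null_sets lborelD)
  ultimately have "N = {}" using open_not_negligible by blast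
  then show "x \<in> E \<Longrightarrow> q x = 0" for x by (auto simp: N_def)
qed

text \<open>Existence is the previous orthogonalisation applied to the monomials; for uniqueness, a polynomial
  of norm zero on a nonempty open set vanishes identically.\<close>

lemma proj_ex1:
  assumes v: "v \<in> L2 E"
  shows "\<exists>!q. q \<in> poly_fun l \<and> (\<forall>r\<in>poly_fun l. ip E (\<lambda>x. v x - q x) r = 0)"
proof (rule ex_ex1I)
  let ?A = "{\<alpha> :: 'n \<Rightarrow> nat. sum \<alpha> UNIV \<le> l}"
  have m: "vmonom \<alpha> \<in> L2 E" if "\<alpha> \<in> ?A" for \<alpha>
    using that by (auto intro: poly_fun_L2_E vmonom_in_poly_fun)
  obtain c where c: "\<forall>\<beta>\<in>?A. ip E (\<lambda>x. v x - (\<Sum>\<alpha>\<in>?A. c \<alpha> * vmonom \<alpha> x)) (vmonom \<beta>) = 0"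
    using ex_orthogonal_projection[OF finite_multi_indices[of l], of vmonom E v] m v by blast
  define q where "q = (\<lambda>x. \<Sum>\<alpha>\<in>?A. c \<alpha> * vmonom \<alpha> x)"
  have q: "q \<in> poly_fun l" unfolding poly_fun_iff q_def by blast
  have w: "(\<lambda>x. v x - q x) \<in> L2 E" by (rule L2_diff(1)[OF v poly_fun_L2_E[OF q]])
  have "ip E (\<lambda>x. v x - q x) r = 0" if "r \<in> poly_fun l" for r
  proof -
    obtain d where r: "r = (\<lambda>x. \<Sum>\<alpha>\<in>?A. d \<alpha> * vmonom \<alpha> x)" using \<open>r \<in> poly_fun l\<close> by (auto simp: poly_fun_iff)
    show ?thesis unfolding r using c by (intro ip_orth_sum w m) (auto simp: q_def)
  qed
  then show "\<exists>q. q \<in> poly_fun l \<and> (\<forall>r\<in>poly_fun l. ip E (\<lambda>x. v x - q x) r = 0)" using q by blast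
next
  fix q r
  assume q: "q \<in> poly_fun l \<and> (\<forall>r\<in>poly_fun l. ip E (\<lambda>x. v x - q x) r = 0)"
    and r: "r \<in> poly_fun l \<and> (\<forall>s\<in>poly_fun l. ip E (\<lambda>x. v x - r x) s = 0)"
  define d where "d = (\<lambda>x. q x - r x)"
  have d: "d \<in> poly_fun l" unfolding d_def using q r by (auto intro: poly_fun_diff)
  have L: "q \<in> L2 E" "r \<in> L2 E" "d \<in> L2 E" using q r d poly_fun_L2_E by auto
  have "ip E d d = ip E (\<lambda>x. v x - r x) d - ip E (\<lambda>x. v x - q x) d"
    using ip_diff_left[OF L2_diff(1)[OF v L(2)] L2_diff(1)[OF v L(1)] L(3)]
    by (simp add: d_def)
  also have "\<dots> = 0" using q r d by simp
  finally have "d = (\<lambda>x. 0)" using poly_fun_norm_zero[OF d] by (simp add: ip_self)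
  then show "q = r" by (simp add: d_def fun_eq_iff)
qed

lemma
  assumes "v \<in> L2 E"
  shows proj_poly: "proj l E v \<in> poly_fun l"
    and proj_orth: "r \<in> poly_fun l \<Longrightarrow> ip E (\<lambda>x. v x - proj l E v x) r = 0"
  using theI'[OF proj_ex1[OF assms, of l]] by (auto simp: proj_def)

lemma proj_eqI:
  assumes "v \<in> L2 E" "q \<in> poly_fun l" "\<And>r. r \<in> poly_fun l \<Longrightarrow> ip E (\<lambda>x. v x - q x) r = 0"
  shows "proj l E v = q"
  unfolding proj_def using assms by (intro the1_equality[OF proj_ex1]) auto

lemma proj_L2: "v \<in> L2 E \<Longrightarrow> proj l E v \<in> L2 E"
  by (rule poly_fun_L2_E[OF proj_poly])

text \<open>The projection error is orthogonal to the polynomials; this is the membership condition of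
  \<open>stab_kernel\<close>.\<close>

lemma proj_of_proj_diff:
  assumes v: "v \<in> L2 E"
  shows "proj l E (\<lambda>x. proj l E v x - v x) = (\<lambda>x. 0)"
proof (rule proj_eqI)
  show "ip E (\<lambda>x. proj l E v x - v x - 0) r = 0" if "r \<in> poly_fun l" for r
    using ip_diff_left[OF v proj_L2[OF v] poly_fun_L2_E[OF that], of l]
      ip_diff_left[OF proj_L2[OF v] v poly_fun_L2_E[OF that], of l] proj_orth[OF v that] by simp
qed (use v in \<open>auto intro: proj_L2 L2_diff(1) poly_fun_zero\<close>)

text \<open>Pythagoras: \<open>r - v\<close> is the sum of the polynomial \<open>r - \<Pi>v\<close> and of
  \<open>\<Pi>v - v\<close>, which is orthogonal to it.\<close>

lemma osc_best:
  assumes v: "v \<in> L2 E" and r: "r \<in> poly_fun l"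
  shows "(osc l E v)\<^sup>2 \<le> (L2norm E (\<lambda>x. r x - v x))\<^sup>2"
proof -
  define a where "a = (\<lambda>x. r x - proj l E v x)"
  define b where "b = (\<lambda>x. v x - proj l E v x)"
  have a: "a \<in> poly_fun l" unfolding a_def using r proj_poly[OF v] by (rule poly_fun_diff)
  have L: "a \<in> L2 E" "b \<in> L2 E"
    using poly_fun_L2_E[OF a] L2_diff(1)[OF v proj_L2[OF v]] by (auto simp: b_def)
  have ab: "(\<lambda>x. a x - b x) \<in> L2 E" by (rule L2_diff(1)[OF L])
  have "ip E b a = 0" unfolding b_def by (rule proj_orth[OF v a])
  then have z: "ip E b a = 0" "ip E a b = 0" by (simp_all add: ip_commute[of E a b])
  have "ip E (\<lambda>x. a x - b x) (\<lambda>x. a x - b x) =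
      ip E a (\<lambda>x. a x - b x) - ip E b (\<lambda>x. a x - b x)"
    by (rule ip_diff_left[OF L ab])
  also have "\<dots> = ip E (\<lambda>x. a x - b x) a - ip E (\<lambda>x. a x - b x) b"
    by (simp only: ip_commute)
  also have "\<dots> = ip E a a + ip E b b"
    by (simp only: ip_diff_left[OF L L(1)] ip_diff_left[OF L L(2)] z)
  finally have "(L2norm E b)\<^sup>2 \<le> (L2norm E (\<lambda>x. a x - b x))\<^sup>2" by (simp add: ip_self)
  then show ?thesis by (simp add: a_def b_def osc_def L2norm_commute[of E v])
qed

text \<open>Use the projection of \<open>w\<close> as a competitor in the best approximation of
  \<open>v\<close>.\<close>

lemma osc_perturb:
  assumes v: "v \<in> L2 E" and w: "w \<in> L2 E"
  shows "(osc l E v)\<^sup>2 \<le> 2 * (osc l E w)\<^sup>2 + 2 * (L2norm E (\<lambda>x. v x - w x))\<^sup>2"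
proof -
  have "(osc l E v)\<^sup>2 \<le> (L2norm E (\<lambda>x. proj l E w x - v x))\<^sup>2"
    by (rule osc_best[OF v proj_poly[OF w]])
  also have "\<dots> = (L2norm E (\<lambda>x. (proj l E w x - w x) + (w x - v x)))\<^sup>2" by simp
  also have "\<dots> \<le> 2 * (osc l E w)\<^sup>2 + 2 * (L2norm E (\<lambda>x. w x - v x))\<^sup>2"
    unfolding osc_def using proj_L2 v w by (intro L2_add(2) L2_diff(1)) auto
  finally show ?thesis by (simp add: L2norm_commute[of E w])
qed

lemma oscv_components:
  assumes v: "v \<in> L2 E"
  shows "(oscv l E v)\<^sup>2 = (\<Sum>i\<in>UNIV. (osc l E (\<lambda>x. v x $ i))\<^sup>2)"
proof -
  have c: "(\<lambda>x. v x $ i) \<in> L2 E" for i using v by (simp add: L2_component)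
  have "(\<lambda>x. projv l E v x - v x) \<in> L2 E"
    unfolding L2_component projv_def using L2_diff(1)[OF proj_L2[OF c] c] by simp
  then show ?thesis by (simp add: oscv_def osc_def L2norm_components projv_def)
qed

lemma projv_L2: "v \<in> L2 E \<Longrightarrow> projv l E v \<in> L2 E"
  unfolding L2_component projv_def by (simp add: proj_L2)

lemma oscv_best:
  assumes v: "v \<in> L2 E" and r: "\<And>i. (\<lambda>x. r x $ i) \<in> poly_fun l"
  shows "(oscv l E v)\<^sup>2 \<le> (L2norm E (\<lambda>x. r x - v x))\<^sup>2"
proof -
  have c: "(\<lambda>x. v x $ i) \<in> L2 E" for i using v by (simp add: L2_component)
  have "r \<in> L2 E" unfolding L2_component using poly_fun_L2_E[OF r] by simp
  then have "(\<lambda>x. r x - v x) \<in> L2 E" using v by (rule L2_diff(1))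
  then show ?thesis
    using v osc_best[OF c r] by (simp add: oscv_components L2norm_components sum_mono)
qed

lemma oscv_perturb:
  assumes v: "v \<in> L2 E" and w: "w \<in> L2 E"
  shows "(oscv l E v)\<^sup>2 \<le> 2 * (oscv l E w)\<^sup>2 + 2 * (L2norm E (\<lambda>x. v x - w x))\<^sup>2"
proof -
  have c: "(\<lambda>x. v x $ i) \<in> L2 E" "(\<lambda>x. w x $ i) \<in> L2 E" for i
    using v w by (simp_all add: L2_component)
  have "(oscv l E v)\<^sup>2 \<le> (\<Sum>i\<in>UNIV. 2 * (osc l E (\<lambda>x. w x $ i))\<^sup>2 + 2 * (L2norm E (\<lambda>x. v x $ i - w x $ i))\<^sup>2)"
    unfolding oscv_components[OF v] by (intro sum_mono osc_perturb c)
  also have "\<dots> = 2 * (oscv l E w)\<^sup>2 + 2 * (L2norm E (\<lambda>x. v x - w x))\<^sup>2"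
    by (simp add: sum.distrib sum_distrib_left oscv_components[OF w] L2norm_components[OF L2_diff(1)[OF v w]])
  finally show ?thesis .
qed

end

section \<open>Continuously differentiable functions and the fundamental lemma\<close>

text \<open>Continuously differentiable functions on the whole space; test functions are those with compact
  support in the given set.\<close>

definition C1_fun :: "(real^'n \<Rightarrow> real) set" where
  "C1_fun = {\<phi>. \<exists>D. (\<forall>x. GDERIV \<phi> x :> D x) \<and> continuous_on UNIV D}"

lemma GDERIV_unique:
  assumes "GDERIV f x :> D" "GDERIV f x :> D'" shows "D = D'"
proof -
  have "(\<lambda>h. h \<bullet> D) = (\<lambda>h. h \<bullet> D')"
    using assms unfolding gderiv_def by (rule has_derivative_unique)
  then show ?thesis by (metis vector_eq_ldot)
qed

lemma grad_eq: "GDERIV f x :> D \<Longrightarrow> grad f x = D"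
  unfolding grad_def by (blast intro: GDERIV_unique)

lemma C1_funI: "(\<And>x. GDERIV \<phi> x :> D x) \<Longrightarrow> continuous_on UNIV D \<Longrightarrow> \<phi> \<in> C1_fun"
  by (auto simp: C1_fun_def)

lemma
  assumes "\<phi> \<in> C1_fun"
  shows C1_fun_GDERIV: "GDERIV \<phi> x :> grad \<phi> x" and C1_fun_grad: "continuous_on S (grad \<phi>)"
proof -
  obtain D where D: "\<And>x. GDERIV \<phi> x :> D x" "continuous_on UNIV D"
    using assms by (auto simp: C1_fun_def)
  then have "grad \<phi> = D" using grad_eq by blast
  then show "GDERIV \<phi> x :> grad \<phi> x" "continuous_on S (grad \<phi>)"
    using D continuous_on_subset[OF D(2) subset_UNIV] by auto
qed

lemma GDERIV_continuous: "GDERIV \<phi> x :> D \<Longrightarrow> isCont \<phi> x"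
  by (auto simp: gderiv_def dest: has_derivative_continuous)

lemma C1_fun_continuous: "\<phi> \<in> C1_fun \<Longrightarrow> continuous_on S \<phi>"
  by (meson C1_fun_GDERIV GDERIV_continuous continuous_at_imp_continuous_on)

lemma C1_const: "(\<lambda>x. c) \<in> C1_fun"
  by (rule C1_funI[OF GDERIV_const]) auto

lemma C1_coord: "(\<lambda>x. x $ j) \<in> C1_fun"
  by (rule C1_funI[OF GDERIV_coord]) auto

lemma C1_add: "f \<in> C1_fun \<Longrightarrow> g \<in> C1_fun \<Longrightarrow> (\<lambda>x. f x + g x) \<in> C1_fun"
  by (rule C1_funI[OF GDERIV_add[OF C1_fun_GDERIV C1_fun_GDERIV]]) (auto intro!: continuous_intros C1_fun_grad)

lemma C1_mult: "f \<in> C1_fun \<Longrightarrow> g \<in> C1_fun \<Longrightarrow> (\<lambda>x. f x * g x) \<in> C1_fun"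
  by (rule C1_funI[OF GDERIV_mult[OF C1_fun_GDERIV C1_fun_GDERIV]])
    (auto intro!: continuous_intros C1_fun_grad C1_fun_continuous)

lemma C1_scale: "f \<in> C1_fun \<Longrightarrow> (\<lambda>x. c * f x) \<in> C1_fun"
  by (rule C1_mult[OF C1_const])

lemma C1_diff: "f \<in> C1_fun \<Longrightarrow> g \<in> C1_fun \<Longrightarrow> (\<lambda>x. f x - g x) \<in> C1_fun"
  using C1_add[OF _ C1_scale[of g "-1"], of f] by simp

lemma C1_inverse:
  assumes "f \<in> C1_fun" "\<And>x. f x \<noteq> 0" shows "(\<lambda>x. inverse (f x)) \<in> C1_fun"
  by (rule C1_funI[OF GDERIV_inverse[OF C1_fun_GDERIV[OF assms(1)] assms(2)]])
    (auto intro!: continuous_intros C1_fun_grad[OF assms(1)] C1_fun_continuous[OF assms(1)] simp: assms(2))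

lemma C1_sum: "(\<And>i. i \<in> A \<Longrightarrow> f i \<in> C1_fun) \<Longrightarrow> (\<lambda>x. \<Sum>i\<in>A. f i x) \<in> C1_fun"
  by (induction A rule: infinite_finite_induct) (auto intro: C1_const C1_add)

lemma C1_prod: "(\<And>i. i \<in> A \<Longrightarrow> f i \<in> C1_fun) \<Longrightarrow> (\<lambda>x. \<Prod>i\<in>A. f i x) \<in> C1_fun"
  by (induction A rule: infinite_finite_induct) (auto intro: C1_const C1_mult)

lemma DERIV_pos_part_sq: "((\<lambda>t::real. (max 0 t)\<^sup>2) has_real_derivative 2 * max 0 t) (at t)"
proof (cases "t = 0")
  case True
  have "(\<lambda>h::real. (max 0 h)\<^sup>2 / h) \<midarrow>0\<rightarrow> 0"
  proof (rule Lim_null_comparison)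
    show "\<forall>\<^sub>F h::real in at 0. norm ((max 0 h)\<^sup>2 / h) \<le> \<bar>h\<bar>"
      by (intro always_eventually allI) (auto simp: max_def power2_eq_square)
    show "(\<lambda>h::real. \<bar>h\<bar>) \<midarrow>0\<rightarrow> 0" by (auto intro!: tendsto_eq_intros)
  qed
  then show ?thesis by (simp add: True DERIV_def)
next
  case False
  then consider "0 < t" | "t < 0" by linarith
  then show ?thesis
  proof cases
    case 1
    have "((\<lambda>t::real. t\<^sup>2) has_real_derivative 2 * t) (at t)"
      by (auto intro!: derivative_eq_intros)
    then have "((\<lambda>t::real. (max 0 t)\<^sup>2) has_real_derivative 2 * t) (at t)"
      by (rule has_field_derivative_transform_within_open[where S = "{0<..}"]) (use 1 in auto)
    then show ?thesis using 1 by simp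
  next
    case 2
    have "((\<lambda>t::real. 0) has_real_derivative 0) (at t)" by simp
    then have "((\<lambda>t::real. (max 0 t)\<^sup>2) has_real_derivative 0) (at t)"
      by (rule has_field_derivative_transform_within_open[where S = "{..<0}"]) (use 2 in auto)
    then show ?thesis using 2 by simp
  qed
qed

lemma C1_pos_part_sq: "f \<in> C1_fun \<Longrightarrow> (\<lambda>x. (max 0 (f x))\<^sup>2) \<in> C1_fun"
  by (rule C1_funI[OF GDERIV_DERIV_compose[OF C1_fun_GDERIV DERIV_pos_part_sq]])
    (auto intro!: continuous_on_scaleR continuous_on_mult continuous_on_max continuous_on_const C1_fun_grad
       intro: C1_fun_continuous)

lemma real_polynomial_C1:
  fixes q :: "real^'n \<Rightarrow> real"
  shows "real_polynomial_function q \<Longrightarrow> q \<in> C1_fun"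
proof (induction rule: real_polynomial_function.induct)
  case (linear f)
  interpret bounded_linear f by fact
  have "f x = (\<Sum>i\<in>UNIV. f (axis i 1) * x $ i)" for x
  proof -
    have "f x = f (\<Sum>i\<in>UNIV. x $ i *\<^sub>R axis i 1)"
      by (rule arg_cong[of _ _ f]) (simp add: vec_eq_iff axis_def if_distrib cong: if_cong)
    also have "\<dots> = (\<Sum>i\<in>UNIV. f (axis i 1) * x $ i)" by (simp add: sum scaleR mult.commute)
    finally show ?thesis .
  qed
  then have "f = (\<lambda>x. \<Sum>i\<in>UNIV. f (axis i 1) * x $ i)" by blast
  moreover have "(\<lambda>x. \<Sum>i\<in>UNIV. f (axis i 1) * x $ i) \<in> C1_fun"
    by (intro C1_sum C1_scale C1_coord)
  ultimately show ?case by simp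
qed (auto intro: C1_const C1_add C1_mult)

lemma poly_fun_C1: "q \<in> poly_fun l \<Longrightarrow> q \<in> C1_fun"
  by (rule real_polynomial_C1[OF poly_fun_real_polynomial])

lemma poly_fun_grad: "q \<in> poly_fun l \<Longrightarrow> (\<lambda>x. grad q x $ i) \<in> poly_fun (l - 1)"
proof -
  assume "q \<in> poly_fun l"
  then obtain D where D: "\<And>x. GDERIV q x :> D x" "\<And>i. (\<lambda>x. D x $ i) \<in> poly_fun (l - 1)"
    using poly_fun_gradient by blast
  then have "grad q = D" using grad_eq by blast
  then show ?thesis using D by simp
qed

lemma test_funI:
  "\<phi> \<in> C1_fun \<Longrightarrow> compact K \<Longrightarrow> K \<subseteq> U \<Longrightarrow> (\<And>x. x \<notin> K \<Longrightarrow> \<phi> x = 0) \<Longrightarrow> \<phi> \<in> test_fun U"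
  unfolding test_fun_def using C1_fun_GDERIV C1_fun_grad by blast

lemma test_fun_C1: "\<phi> \<in> test_fun U \<Longrightarrow> \<phi> \<in> C1_fun"
  by (auto simp: test_fun_def intro: C1_funI)

lemma grad_eq_0_outside:
  assumes "closed K" "\<And>x. x \<notin> K \<Longrightarrow> \<phi> x = 0" "x \<notin> K" shows "grad \<phi> x = (0 :: real^'n)"
proof (rule grad_eq)
  have "((\<lambda>x. 0) has_derivative (\<lambda>h. 0)) (at x)" by simp
  then have "(\<phi> has_derivative (\<lambda>h. 0)) (at x)"
    by (rule has_derivative_transform_within_open[where s = "- K"]) (use assms in auto)
  then show "GDERIV \<phi> x :> 0" by (simp add: gderiv_def)
qed

lemma test_fun_support:
  assumes "\<phi> \<in> test_fun U"
  obtains K where "compact K" "K \<subseteq> U" "\<And>x. x \<notin> K \<Longrightarrow> \<phi> x = 0" "\<And>x. x \<notin> K \<Longrightarrow> grad \<phi> x = 0"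
proof -
  obtain K where K: "compact K" "K \<subseteq> U" "\<And>x. x \<notin> K \<Longrightarrow> \<phi> x = 0"
    using assms by (auto simp: test_fun_def)
  then show thesis
    using that[OF K] grad_eq_0_outside[of K \<phi>] compact_imp_closed[OF K(1)] by blast
qed

lemma test_fun_mono: "\<phi> \<in> test_fun V \<Longrightarrow> V \<subseteq> U \<Longrightarrow> \<phi> \<in> test_fun U"
  by (auto simp: test_fun_def)

lemma C1_mult_test:
  assumes "q \<in> C1_fun" "\<phi> \<in> test_fun U" shows "(\<lambda>x. q x * \<phi> x) \<in> test_fun U"
proof -
  obtain K where "compact K" "K \<subseteq> U" "\<And>x. x \<notin> K \<Longrightarrow> \<phi> x = 0"
    using test_fun_support[OF assms(2)] by metis
  then show ?thesis
    using C1_mult[OF assms(1) test_fun_C1[OF assms(2)]] by (intro test_funI[of _ K]) auto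
qed

lemma test_fun_lincomb:
  assumes "\<phi> \<in> test_fun U" "\<psi> \<in> test_fun U"
  shows "(\<lambda>x. a * \<phi> x + b * \<psi> x) \<in> test_fun U"
    "grad (\<lambda>x. a * \<phi> x + b * \<psi> x) = (\<lambda>x. a *\<^sub>R grad \<phi> x + b *\<^sub>R grad \<psi> x)"
proof -
  obtain K L where KL: "compact K" "K \<subseteq> U" "\<And>x. x \<notin> K \<Longrightarrow> \<phi> x = 0"
    "compact L" "L \<subseteq> U" "\<And>x. x \<notin> L \<Longrightarrow> \<psi> x = 0"
    using test_fun_support[OF assms(1)] test_fun_support[OF assms(2)] by metis
  show "(\<lambda>x. a * \<phi> x + b * \<psi> x) \<in> test_fun U"
    by (rule test_funI[of _ "K \<union> L"]) (use KL in \<open>auto intro!: C1_add C1_scale test_fun_C1[OF assms(1)] test_fun_C1[OF assms(2)]\<close>)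
  have "GDERIV (\<lambda>x. a * \<phi> x + b * \<psi> x) x :> a *\<^sub>R grad \<phi> x + b *\<^sub>R grad \<psi> x" for x
    using GDERIV_add[OF GDERIV_mult[OF GDERIV_const[of a] C1_fun_GDERIV[OF test_fun_C1[OF assms(1)]]]
        GDERIV_mult[OF GDERIV_const[of b] C1_fun_GDERIV[OF test_fun_C1[OF assms(2)]]], of x] by simp
  then show "grad (\<lambda>x. a * \<phi> x + b * \<psi> x) = (\<lambda>x. a *\<^sub>R grad \<phi> x + b *\<^sub>R grad \<psi> x)"
    using grad_eq by blast
qed

lemma zero_test_fun: "(\<lambda>x. 0) \<in> test_fun U"
  by (rule test_funI[of _ "{}"]) (auto intro: C1_const)

lemma integrable_continuous_scaleR:
  fixes H :: "real^'n \<Rightarrow> 'b::euclidean_space"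
  assumes K: "compact K" and H: "integrable (lebesgue_on K) H" and g: "continuous_on K g"
  shows "integrable (lebesgue_on K) (\<lambda>x. g x *\<^sub>R H x)"
proof -
  have Ks: "K \<in> sets lebesgue" using K by (simp add: compact_imp_closed)
  obtain B where B: "\<And>x. x \<in> K \<Longrightarrow> norm (g x) \<le> B"
    using compact_imp_bounded[OF compact_continuous_image[OF g K]] by (auto simp: bounded_iff)
  have "g \<in> borel_measurable (lebesgue_on K)"
    by (rule continuous_imp_measurable_on_sets_lebesgue[OF g Ks])
  then have m: "(\<lambda>x. g x *\<^sub>R H x) \<in> borel_measurable (lebesgue_on K)"
    using borel_measurable_integrable[OF H] by measurable
  have b: "norm (g x *\<^sub>R H x) \<le> norm (B *\<^sub>R H x)" if "x \<in> K" for x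
    using B[OF that] norm_ge_zero[of "g x"] by (auto intro!: mult_right_mono)
  have "integrable (lebesgue_on K) (\<lambda>x. B *\<^sub>R H x)" using H by simp
  then show ?thesis
    by (rule Bochner_Integration.integrable_bound[OF _ m]) (use b in \<open>auto intro!: AE_I2\<close>)
qed

lemma integrable_scaleR_continuous:
  fixes g :: "real^'n \<Rightarrow> 'b::euclidean_space"
  assumes K: "compact K" and H: "integrable (lebesgue_on K) v" and g: "continuous_on K g"
  shows "integrable (lebesgue_on K) (\<lambda>x. v x *\<^sub>R g x)"
proof -
  have Ks: "K \<in> sets lebesgue" using K by (simp add: compact_imp_closed)
  obtain B where B: "\<And>x. x \<in> K \<Longrightarrow> norm (g x) \<le> B"
    using compact_imp_bounded[OF compact_continuous_image[OF g K]] by (auto simp: bounded_iff)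
  have "g \<in> borel_measurable (lebesgue_on K)"
    by (rule continuous_imp_measurable_on_sets_lebesgue[OF g Ks])
  then have m: "(\<lambda>x. v x *\<^sub>R g x) \<in> borel_measurable (lebesgue_on K)"
    using borel_measurable_integrable[OF H] by measurable
  have b: "norm (v x *\<^sub>R g x) \<le> norm (v x * B)" if "x \<in> K" for x
    using B[OF that] norm_ge_zero[of "g x"] by (auto simp: abs_mult intro!: mult_left_mono)
  have "integrable (lebesgue_on K) (\<lambda>x. v x * B)" using H by simp
  then show ?thesis
    by (rule Bochner_Integration.integrable_bound[OF _ m]) (use b in \<open>auto intro!: AE_I2\<close>)
qed

text \<open>With \<open>\<psi>\<close> a continuously differentiable function that is positive exactly in the
  open box, \<open>n \<psi> / (1 + n \<psi>)\<close> increases to the indicator of the box.\<close>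

lemma C1_cutoffs:
  fixes c d :: "real^'n"
  obtains \<eta> where "\<And>n::nat. \<eta> n \<in> C1_fun" "\<And>n x. x \<notin> cbox c d \<Longrightarrow> \<eta> n x = 0"
    "\<And>n x. \<bar>\<eta> n x\<bar> \<le> 1" "\<And>x. x \<in> box c d \<Longrightarrow> (\<lambda>n. \<eta> n x) \<longlonglongrightarrow> 1"
proof
  define \<psi> where "\<psi> = (\<lambda>x. \<Prod>i\<in>UNIV. (max 0 (x $ i - c $ i))\<^sup>2 * (max 0 (d $ i - x $ i))\<^sup>2)"
  have C: "\<psi> \<in> C1_fun" unfolding \<psi>_def
    by (intro C1_prod C1_mult C1_pos_part_sq C1_diff C1_coord C1_const)
  have nn: "0 \<le> \<psi> x" for x unfolding \<psi>_def by (intro prod_nonneg) auto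
  define \<eta> where "\<eta> n = (\<lambda>x. 1 - inverse (1 + real n * \<psi> x))" for n
  have pos: "0 < 1 + real n * \<psi> x" for n x using nn[of x] by (simp add: add_pos_nonneg)
  show "\<eta> n \<in> C1_fun" for n unfolding \<eta>_def
    by (intro C1_diff C1_const C1_inverse C1_add C1_scale C) (use pos less_imp_neq in metis)
  show "\<eta> n x = 0" if x: "x \<notin> cbox c d" for n x
  proof -
    obtain i where "x $ i < c $ i \<or> d $ i < x $ i" using x by (auto simp: mem_box_cart not_le)
    then have "\<psi> x = 0" unfolding \<psi>_def by (intro prod_zero) (auto intro!: exI[of _ i])
    then show ?thesis by (simp add: \<eta>_def)
  qed
  show "\<bar>\<eta> n x\<bar> \<le> 1" for n x
  proof -
    have "inverse (1 + real n * \<psi> x) \<le> 1" using nn[of x] by (intro inverse_le_1_iff[THEN iffD2]) simp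
    moreover have "0 < inverse (1 + real n * \<psi> x)" using pos by simp
    ultimately show ?thesis unfolding \<eta>_def by linarith
  qed
  show "(\<lambda>n. \<eta> n x) \<longlonglongrightarrow> 1" if x: "x \<in> box c d" for x
  proof -
    have "0 < \<psi> x" unfolding \<psi>_def using x by (intro prod_pos ballI mult_pos_pos zero_less_power) (simp_all add: mem_box_cart zero_less_mult_iff)
    then have "filterlim (\<lambda>n. 1 + real n * \<psi> x) at_top sequentially"
      by (intro filterlim_tendsto_add_at_top[OF tendsto_const]
          filterlim_at_top_mult_tendsto_pos[OF tendsto_const _ filterlim_real_sequentially])
    then have "(\<lambda>n. inverse (1 + real n * \<psi> x)) \<longlonglongrightarrow> 0"
      by (rule tendsto_inverse_0_at_top)
    from tendsto_diff[OF tendsto_const[of 1] this] show ?thesis unfolding \<eta>_def by simp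
  qed
qed

text \<open>By Stone--Weierstrass and Lusin-type approximation there are polynomials, bounded by 2 on the box,
  that tend to \<open>sgn h\<close> almost everywhere.  Cut off at the boundary they are admissible,
  and dominated convergence turns the hypothesis into \<open>\<integral>|h| = 0\<close>.\<close>

lemma fundamental_lemma_box:
  fixes h :: "real^'n \<Rightarrow> real"
  assumes h: "integrable (lebesgue_on (cbox c d)) h"
    and z: "\<And>\<phi>. \<phi> \<in> C1_fun \<Longrightarrow> (\<And>x. x \<notin> cbox c d \<Longrightarrow> \<phi> x = 0) \<Longrightarrow>
        (\<integral>x. \<phi> x * h x \<partial>lebesgue_on (cbox c d)) = 0"
  shows "AE x in lebesgue_on (cbox c d). h x = 0"
proof -
  let ?C = "cbox c d" let ?M = "lebesgue_on ?C"
  have hm [measurable]: "h \<in> borel_measurable ?M" using h by simp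
  have "(\<lambda>x. sgn (h x)) \<in> borel_measurable ?M" by measurable
  then have "(\<lambda>x. sgn (h x)) measurable_on ?C" by (simp add: measurable_on_iff_borel_measurable)
  then obtain N g where N: "negligible N" and g: "\<And>n::nat. continuous_on UNIV (g n)"
    and glim: "\<And>x. x \<notin> N \<Longrightarrow> (\<lambda>n. g n x) \<longlonglongrightarrow> (if x \<in> ?C then sgn (h x) else 0)"
    unfolding measurable_on_def by metis
  \<comment> \<open>Clamping makes the approximations bounded without changing their limit.\<close>
  define g' where "g' n = (\<lambda>x. max (-1) (min 1 (g n x)))" for n
  have g': "continuous_on ?C (g' n)" for n
    unfolding g'_def using g[of n] by (auto intro!: continuous_intros intro: continuous_on_subset)
  have "\<exists>q. real_polynomial_function q \<and> (\<forall>x\<in>?C. \<bar>g' n x - q x\<bar> < inverse (real (Suc n)))" for n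
  proof -
    have "0 < inverse (real (Suc n))" by simp
    then show ?thesis
      using Stone_Weierstrass_real_polynomial_function[OF compact_cbox g'] by metis
  qed
  then obtain q where q: "\<And>n. real_polynomial_function (q n)"
    and gq: "\<And>n x. x \<in> ?C \<Longrightarrow> \<bar>g' n x - q n x\<bar> < inverse (real (Suc n))" by metis
  obtain \<eta> where \<eta>: "\<And>n::nat. \<eta> n \<in> C1_fun" "\<And>n x. x \<notin> cbox c d \<Longrightarrow> \<eta> n x = 0"
    "\<And>n x. \<bar>\<eta> n x\<bar> \<le> 1" "\<And>x. x \<in> box c d \<Longrightarrow> (\<lambda>n. \<eta> n x) \<longlonglongrightarrow> 1"
    using C1_cutoffs[of c d] by blast
  define \<phi> where "\<phi> n = (\<lambda>x. \<eta> n x * q n x)" for n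
  have \<phi>: "\<phi> n \<in> C1_fun" for n unfolding \<phi>_def by (intro C1_mult \<eta> real_polynomial_C1 q)
  have \<phi>m [measurable]: "\<phi> n \<in> borel_measurable ?M" for n
    by (rule continuous_imp_measurable_on_sets_lebesgue[OF C1_fun_continuous[OF \<phi>]]) simp
  have q2: "\<bar>q n x\<bar> \<le> 2" if "x \<in> ?C" for n x
  proof -
    have "\<bar>g' n x\<bar> \<le> 1" by (auto simp: g'_def)
    moreover have "inverse (real (Suc n)) \<le> 1" by (simp add: inverse_le_1_iff)
    ultimately show ?thesis using gq[OF that, of n] by linarith
  qed
  have "(\<lambda>n. \<integral>x. \<phi> n x * h x \<partial>?M) \<longlonglongrightarrow> (\<integral>x. \<bar>h x\<bar> \<partial>?M)"
  proof (rule integral_dominated_convergence[where w = "\<lambda>x. 2 * \<bar>h x\<bar>"])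
    show "integrable ?M (\<lambda>x. 2 * \<bar>h x\<bar>)" using h by simp
    show "AE x in ?M. norm (\<phi> n x * h x) \<le> 2 * \<bar>h x\<bar>" for n
    proof (rule AE_I2)
      fix x assume "x \<in> space ?M"
      then have "\<bar>\<phi> n x\<bar> \<le> 1 * 2"
        unfolding \<phi>_def abs_mult using \<eta>(3) q2 by (intro mult_mono) auto
      then show "norm (\<phi> n x * h x) \<le> 2 * \<bar>h x\<bar>" by (simp add: abs_mult mult_right_mono)
    qed
    have "negligible (N \<union> (?C - box c d))"
      using N negligible_frontier_interval[of c d] by (simp add: negligible_Un_eq)
    then have "AE x in lebesgue. x \<notin> N \<union> (?C - box c d)"
      unfolding negligible_iff_null_sets by (rule AE_not_in)
    then have "AE x in ?M. x \<notin> N \<union> (?C - box c d)"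
      by (subst AE_restrict_space_iff) (auto elim: eventually_mono)
    then show "AE x in ?M. (\<lambda>n. \<phi> n x * h x) \<longlonglongrightarrow> \<bar>h x\<bar>"
    proof (rule lebesgue_on_mono)
      fix x assume x: "x \<notin> N \<union> (?C - box c d)" "x \<in> ?C"
      have "(\<lambda>n. g' n x) \<longlonglongrightarrow> max (-1) (min 1 (sgn (h x)))"
        unfolding g'_def using glim[of x] x by (intro tendsto_intros) auto
      then have a: "(\<lambda>n. g' n x) \<longlonglongrightarrow> sgn (h x)" by (simp add: sgn_real_def)
      have "(\<lambda>n. g' n x - q n x) \<longlonglongrightarrow> 0"
        by (rule Lim_null_comparison[OF _ LIMSEQ_inverse_real_of_nat])
          (use gq[OF x(2)] less_imp_le in \<open>auto intro!: always_eventually\<close>)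
      from tendsto_diff[OF a this] have "(\<lambda>n. q n x) \<longlonglongrightarrow> sgn (h x)" by simp
      moreover have "(\<lambda>n. \<eta> n x) \<longlonglongrightarrow> 1" using x by (intro \<eta>(4)) auto
      ultimately have "(\<lambda>n. \<phi> n x * h x) \<longlonglongrightarrow> 1 * sgn (h x) * h x"
        unfolding \<phi>_def by (intro tendsto_intros)
      then show "(\<lambda>n. \<phi> n x * h x) \<longlonglongrightarrow> \<bar>h x\<bar>" by (simp add: sgn_mult_self_eq abs_sgn mult.commute)
    qed
  qed measurable
  moreover have "(\<integral>x. \<phi> n x * h x \<partial>?M) = 0" for n
    using \<eta>(2) by (intro z \<phi>) (auto simp: \<phi>_def)
  ultimately have "(\<integral>x. \<bar>h x\<bar> \<partial>?M) = 0" by (simp add: LIMSEQ_const_iff)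
  then show ?thesis using h by (simp add: integral_nonneg_eq_0_iff_AE)
qed

text \<open>An open set is a countable union of closed boxes, so the statement reduces to the components of
  \<open>H\<close> on a box.\<close>

lemma fundamental_lemma:
  fixes H :: "real^'n \<Rightarrow> real^'m"
  assumes U: "open U" and H: "\<And>K. compact K \<Longrightarrow> K \<subseteq> U \<Longrightarrow> integrable (lebesgue_on K) H"
    and z: "\<And>\<phi>. \<phi> \<in> test_fun U \<Longrightarrow> (\<integral>x. \<phi> x *\<^sub>R H x \<partial>lebesgue_on U) = 0"
  shows "AE x in lebesgue_on U. H x = 0"
proof -
  have box: "AE x in lebesgue_on (cbox c d). H x $ i = 0" if C: "cbox c d \<subseteq> U" for c d i
  proof (rule fundamental_lemma_box)
    have iH: "integrable (lebesgue_on (cbox c d)) H" by (rule H[OF compact_cbox C])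
    then show "integrable (lebesgue_on (cbox c d)) (\<lambda>x. H x $ i)"
      by (subst (asm) integrable_iff_component) auto
    fix \<phi> assume \<phi>: "\<phi> \<in> C1_fun" "\<And>x. x \<notin> cbox c d \<Longrightarrow> \<phi> x = 0"
    have "0 = (\<integral>x. \<phi> x *\<^sub>R H x \<partial>lebesgue_on U) $ i"
      using z[OF test_funI[OF \<phi>(1) compact_cbox C \<phi>(2)]] by simp
    also have "(\<integral>x. \<phi> x *\<^sub>R H x \<partial>lebesgue_on U) = (\<integral>x. \<phi> x *\<^sub>R H x \<partial>lebesgue_on (cbox c d))"
      using C U \<phi>(2) by (intro integral_lebesgue_on_subset[symmetric]) auto
    also have "\<dots> $ i = (\<integral>x. (\<phi> x *\<^sub>R H x) $ i \<partial>lebesgue_on (cbox c d))"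
      by (rule integral_bounded_linear[OF bounded_linear_vec_nth, symmetric])
        (rule integrable_continuous_scaleR[OF compact_cbox iH C1_fun_continuous[OF \<phi>(1)]])
    finally show "(\<integral>x. \<phi> x * H x $ i \<partial>lebesgue_on (cbox c d)) = 0" by simp
  qed
  obtain \<D> where \<D>: "countable \<D>" "\<D> \<subseteq> Pow U" "\<And>X. X \<in> \<D> \<Longrightarrow> \<exists>a b. X = cbox a b" "\<Union>\<D> = U"
    using open_countable_Union_open_cbox[OF U] by metis
  have "AE x in lebesgue. x \<in> X \<longrightarrow> H x = 0" if X: "X \<in> \<D>" for X
  proof -
    obtain c d where cd: "X = cbox c d" using \<D>(3)[OF X] by blast
    have "AE x in lebesgue_on X. \<forall>i. H x $ i = 0"
      unfolding cd AE_all_countable using box[of c d] X \<D>(2) cd by auto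
    then show ?thesis
      by (subst (asm) AE_restrict_space_iff) (auto simp: cd vec_eq_iff elim: eventually_mono)
  qed
  then have "AE x in lebesgue. \<forall>X\<in>\<D>. x \<in> X \<longrightarrow> H x = 0" using \<D>(1) by (subst AE_ball_countable) auto
  then have "AE x in lebesgue. x \<in> U \<longrightarrow> H x = 0" using \<D>(4) by (auto elim: eventually_mono)
  then show ?thesis using U by (subst AE_restrict_space_iff) auto
qed

section \<open>Weak gradients\<close>

text \<open>Lebesgue measure is translation invariant, so the difference quotients of \<open>\<psi>\<close> in
  direction \<open>e\<close> have integral zero.  They are bounded by a multiple of the Lipschitz
  constant of \<open>\<psi>\<close>, live on a fixed ball, and tend to \<open>\<nabla>\<psi>
  \<bullet> e\<close>.  This gives integration by parts without boundary terms.\<close>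

lemma test_fun_zero_mean_grad:
  fixes \<psi> :: "real^'n \<Rightarrow> real"
  assumes \<psi>: "\<psi> \<in> test_fun UNIV"
  shows "(\<integral>x. grad \<psi> x \<partial>lebesgue) = 0"
proof -
  have C: "\<psi> \<in> C1_fun" by (rule test_fun_C1[OF \<psi>])
  obtain K where K: "compact K" "\<And>x. x \<notin> K \<Longrightarrow> \<psi> x = 0" "\<And>x. x \<notin> K \<Longrightarrow> grad \<psi> x = 0"
    using test_fun_support[OF \<psi>] by metis
  obtain r where r: "K \<subseteq> ball 0 r" "0 < r"
    using compact_imp_bounded[OF K(1)] bounded_subset_ballD by blast
  obtain B where B: "\<And>x. x \<in> K \<Longrightarrow> norm (grad \<psi> x) \<le> B" "0 < B"
    using compact_imp_bounded[OF compact_continuous_image[OF C1_fun_grad[OF C] K(1)]]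
    by (auto simp: bounded_pos)
  have B': "norm (grad \<psi> x) \<le> B" for x using B K(3)[of x] by (cases "x \<in> K") auto
  have lip: "\<bar>\<psi> x - \<psi> y\<bar> \<le> B * norm (x - y)" for x y
  proof -
    have "norm (\<psi> x - \<psi> y) \<le> B * norm (x - y)"
    proof (rule differentiable_bound[where S = UNIV and f' = "\<lambda>x h. h \<bullet> grad \<psi> x"])
      show "(\<psi> has_derivative (\<lambda>h. h \<bullet> grad \<psi> x)) (at x within UNIV)" for x
        using C1_fun_GDERIV[OF C] by (simp add: gderiv_def)
      show "onorm (\<lambda>h. h \<bullet> grad \<psi> x) \<le> B" for x
      proof (rule onorm_le)
        fix h
        have "norm (h \<bullet> grad \<psi> x) \<le> norm h * norm (grad \<psi> x)" by (simp add: Cauchy_Schwarz_ineq2)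
        also have "\<dots> \<le> norm h * B" using B' by (intro mult_left_mono) auto
        finally show "norm (h \<bullet> grad \<psi> x) \<le> B * norm h" by (simp add: mult.commute)
      qed
    qed auto
    then show ?thesis by simp
  qed
  have cont: "continuous_on UNIV \<psi>" by (rule C1_fun_continuous[OF C])
  have meas: "\<psi> \<in> borel_measurable lborel" using borel_measurable_continuous_onI[OF cont] by simp
  have meas_g: "grad \<psi> \<in> borel_measurable lborel"
    using borel_measurable_continuous_onI[OF C1_fun_grad[OF C]] by simp
  have int_ball: "integrable lborel (\<lambda>x :: real^'n. c * indicator (cball 0 s) x :: real)" for s and c :: real
    using emeasure_lborel_cball_finite[of "0 :: real^'n" s] by (intro integrable_mult_right) simp
  have int_g: "integrable lborel (grad \<psi>)"
  proof (rule Bochner_Integration.integrable_bound[OF int_ball[of B r] meas_g])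
    have "norm (grad \<psi> x) \<le> norm (B * indicator (cball 0 r) x)" for x
      using B'[of x] B(2) K(3)[of x] r by (cases "x \<in> K") (auto simp: indicator_def)
    then show "AE x in lborel. norm (grad \<psi> x) \<le> norm (B * indicator (cball 0 r) x)" by simp
  qed
  have "(\<integral>x. grad \<psi> x \<bullet> e \<partial>lborel) = 0" for e
  proof -
    define q where "q n x = (\<psi> (inverse (real (Suc n)) *\<^sub>R e + x) - \<psi> x) / inverse (real (Suc n))" for n x
    have meas_t: "(\<lambda>x. \<psi> (t + x)) \<in> borel_measurable lborel" for t
    proof -
      have "continuous_on UNIV (\<lambda>x. \<psi> (t + x))"
        by (rule continuous_on_compose2[OF cont]) (auto intro: continuous_intros)
      then show ?thesis using borel_measurable_continuous_onI by simp
    qed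
    have qm: "q n \<in> borel_measurable lborel" for n
      unfolding q_def using meas meas_t by (intro borel_measurable_divide borel_measurable_diff) auto
    have int_\<psi>: "integrable lborel \<psi>"
    proof (rule Bochner_Integration.integrable_bound[OF int_ball[of "B * (r + r)" r] meas])
      have "norm (\<psi> x) \<le> norm (B * (r + r) * indicator (cball 0 r) x)" for x
      proof (cases "x \<in> K")
        case True
        \<comment> \<open>A point at distance \<open>r\<close> lies outside the support and bounds \<open>\<psi> x\<close> by the Lipschitz estimate.\<close>
        define y :: "real^'n" where "y = r *\<^sub>R axis undefined 1"
        have y: "norm y = r" using r by (simp add: y_def norm_axis_1)
        then have "y \<notin> K" using r by auto
        then have "\<bar>\<psi> x\<bar> \<le> B * norm (x - y)" using lip[of x y] K(2) by simp
        also have "\<dots> \<le> B * (norm x + norm y)" using B(2) by (intro mult_left_mono norm_triangle_ineq4) auto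
        also have "\<dots> \<le> B * (r + r)" using B(2) True r y by (intro mult_left_mono add_mono) auto
        finally show ?thesis using True r by (auto simp: indicator_def)
      next
        case False
        then show ?thesis by (simp add: K(2))
      qed
      then show "AE x in lborel. norm (\<psi> x) \<le> norm (B * (r + r) * indicator (cball 0 r) x)" by simp
    qed
    have shift: "integrable lborel (\<lambda>x. \<psi> (t + x))" "(\<integral>x. \<psi> (t + x) \<partial>lborel) = (\<integral>x. \<psi> x \<partial>lborel)" for t
    proof -
      have "integrable (distr lborel borel ((+) t)) \<psi>" by (simp add: lborel_distr_plus int_\<psi>)
      then show "integrable lborel (\<lambda>x. \<psi> (t + x))" using meas by (subst (asm) integrable_distr_eq) auto
      have "(\<integral>x. \<psi> x \<partial>distr lborel borel ((+) t)) = (\<integral>x. \<psi> (t + x) \<partial>lborel)"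
        using meas by (subst integral_distr) auto
      then show "(\<integral>x. \<psi> (t + x) \<partial>lborel) = (\<integral>x. \<psi> x \<partial>lborel)" by (simp add: lborel_distr_plus)
    qed
    have "(\<lambda>n. \<integral>x. q n x \<partial>lborel) \<longlonglongrightarrow> (\<integral>x. grad \<psi> x \<bullet> e \<partial>lborel)"
    proof (rule integral_dominated_convergence[where w = "\<lambda>x. B * norm e * indicator (cball 0 (r + norm e)) x"])
      show "(\<lambda>x. grad \<psi> x \<bullet> e) \<in> borel_measurable lborel"
        using meas_g by (intro borel_measurable_inner) auto
      show "AE x in lborel. (\<lambda>n. q n x) \<longlonglongrightarrow> grad \<psi> x \<bullet> e"
      proof (intro AE_I2)
        fix x
        have "((\<lambda>t. \<psi> (t *\<^sub>R e + x)) has_derivative (\<lambda>t. (t *\<^sub>R e) \<bullet> grad \<psi> x)) (at 0)"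
        proof (rule has_derivative_compose[of "\<lambda>t. t *\<^sub>R e + x" _ _ _ \<psi>])
          show "((\<lambda>t::real. t *\<^sub>R e + x) has_derivative (\<lambda>t. t *\<^sub>R e)) (at 0)"
            by (auto intro!: derivative_eq_intros)
          show "(\<psi> has_derivative (\<lambda>h. h \<bullet> grad \<psi> x)) (at (0 *\<^sub>R e + x))"
            using C1_fun_GDERIV[OF C, of x] by (simp add: gderiv_def)
        qed
        then have "((\<lambda>t. \<psi> (t *\<^sub>R e + x)) has_real_derivative grad \<psi> x \<bullet> e) (at 0)"
          by (simp add: has_field_derivative_def inner_commute mult_commute_abs)
        then have "(\<lambda>h. (\<psi> (h *\<^sub>R e + x) - \<psi> x) / h) \<midarrow>0\<rightarrow> grad \<psi> x \<bullet> e"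
          by (simp add: DERIV_def)
        moreover have "filterlim (\<lambda>n. inverse (real (Suc n))) (at 0) sequentially"
          unfolding filterlim_at by (simp add: LIMSEQ_inverse_real_of_nat[simplified])
        ultimately show "(\<lambda>n. q n x) \<longlonglongrightarrow> grad \<psi> x \<bullet> e"
          unfolding q_def by (rule filterlim_compose)
      qed
      show "AE x in lborel. norm (q n x) \<le> B * norm e * indicator (cball 0 (r + norm e)) x" for n
      proof (intro AE_I2)
        fix x
        let ?t = "inverse (real (Suc n))"
        have t: "0 < ?t" "?t \<le> 1" by (simp_all add: inverse_le_1_iff)
        show "norm (q n x) \<le> B * norm e * indicator (cball 0 (r + norm e)) x"
        proof (cases "x \<in> cball 0 (r + norm e)")
          case True
          have "\<bar>\<psi> (?t *\<^sub>R e + x) - \<psi> x\<bar> \<le> B * norm (?t *\<^sub>R e)" using lip[of "?t *\<^sub>R e + x" x] by simp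
          also have "\<dots> = B * norm e * ?t" using t by simp
          finally have "\<bar>\<psi> (?t *\<^sub>R e + x) - \<psi> x\<bar> / ?t \<le> B * norm e" using t by (subst pos_divide_le_eq) auto
          moreover have "norm (q n x) = \<bar>\<psi> (?t *\<^sub>R e + x) - \<psi> x\<bar> / ?t" using t by (simp add: q_def abs_divide)
          ultimately show ?thesis using True by simp
        next
          case False
          then have x: "r + norm e < norm x" by simp
          have te: "norm (?t *\<^sub>R e) \<le> norm e" using t by (simp add: mult_left_le_one_le)
          have "norm x \<le> norm (?t *\<^sub>R e + x) + norm (?t *\<^sub>R e)"
            using norm_triangle_ineq4[of "?t *\<^sub>R e + x" "?t *\<^sub>R e"] by simp
          then have "r \<le> norm (?t *\<^sub>R e + x)" "r \<le> norm x"
            using te x norm_ge_zero[of e] by linarith+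
          then have "?t *\<^sub>R e + x \<notin> ball 0 r" "x \<notin> ball 0 r" by auto
          then have "?t *\<^sub>R e + x \<notin> K" "x \<notin> K" using r(1) by blast+
          then show ?thesis by (simp add: q_def K(2) less_imp_le[OF B(2)])
        qed
      qed
    qed (use qm int_ball in auto)
    moreover have "(\<integral>x. q n x \<partial>lborel) = 0" for n
      unfolding q_def using shift int_\<psi> by simp
    ultimately show ?thesis by (simp add: LIMSEQ_const_iff)
  qed
  then have "(\<integral>x. grad \<psi> x \<partial>lborel) \<bullet> e = 0" for e
    using integral_inner_left[of e lborel "grad \<psi>"] int_g by simp
  then have "(\<integral>x. grad \<psi> x \<partial>lborel) = 0" using inner_eq_zero_iff by blast
  then show ?thesis using meas_g by (simp add: integral_completion)
qed

lemma integrable_lebesgue_on_support: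
  fixes f :: "real^'n \<Rightarrow> 'b::euclidean_space"
  assumes "K \<subseteq> U" "K \<in> sets lebesgue" "U \<in> sets lebesgue" "integrable (lebesgue_on K) f"
    "\<And>x. x \<notin> K \<Longrightarrow> f x = 0"
  shows "integrable (lebesgue_on U) f"
proof -
  have "(\<lambda>x. if x \<in> K then f x else 0) = (\<lambda>x. if x \<in> U then f x else 0)"
    using assms by (auto simp: fun_eq_iff)
  then show ?thesis using assms Lebesgue_Measure.integrable_restrict_UNIV[of K f]
      Lebesgue_Measure.integrable_restrict_UNIV[of U f] by simp
qed

lemma has_wgrad_integrable:
  assumes U: "open U" and G: "has_wgrad U v G" and \<phi>: "\<phi> \<in> test_fun U"
  shows "integrable (lebesgue_on U) (\<lambda>x. v x *\<^sub>R grad \<phi> x)" "integrable (lebesgue_on U) (\<lambda>x. \<phi> x *\<^sub>R G x)"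
proof -
  obtain K where K: "compact K" "K \<subseteq> U" "\<And>x. x \<notin> K \<Longrightarrow> \<phi> x = 0" "\<And>x. x \<notin> K \<Longrightarrow> grad \<phi> x = 0"
    using test_fun_support[OF \<phi>] by metis
  have C: "\<phi> \<in> C1_fun" by (rule test_fun_C1[OF \<phi>])
  have i: "integrable (lebesgue_on K) v" "integrable (lebesgue_on K) G"
    using G K by (auto simp: has_wgrad_def)
  have s: "K \<in> sets lebesgue" "U \<in> sets lebesgue" using U K(1) by (auto simp: compact_imp_closed)
  show "integrable (lebesgue_on U) (\<lambda>x. v x *\<^sub>R grad \<phi> x)"
    by (rule integrable_lebesgue_on_support[OF K(2) s integrable_scaleR_continuous[OF K(1) i(1) C1_fun_grad[OF C]]])
      (simp add: K(4))
  show "integrable (lebesgue_on U) (\<lambda>x. \<phi> x *\<^sub>R G x)"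
    by (rule integrable_lebesgue_on_support[OF K(2) s integrable_continuous_scaleR[OF K(1) i(2) C1_fun_continuous[OF C]]])
      (simp add: K(3))
qed

lemma has_wgrad_lincomb:
  assumes U: "open U" and v: "has_wgrad U v G" and w: "has_wgrad U w H"
  shows "has_wgrad U (\<lambda>x. a * v x + b * w x) (\<lambda>x. a *\<^sub>R G x + b *\<^sub>R H x)"
  unfolding has_wgrad_def
proof (intro conjI allI impI ballI)
  fix K assume "compact K \<and> K \<subseteq> U"
  then have "integrable (lebesgue_on K) v" "integrable (lebesgue_on K) G"
    "integrable (lebesgue_on K) w" "integrable (lebesgue_on K) H"
    using v w by (auto simp: has_wgrad_def)
  then show "integrable (lebesgue_on K) (\<lambda>x. a * v x + b * w x)"
    "integrable (lebesgue_on K) (\<lambda>x. a *\<^sub>R G x + b *\<^sub>R H x)" by auto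
next
  fix \<phi> assume \<phi>: "\<phi> \<in> test_fun U"
  note i = has_wgrad_integrable[OF U v \<phi>] has_wgrad_integrable[OF U w \<phi>]
  have e: "(\<integral>x. v x *\<^sub>R grad \<phi> x \<partial>lebesgue_on U) = - (\<integral>x. \<phi> x *\<^sub>R G x \<partial>lebesgue_on U)"
    "(\<integral>x. w x *\<^sub>R grad \<phi> x \<partial>lebesgue_on U) = - (\<integral>x. \<phi> x *\<^sub>R H x \<partial>lebesgue_on U)"
    using v w \<phi> by (auto simp: has_wgrad_def)
  have "(\<integral>x. (a * v x + b * w x) *\<^sub>R grad \<phi> x \<partial>lebesgue_on U) =
    (\<integral>x. a *\<^sub>R (v x *\<^sub>R grad \<phi> x) + b *\<^sub>R (w x *\<^sub>R grad \<phi> x) \<partial>lebesgue_on U)"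
    by (simp add: scaleR_add_left)
  also have "\<dots> = a *\<^sub>R (\<integral>x. v x *\<^sub>R grad \<phi> x \<partial>lebesgue_on U) + b *\<^sub>R (\<integral>x. w x *\<^sub>R grad \<phi> x \<partial>lebesgue_on U)"
    using i by (simp del: scaleR_scaleR)
  also have "\<dots> = - (a *\<^sub>R (\<integral>x. \<phi> x *\<^sub>R G x \<partial>lebesgue_on U) + b *\<^sub>R (\<integral>x. \<phi> x *\<^sub>R H x \<partial>lebesgue_on U))"
    by (simp add: e)
  also have "\<dots> = - (\<integral>x. a *\<^sub>R (\<phi> x *\<^sub>R G x) + b *\<^sub>R (\<phi> x *\<^sub>R H x) \<partial>lebesgue_on U)"
    using i by (simp del: scaleR_scaleR)
  also have "\<dots> = - (\<integral>x. \<phi> x *\<^sub>R (a *\<^sub>R G x + b *\<^sub>R H x) \<partial>lebesgue_on U)"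
    by (simp add: scaleR_add_right mult.commute)
  finally show "(\<integral>x. (a * v x + b * w x) *\<^sub>R grad \<phi> x \<partial>lebesgue_on U) =
    - (\<integral>x. \<phi> x *\<^sub>R (a *\<^sub>R G x + b *\<^sub>R H x) \<partial>lebesgue_on U)" .
qed

text \<open>The difference of two weak gradients is a weak gradient of zero, and the fundamental lemma applies.\<close>

lemma has_wgrad_unique:
  assumes U: "open U" and G: "has_wgrad U v G" and H: "has_wgrad U v H"
  shows "AE x in lebesgue_on U. G x = H x"
proof -
  have d: "has_wgrad U (\<lambda>x. 1 * v x + (-1) * v x) (\<lambda>x. 1 *\<^sub>R G x + (-1) *\<^sub>R H x)"
    by (rule has_wgrad_lincomb[OF U G H])
  have "AE x in lebesgue_on U. 1 *\<^sub>R G x + (-1) *\<^sub>R H x = 0"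
  proof (rule fundamental_lemma[OF U])
    fix K assume "compact K" "K \<subseteq> U"
    then show "integrable (lebesgue_on K) (\<lambda>x. 1 *\<^sub>R G x + (-1) *\<^sub>R H x)"
      using d unfolding has_wgrad_def by blast
  next
    fix \<phi> assume "\<phi> \<in> test_fun U"
    then have "(\<integral>x. (1 * v x + (-1) * v x) *\<^sub>R grad \<phi> x \<partial>lebesgue_on U) =
        - (\<integral>x. \<phi> x *\<^sub>R (1 *\<^sub>R G x + (-1) *\<^sub>R H x) \<partial>lebesgue_on U)"
      using d unfolding has_wgrad_def by blast
    then show "(\<integral>x. \<phi> x *\<^sub>R (1 *\<^sub>R G x + (-1) *\<^sub>R H x) \<partial>lebesgue_on U) = 0" by simp
  qed
  then show ?thesis by (auto elim: eventually_mono)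
qed

lemma has_wgrad_wgrad: "has_wgrad U v G \<Longrightarrow> has_wgrad U v (wgrad U v)"
  unfolding wgrad_def by (rule someI[of "has_wgrad U v"])

lemma wgrad_AE: "open U \<Longrightarrow> has_wgrad U v G \<Longrightarrow> AE x in lebesgue_on U. G x = wgrad U v x"
  using has_wgrad_unique has_wgrad_wgrad by blast

text \<open>Test functions of a smaller open set are test functions of the larger one.\<close>

lemma has_wgrad_subset:
  assumes "has_wgrad U v G" "V \<subseteq> U" "open U" "open V" shows "has_wgrad V v G"
  unfolding has_wgrad_def
proof (intro conjI allI impI ballI)
  fix K assume "compact K \<and> K \<subseteq> V"
  then show "integrable (lebesgue_on K) v" "integrable (lebesgue_on K) G"
    using assms by (auto simp: has_wgrad_def)
next
  fix \<phi> assume \<phi>: "\<phi> \<in> test_fun V"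
  obtain K where K: "compact K" "K \<subseteq> V" "\<And>x. x \<notin> K \<Longrightarrow> \<phi> x = 0" "\<And>x. x \<notin> K \<Longrightarrow> grad \<phi> x = 0"
    using test_fun_support[OF \<phi>] by metis
  have "\<phi> x = 0" "grad \<phi> x = 0" if "x \<notin> V" for x using K that by blast+
  then have "(\<integral>x. v x *\<^sub>R grad \<phi> x \<partial>lebesgue_on V) = (\<integral>x. v x *\<^sub>R grad \<phi> x \<partial>lebesgue_on U)"
    "(\<integral>x. \<phi> x *\<^sub>R G x \<partial>lebesgue_on V) = (\<integral>x. \<phi> x *\<^sub>R G x \<partial>lebesgue_on U)"
    using assms by (auto intro!: integral_lebesgue_on_subset)
  then show "(\<integral>x. v x *\<^sub>R grad \<phi> x \<partial>lebesgue_on V) = - (\<integral>x. \<phi> x *\<^sub>R G x \<partial>lebesgue_on V)"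
    using assms(1) test_fun_mono[OF \<phi> assms(2)] by (simp add: has_wgrad_def)
qed

lemma H1_D:
  assumes U: "open U" and v: "v \<in> H1 U"
  shows "v \<in> L2 U" "has_wgrad U v (wgrad U v)" "wgrad U v \<in> L2 U"
proof -
  obtain G where G: "v \<in> L2 U" "G \<in> L2 U" "has_wgrad U v G" using v by (auto simp: H1_def)
  show "v \<in> L2 U" "has_wgrad U v (wgrad U v)" using G has_wgrad_wgrad by auto
  show "wgrad U v \<in> L2 U" using L2_AE(1)[OF _ G(2) wgrad_AE[OF U G(3)]] U by simp
qed

lemma H1_I: "v \<in> L2 U \<Longrightarrow> G \<in> L2 U \<Longrightarrow> has_wgrad U v G \<Longrightarrow> v \<in> H1 U"
  by (auto simp: H1_def)

lemma
  assumes U: "open U" and v: "v \<in> H1 U" and w: "w \<in> H1 U"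
  shows H1_lincomb: "(\<lambda>x. a * v x + b * w x) \<in> H1 U"
    and wgrad_lincomb: "AE x in lebesgue_on U.
      a *\<^sub>R wgrad U v x + b *\<^sub>R wgrad U w x = wgrad U (\<lambda>x. a * v x + b * w x) x"
proof -
  note V = H1_D[OF U v] and W = H1_D[OF U w]
  note g = has_wgrad_lincomb[OF U V(2) W(2), of a b]
  show "(\<lambda>x. a * v x + b * w x) \<in> H1 U"
    using H1_I[OF _ _ g] L2_add(1)[OF L2_scale(1)[OF V(1), of a] L2_scale(1)[OF W(1), of b]]
      L2_add(1)[OF L2_scale(1)[OF V(3), of a] L2_scale(1)[OF W(3), of b]] by simp
  show "AE x in lebesgue_on U.
      a *\<^sub>R wgrad U v x + b *\<^sub>R wgrad U w x = wgrad U (\<lambda>x. a * v x + b * w x) x"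
    by (rule wgrad_AE[OF U g])
qed

lemma H1_subset:
  assumes U: "open U" and V: "open V" "V \<subseteq> U" and v: "v \<in> H1 U"
  shows "v \<in> H1 V"
proof -
  have s: "U \<in> sets lebesgue" "V \<in> sets lebesgue" using U V by auto
  have g: "has_wgrad V v (wgrad U v)" by (rule has_wgrad_subset[OF H1_D(2)[OF U v] V(2) U V(1)])
  show ?thesis
    using H1_I[OF L2_subset[OF H1_D(1)[OF U v] V(2) s(2,1)] L2_subset[OF H1_D(3)[OF U v] V(2) s(2,1)] g] .
qed

lemma integral_grad_test_fun:
  assumes U: "open U" and \<psi>: "\<psi> \<in> test_fun U"
  shows "(\<integral>x. grad \<psi> x \<partial>lebesgue_on U) = 0"
proof -
  obtain K where K: "K \<subseteq> U" "\<And>x. x \<notin> K \<Longrightarrow> grad \<psi> x = 0"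
    using test_fun_support[OF \<psi>] by metis
  have "(\<integral>x. grad \<psi> x \<partial>lebesgue_on U) = (\<integral>x. grad \<psi> x \<partial>lebesgue_on UNIV)"
    using U K by (intro integral_lebesgue_on_subset) auto
  then show ?thesis
    using test_fun_zero_mean_grad[OF test_fun_mono[OF \<psi> subset_UNIV]] by (simp add: lebesgue_on_UNIV_eq)
qed

text \<open>If \<open>\<phi>\<close> is a test function, then so is \<open>q \<phi>\<close>, and the integral of
  its gradient vanishes; the product rule turns this into integration by parts.\<close>

lemma C1_has_wgrad:
  assumes U: "open U" "bounded U" and q: "q \<in> C1_fun"
  shows "has_wgrad U q (grad q)"
  unfolding has_wgrad_def
proof (intro conjI allI impI ballI)
  fix K assume "compact K \<and> K \<subseteq> U"
  then have K: "bounded K" "K \<in> sets lebesgue" "K \<in> lmeasurable"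
    by (auto simp: compact_imp_bounded compact_imp_closed lmeasurable_compact)
  show "integrable (lebesgue_on K) q" "integrable (lebesgue_on K) (grad q)"
    using K by (auto intro!: L2_integrable_finite L2_continuous_bounded C1_fun_continuous[OF q] C1_fun_grad[OF q])
next
  fix \<phi> assume \<phi>: "\<phi> \<in> test_fun U"
  have C: "\<phi> \<in> C1_fun" by (rule test_fun_C1[OF \<phi>])
  have s: "U \<in> sets lebesgue" "U \<in> lmeasurable" using U by (auto simp: lmeasurable_open)
  have "GDERIV (\<lambda>x. q x * \<phi> x) x :> q x *\<^sub>R grad \<phi> x + \<phi> x *\<^sub>R grad q x" for x
    by (rule GDERIV_mult[OF C1_fun_GDERIV[OF q] C1_fun_GDERIV[OF C]])
  then have g: "grad (\<lambda>x. q x * \<phi> x) = (\<lambda>x. q x *\<^sub>R grad \<phi> x + \<phi> x *\<^sub>R grad q x)"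
    using grad_eq by blast
  have i: "integrable (lebesgue_on U) (\<lambda>x. q x *\<^sub>R grad \<phi> x)" "integrable (lebesgue_on U) (\<lambda>x. \<phi> x *\<^sub>R grad q x)"
    using s U by (auto intro!: L2_integrable_finite L2_continuous_bounded continuous_on_scaleR
        C1_fun_continuous[OF q] C1_fun_grad[OF q] C1_fun_continuous[OF C] C1_fun_grad[OF C])
  have "(\<integral>x. q x *\<^sub>R grad \<phi> x + \<phi> x *\<^sub>R grad q x \<partial>lebesgue_on U) = 0"
    using integral_grad_test_fun[OF U(1) C1_mult_test[OF q \<phi>]] by (simp add: g)
  then show "(\<integral>x. q x *\<^sub>R grad \<phi> x \<partial>lebesgue_on U) = - (\<integral>x. \<phi> x *\<^sub>R grad q x \<partial>lebesgue_on U)"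
    using i by (simp add: eq_neg_iff_add_eq_0)
qed

lemma
  assumes U: "open U" "bounded U" and q: "q \<in> C1_fun"
  shows C1_H1: "q \<in> H1 U" and C1_wgrad: "AE x in lebesgue_on U. grad q x = wgrad U q x"
proof -
  have g: "has_wgrad U q (grad q)" by (rule C1_has_wgrad[OF U q])
  show "q \<in> H1 U" using U
    by (intro H1_I[OF _ _ g] L2_continuous_bounded C1_fun_continuous[OF q] C1_fun_grad[OF q]) auto
  show "AE x in lebesgue_on U. grad q x = wgrad U q x" by (rule wgrad_AE[OF U(1) g])
qed

section \<open>Virtual element spaces\<close>

text \<open>Linear subspaces of a function space, without mention of zero: the spaces involved are nonempty.\<close>

definition lin_closed :: "('a \<Rightarrow> real) set \<Rightarrow> bool" where
  "lin_closed V \<longleftrightarrow> (\<forall>v\<in>V. \<forall>w\<in>V. \<forall>a b. (\<lambda>x. a * v x + b * w x) \<in> V)"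

lemma lin_closedD: "lin_closed V \<Longrightarrow> v \<in> V \<Longrightarrow> w \<in> V \<Longrightarrow> (\<lambda>x. a * v x + b * w x) \<in> V"
  by (auto simp: lin_closed_def)

lemma ip_AE_left:
  fixes f g h :: "real^'n \<Rightarrow> 'b::euclidean_space"
  assumes "U \<in> sets lebesgue" "f \<in> L2 U" "h \<in> L2 U" "AE x in lebesgue_on U. f x = g x"
  shows "ip U f h = ip U g h"
  unfolding ip_def
  by (rule integral_AE_lebesgue_on[OF assms(1) borel_measurable_integrable[OF L2_inner_integrable[OF assms(2,3)]]])
    (use assms(4) in \<open>auto elim: eventually_mono\<close>)

lemma L2norm_lincomb_sq:
  fixes f g :: "real^'n \<Rightarrow> 'b::euclidean_space"
  assumes f: "f \<in> L2 U" and g: "g \<in> L2 U"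
  shows "(L2norm U (\<lambda>x. a *\<^sub>R f x + b *\<^sub>R g x))\<^sup>2 \<le> 2 * a\<^sup>2 * (L2norm U f)\<^sup>2 + 2 * b\<^sup>2 * (L2norm U g)\<^sup>2"
  using L2_add(2)[OF L2_scale(1)[OF f, of a] L2_scale(1)[OF g, of b]] by (simp add: L2_scale[OF f] L2_scale[OF g])

context
  fixes U :: "(real^'n) set"
  assumes U: "open U" "bounded U"
begin

lemma U_sets: "U \<in> sets lebesgue"
  using U by simp

lemma test_fun_L2:
  assumes "\<phi> \<in> test_fun U" shows "\<phi> \<in> L2 U" "grad \<phi> \<in> L2 U"
  using U U_sets test_fun_C1[OF assms] by (auto intro!: L2_continuous_bounded C1_fun_continuous C1_fun_grad)

text \<open>The same combination of approximating test functions approximates the combination; the errors are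
  controlled by squares.\<close>

lemma H10_lincomb:
  assumes v: "v \<in> H10 U" and w: "w \<in> H10 U" shows "(\<lambda>x. a * v x + b * w x) \<in> H10 U"
proof -
  let ?u = "\<lambda>x. a * v x + b * w x"
  define err where "err v \<phi> = (L2norm U (\<lambda>x. v x - \<phi> x))\<^sup>2 + (L2norm U (\<lambda>x. wgrad U v x - grad \<phi> x))\<^sup>2" for v \<phi>
  obtain \<phi> where \<phi>: "\<And>k. \<phi> k \<in> test_fun U" "(\<lambda>k. err v (\<phi> k)) \<longlonglongrightarrow> 0" and v1: "v \<in> H1 U"
    using v by (auto simp: H10_def err_def)
  obtain \<psi> where \<psi>: "\<And>k. \<psi> k \<in> test_fun U" "(\<lambda>k. err w (\<psi> k)) \<longlonglongrightarrow> 0" and w1: "w \<in> H1 U"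
    using w by (auto simp: H10_def err_def)
  note V = H1_D[OF U(1) v1] and W = H1_D[OF U(1) w1]
  define \<eta> where "\<eta> k = (\<lambda>x. a * \<phi> k x + b * \<psi> k x)" for k
  have \<eta>: "\<eta> k \<in> test_fun U" "grad (\<eta> k) = (\<lambda>x. a *\<^sub>R grad (\<phi> k) x + b *\<^sub>R grad (\<psi> k) x)" for k
    unfolding \<eta>_def using test_fun_lincomb[OF \<phi>(1) \<psi>(1)] by auto
  have le: "err ?u (\<eta> k) \<le> 2 * a\<^sup>2 * err v (\<phi> k) + 2 * b\<^sup>2 * err w (\<psi> k)" for k
  proof -
    note P = test_fun_L2[OF \<phi>(1)[of k]] and Q = test_fun_L2[OF \<psi>(1)[of k]]
    note d = L2_diff(1)[OF V(1) P(1)] L2_diff(1)[OF W(1) Q(1)] L2_diff(1)[OF V(3) P(2)] L2_diff(1)[OF W(3) Q(2)]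
    have "(\<lambda>x. ?u x - \<eta> k x) = (\<lambda>x. a *\<^sub>R (v x - \<phi> k x) + b *\<^sub>R (w x - \<psi> k x))"
      by (simp add: \<eta>_def fun_eq_iff algebra_simps)
    then have 1: "(L2norm U (\<lambda>x. ?u x - \<eta> k x))\<^sup>2 \<le>
        2 * a\<^sup>2 * (L2norm U (\<lambda>x. v x - \<phi> k x))\<^sup>2 + 2 * b\<^sup>2 * (L2norm U (\<lambda>x. w x - \<psi> k x))\<^sup>2"
      using L2norm_lincomb_sq[OF d(1,2), of a b] by simp
    have l: "(\<lambda>x. a *\<^sub>R (wgrad U v x - grad (\<phi> k) x) + b *\<^sub>R (wgrad U w x - grad (\<psi> k) x)) \<in> L2 U"
      by (rule L2_add(1)[OF L2_scale(1)[OF d(3)] L2_scale(1)[OF d(4)]])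
    have "AE x in lebesgue_on U. a *\<^sub>R (wgrad U v x - grad (\<phi> k) x) + b *\<^sub>R (wgrad U w x - grad (\<psi> k) x)
        = wgrad U ?u x - grad (\<eta> k) x"
      using wgrad_lincomb[OF U(1) v1 w1, of a b]
      by (auto simp: \<eta>(2) algebra_simps elim!: eventually_mono)
    from L2_AE(2)[OF U_sets l this]
    have 2: "(L2norm U (\<lambda>x. wgrad U ?u x - grad (\<eta> k) x))\<^sup>2 \<le>
        2 * a\<^sup>2 * (L2norm U (\<lambda>x. wgrad U v x - grad (\<phi> k) x))\<^sup>2 + 2 * b\<^sup>2 * (L2norm U (\<lambda>x. wgrad U w x - grad (\<psi> k) x))\<^sup>2"
      using L2norm_lincomb_sq[OF d(3,4), of a b] by simp
    show ?thesis using 1 2 by (simp add: err_def algebra_simps)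
  qed
  have "(\<lambda>k. err ?u (\<eta> k)) \<longlonglongrightarrow> 0"
  proof (rule tendsto_sandwich[OF _ _ tendsto_const])
    show "\<forall>\<^sub>F k in sequentially. 0 \<le> err ?u (\<eta> k)" by (simp add: err_def)
    show "\<forall>\<^sub>F k in sequentially. err ?u (\<eta> k) \<le> 2 * a\<^sup>2 * err v (\<phi> k) + 2 * b\<^sup>2 * err w (\<psi> k)"
      using le by simp
    have "(\<lambda>k. 2 * a\<^sup>2 * err v (\<phi> k) + 2 * b\<^sup>2 * err w (\<psi> k)) \<longlonglongrightarrow> 2 * a\<^sup>2 * 0 + 2 * b\<^sup>2 * 0"
      by (intro tendsto_intros \<phi>(2) \<psi>(2))
    then show "(\<lambda>k. 2 * a\<^sup>2 * err v (\<phi> k) + 2 * b\<^sup>2 * err w (\<psi> k)) \<longlonglongrightarrow> 0" by simp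
  qed
  then show ?thesis
    unfolding H10_def using H1_lincomb[OF U(1) v1 w1] \<eta>(1) by (auto simp: err_def)
qed

lemma zero_H10: "(\<lambda>x. 0) \<in> H10 U"
proof -
  have C: "(\<lambda>x :: real^'n. 0) \<in> C1_fun" by (rule C1_const)
  have g: "grad (\<lambda>x. 0) = (\<lambda>x :: real^'n. 0)" using grad_eq[OF GDERIV_const] by blast
  have "L2norm U (\<lambda>x. 0 :: real^'n) = L2norm U (wgrad U (\<lambda>x. 0))"
    using C1_wgrad[OF U C] by (intro L2_AE(2)[OF U_sets L2_zero]) (simp add: g)
  then have "L2norm U (wgrad U (\<lambda>x. 0)) = 0" by (simp add: L2norm_def)
  moreover have "L2norm U (\<lambda>x. 0 :: real) = 0" by (simp add: L2norm_def)
  ultimately show ?thesis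
    unfolding H10_def using C1_H1[OF U C] zero_test_fun
    by (auto simp: g intro!: exI[of _ "\<lambda>k x. 0"])
qed

lemma has_trace_lincomb:
  assumes "has_trace U v g" "has_trace U w h"
  shows "has_trace U (\<lambda>x. a * v x + b * w x) (\<lambda>x. a * g x + b * h x)"
proof -
  obtain v' where v': "v' \<in> H1 U" "continuous_on (closure U) v'" "\<And>x. x \<in> frontier U \<Longrightarrow> v' x = g x"
    "(\<lambda>x. v x - v' x) \<in> H10 U" using assms(1) by (auto simp: has_trace_def)
  obtain w' where w': "w' \<in> H1 U" "continuous_on (closure U) w'" "\<And>x. x \<in> frontier U \<Longrightarrow> w' x = h x"
    "(\<lambda>x. w x - w' x) \<in> H10 U" using assms(2) by (auto simp: has_trace_def)
  have "(\<lambda>x. a * v x + b * w x - (a * v' x + b * w' x)) = (\<lambda>x. a * (v x - v' x) + b * (w x - w' x))"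
    by (simp add: algebra_simps)
  then have "(\<lambda>x. a * v x + b * w x - (a * v' x + b * w' x)) \<in> H10 U"
    using H10_lincomb[OF v'(4) w'(4)] by simp
  moreover have "continuous_on (frontier U) g" "continuous_on (frontier U) h"
    using assms by (auto simp: has_trace_def)
  ultimately show ?thesis unfolding has_trace_def
    using v'(1-3) w'(1-3) H1_lincomb[OF U(1) v'(1) w'(1), of a b]
    by (auto intro!: continuous_intros bexI[of _ "\<lambda>x. a * v' x + b * w' x"])
qed

lemma has_trace_C1:
  assumes "q \<in> C1_fun" shows "has_trace U q q"
  unfolding has_trace_def using C1_H1[OF U assms] zero_H10
  by (auto intro!: C1_fun_continuous[OF assms] bexI[of _ q])

lemma lap_in_poly_lincomb:
  assumes v: "v \<in> H1 U" "lap_in_poly p U v" and w: "w \<in> H1 U" "lap_in_poly p U w"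
  shows "lap_in_poly p U (\<lambda>x. a * v x + b * w x)"
proof -
  obtain q r where q: "q \<in> poly_fun p" "\<And>\<phi>. \<phi> \<in> test_fun U \<Longrightarrow> ip U (wgrad U v) (grad \<phi>) = - ip U q \<phi>"
    and r: "r \<in> poly_fun p" "\<And>\<phi>. \<phi> \<in> test_fun U \<Longrightarrow> ip U (wgrad U w) (grad \<phi>) = - ip U r \<phi>"
    using v(2) w(2) unfolding lap_in_poly_def by metis
  note V = H1_D(3)[OF U(1) v(1)] and W = H1_D(3)[OF U(1) w(1)]
  have "ip U (wgrad U (\<lambda>x. a * v x + b * w x)) (grad \<phi>) = - ip U (\<lambda>x. a * q x + b * r x) \<phi>"
    if \<phi>: "\<phi> \<in> test_fun U" for \<phi>
  proof -
    note P = test_fun_L2[OF \<phi>]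
    have "ip U (wgrad U (\<lambda>x. a * v x + b * w x)) (grad \<phi>) = ip U (\<lambda>x. a *\<^sub>R wgrad U v x + b *\<^sub>R wgrad U w x) (grad \<phi>)"
      using wgrad_lincomb[OF U(1) v(1) w(1), of a b]
      by (intro ip_AE_left[symmetric] U_sets P L2_add(1)[OF L2_scale(1)[OF V] L2_scale(1)[OF W]])
    also have "\<dots> = a * ip U (wgrad U v) (grad \<phi>) + b * ip U (wgrad U w) (grad \<phi>)"
      by (rule ip_lincomb_scaleR[OF V W P(2)])
    also have "\<dots> = - (a * ip U q \<phi> + b * ip U r \<phi>)" using q(2)[OF \<phi>] r(2)[OF \<phi>] by simp
    also have "a * ip U q \<phi> + b * ip U r \<phi> = ip U (\<lambda>x. a * q x + b * r x) \<phi>"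
      by (rule ip_lincomb_left[symmetric]) (use P poly_fun_L2[OF q(1) U(2) U_sets] poly_fun_L2[OF r(1) U(2) U_sets] in auto)
    finally show ?thesis .
  qed
  then show ?thesis unfolding lap_in_poly_def using poly_fun_lincomb[OF q(1) r(1)] by blast
qed

text \<open>Integrate by parts once more: each \<open>\<partial>\<^sub>i q\<close> is a polynomial with weak
  gradient \<open>\<nabla>\<partial>\<^sub>i q\<close>, so the distributional Laplacian is the
  classical one, a polynomial.\<close>

lemma lap_in_poly_poly:
  assumes q: "q \<in> poly_fun p" shows "lap_in_poly p U q"
proof -
  have C: "q \<in> C1_fun" by (rule poly_fun_C1[OF q])
  define q' where "q' i = (\<lambda>x. grad q x $ i)" for i
  have q': "q' i \<in> poly_fun (p - 1)" for i unfolding q'_def by (rule poly_fun_grad[OF q])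
  have C': "q' i \<in> C1_fun" for i by (rule poly_fun_C1[OF q'])
  define L where "L = (\<lambda>x. \<Sum>i\<in>UNIV. grad (q' i) x $ i)"
  have L: "L \<in> poly_fun p" unfolding L_def
    by (intro poly_fun_sum poly_fun_mono[OF poly_fun_grad[OF q']]) simp
  have "ip U (wgrad U q) (grad \<phi>) = - ip U L \<phi>" if \<phi>: "\<phi> \<in> test_fun U" for \<phi>
  proof -
    note P = test_fun_L2[OF \<phi>]
    have Pi: "(\<lambda>x. grad \<phi> x $ i) \<in> L2 U" for i using P(2) by (simp add: L2_component)
    have g2: "grad q \<in> L2 U" using U U_sets by (intro L2_continuous_bounded C1_fun_grad[OF C])
    have Q: "q' i \<in> L2 U" for i by (rule poly_fun_L2[OF q' U(2) U_sets])
    have Q2: "(\<lambda>x. grad (q' i) x $ i) \<in> L2 U" for i by (rule poly_fun_L2[OF poly_fun_grad[OF q'] U(2) U_sets])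
    have "ip U (wgrad U q) (grad \<phi>) = ip U (grad q) (grad \<phi>)"
      by (rule ip_AE_left[OF U_sets g2 P(2) C1_wgrad[OF U C], symmetric])
    also have "\<dots> = (\<Sum>i\<in>UNIV. \<integral>x. q' i x * grad \<phi> x $ i \<partial>lebesgue_on U)"
      unfolding ip_def inner_vec_def q'_def
      using L2_inner_integrable[OF Q Pi] by (simp add: q'_def)
    also have "\<dots> = (\<Sum>i\<in>UNIV. - (\<integral>x. \<phi> x * grad (q' i) x $ i \<partial>lebesgue_on U))"
    proof (rule sum.cong[OF refl])
      fix i
      note g = C1_has_wgrad[OF U C'[of i]]
      have "(\<integral>x. q' i x *\<^sub>R grad \<phi> x \<partial>lebesgue_on U) $ i = - (\<integral>x. \<phi> x *\<^sub>R grad (q' i) x \<partial>lebesgue_on U) $ i"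
        using g \<phi> by (simp add: has_wgrad_def)
      moreover have "(\<integral>x. q' i x *\<^sub>R grad \<phi> x \<partial>lebesgue_on U) $ i = (\<integral>x. (q' i x *\<^sub>R grad \<phi> x) $ i \<partial>lebesgue_on U)"
        by (rule integral_bounded_linear[OF bounded_linear_vec_nth has_wgrad_integrable(1)[OF U(1) g \<phi>], symmetric])
      moreover have "(\<integral>x. \<phi> x *\<^sub>R grad (q' i) x \<partial>lebesgue_on U) $ i = (\<integral>x. (\<phi> x *\<^sub>R grad (q' i) x) $ i \<partial>lebesgue_on U)"
        by (rule integral_bounded_linear[OF bounded_linear_vec_nth has_wgrad_integrable(2)[OF U(1) g \<phi>], symmetric])
      ultimately show "(\<integral>x. q' i x * grad \<phi> x $ i \<partial>lebesgue_on U) = - (\<integral>x. \<phi> x * grad (q' i) x $ i \<partial>lebesgue_on U)"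
        by simp
    qed
    also have "\<dots> = - (\<Sum>i\<in>UNIV. \<integral>x. \<phi> x * grad (q' i) x $ i \<partial>lebesgue_on U)"
      by (simp add: sum_negf)
    also have "(\<Sum>i\<in>UNIV. \<integral>x. \<phi> x * grad (q' i) x $ i \<partial>lebesgue_on U) =
        (\<integral>x. (\<Sum>i\<in>UNIV. \<phi> x * grad (q' i) x $ i) \<partial>lebesgue_on U)"
      using L2_inner_integrable[OF P(1) Q2] by (simp add: integral_sum)
    also have "\<dots> = ip U L \<phi>"
      by (simp add: ip_def L_def sum_distrib_left mult.commute)
    finally show ?thesis .
  qed
  then show ?thesis unfolding lap_in_poly_def using L by blast
qed

lemma lin_closed_vem_W:
  assumes "\<And>s. s \<in> S \<Longrightarrow> lin_closed (Vs s)" shows "lin_closed (vem_W p U S Vs)"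
  unfolding lin_closed_def
proof (intro ballI allI)
  fix v w a b assume v: "v \<in> vem_W p U S Vs" and w: "w \<in> vem_W p U S Vs"
  obtain g h where g: "has_trace U v g" "\<And>s. s \<in> S \<Longrightarrow> g \<in> Vs s"
    and h: "has_trace U w h" "\<And>s. s \<in> S \<Longrightarrow> h \<in> Vs s"
    using v w unfolding vem_W_def by blast
  have "(\<lambda>x. a * g x + b * h x) \<in> Vs s" if "s \<in> S" for s
    using lin_closedD[OF assms[OF that] g(2)[OF that] h(2)[OF that]] .
  then show "(\<lambda>x. a * v x + b * w x) \<in> vem_W p U S Vs"
    using v w has_trace_lincomb[OF g(1) h(1), of a b] lap_in_poly_lincomb[of v p w a b] H1_lincomb[OF U(1), of v w a b]
    unfolding vem_W_def by blast
qed

lemma poly_in_vem_W: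
  assumes q: "q \<in> poly_fun p" and "\<And>s. s \<in> S \<Longrightarrow> q \<in> Vs s" shows "q \<in> vem_W p U S Vs"
  unfolding vem_W_def
  using assms(2) C1_H1[OF U poly_fun_C1[OF q]] lap_in_poly_poly[OF q] has_trace_C1[OF poly_fun_C1[OF q]] by blast

text \<open>The defining moment conditions are linear because \<open>P\<close> is linear on \<open>W\<close>.\<close>

lemma lin_closed_vem_V:
  assumes W: "lin_closed W" "W \<subseteq> H1 U" and P: "vem_projection p C U W D P"
  shows "lin_closed (vem_V p U W P)"
  unfolding lin_closed_def
proof (intro ballI allI)
  fix v w a b assume v: "v \<in> vem_V p U W P" and w: "w \<in> vem_V p U W P"
  then have vW: "v \<in> W" "w \<in> W" by (auto simp: vem_V_def)
  have l: "v \<in> L2 U" "w \<in> L2 U" using vW W(2) H1_D(1)[OF U(1)] by auto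
  have Pv: "P v \<in> poly_fun p" "P w \<in> poly_fun p" "P (\<lambda>x. a * v x + b * w x) = (\<lambda>x. a * P v x + b * P w x)"
    using P vW unfolding vem_projection_def by blast+
  have Pl: "P v \<in> L2 U" "P w \<in> L2 U" using Pv poly_fun_L2[OF _ U(2) U_sets] by auto
  have m: "smono U \<alpha> \<in> L2 U" for \<alpha>
    unfolding smono_def[abs_def] divide_inverse
    by (intro L2_continuous_bounded U U_sets continuous_on_prod continuous_on_power continuous_on_mult
        continuous_on_diff continuous_on_const continuous_on_component continuous_on_id)
  show "(\<lambda>x. a * v x + b * w x) \<in> vem_V p U W P"
    unfolding vem_V_def
  proof (intro CollectI conjI allI impI)
    show "(\<lambda>x. a * v x + b * w x) \<in> W" by (rule lin_closedD[OF W(1) vW])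
    fix \<alpha> :: "'n \<Rightarrow> nat" assume "p - 1 \<le> sum \<alpha> UNIV \<and> sum \<alpha> UNIV \<le> p"
    then have "ip U v (smono U \<alpha>) = ip U (P v) (smono U \<alpha>)" "ip U w (smono U \<alpha>) = ip U (P w) (smono U \<alpha>)"
      using v w by (auto simp: vem_V_def)
    then show "ip U (\<lambda>x. a * v x + b * w x) (smono U \<alpha>) = ip U (P (\<lambda>x. a * v x + b * w x)) (smono U \<alpha>)"
      by (simp add: Pv(3) ip_lincomb_left[OF l m] ip_lincomb_left[OF Pl m])
  qed
qed

text \<open>The moment conditions are trivial, as \<open>P\<close> fixes polynomials.\<close>

lemma poly_in_vem_V:
  assumes "q \<in> poly_fun p" "q \<in> W" "vem_projection p C U W D P" shows "q \<in> vem_V p U W P"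
  using assms by (auto simp: vem_V_def vem_projection_def)

end

lemma lin_closed_edge_space: "lin_closed (edge_space p s)"
  unfolding lin_closed_def edge_space_def
proof safe
  fix g h a b and q r :: "real^'a \<Rightarrow> real" assume "q \<in> poly_fun p" "r \<in> poly_fun p" "\<forall>x\<in>s. g x = q x" "\<forall>x\<in>s. h x = r x"
  then show "\<exists>q\<in>poly_fun p. \<forall>x\<in>s. a * g x + b * h x = q x"
    by (intro bexI[of _ "\<lambda>x. a * q x + b * r x"] poly_fun_lincomb) auto
qed

lemma poly_in_edge_space: "q \<in> poly_fun p \<Longrightarrow> q \<in> edge_space p s"
  by (auto simp: edge_space_def)

text \<open>After subtracting its value at 0, an isometry preserves norms and distances and hence inner
  products.  Comparing \<open>f x\<close> with the combination of the images of the unit vectors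
  shows that it is linear.\<close>

lemma isometry_components_poly:
  fixes \<phi> :: "real^'m \<Rightarrow> real^'n"
  assumes iso: "\<And>x y. dist (\<phi> x) (\<phi> y) = dist x y"
  shows "(\<lambda>x. \<phi> x $ i) \<in> poly_fun 1"
proof -
  define f where "f x = \<phi> x - \<phi> 0" for x
  have n: "norm (f x) = norm x" for x using iso[of x 0] by (simp add: f_def dist_norm)
  have d: "norm (f x - f y) = norm (x - y)" for x y using iso[of x y] by (simp add: f_def dist_norm)
  have ip: "f x \<bullet> f y = x \<bullet> y" for x y
    using d[of x y] n[of x] n[of y] by (simp add: dot_norm_neg)
  have f: "f x = (\<Sum>j\<in>UNIV. (x $ j) *\<^sub>R f (axis j 1))" for x
  proof -
    define y where "y = (\<Sum>j\<in>UNIV. (x $ j) *\<^sub>R f (axis j 1))"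
    have fy: "f z \<bullet> y = z \<bullet> x" for z
    proof -
      have "f z \<bullet> y = (\<Sum>j\<in>UNIV. x $ j * (f z \<bullet> f (axis j 1)))" by (simp add: y_def inner_sum_right)
      also have "\<dots> = (\<Sum>j\<in>UNIV. z $ j * x $ j)" by (simp add: ip inner_axis mult.commute)
      finally show ?thesis by (simp add: inner_vec_def)
    qed
    have "y \<bullet> y = (\<Sum>j\<in>UNIV. x $ j * (f (axis j 1) \<bullet> y))"
      by (subst (1) y_def) (simp add: inner_sum_left)
    also have "\<dots> = (\<Sum>j\<in>UNIV. x $ j * x $ j)" by (simp add: fy inner_axis')
    also have "\<dots> = x \<bullet> x" by (simp add: inner_vec_def)
    finally have "(f x - y) \<bullet> (f x - y) = 0"
      using fy[of x] by (simp add: inner_diff_left inner_diff_right ip inner_commute)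
    then show ?thesis by (simp add: y_def)
  qed
  have "\<phi> x $ i = \<phi> 0 $ i + (\<Sum>j\<in>UNIV. f (axis j 1) $ i * x $ j)" for x
  proof -
    have "\<phi> x $ i = \<phi> 0 $ i + f x $ i" by (simp add: f_def)
    also have "f x $ i = (\<Sum>j\<in>UNIV. (x $ j) *\<^sub>R f (axis j 1)) $ i" by (simp only: f[of x])
    finally show ?thesis by (simp add: mult.commute)
  qed
  then have "(\<lambda>x. \<phi> x $ i) = (\<lambda>x. \<phi> 0 $ i + (\<Sum>j\<in>UNIV. f (axis j 1) $ i * x $ j))" by (rule ext)
  moreover have "(\<lambda>x. \<phi> 0 $ i + (\<Sum>j\<in>UNIV. f (axis j 1) $ i * x $ j)) \<in> poly_fun 1"
    using poly_fun_coord[where l=0] by (intro poly_fun_add poly_fun_const poly_fun_sum poly_fun_scale) simp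
  ultimately show ?thesis by simp
qed

text \<open>Subspaces of equal dimension are isometric, and \<open>affine hull s\<close> is a translate of one.\<close>

lemma chart_exists:
  fixes s :: "(real^'n) set"
  assumes "aff_dim s = int CARD('m)"
  shows "(\<forall>x y. dist (chart s x :: real^'n) (chart s (y :: real^'m)) = dist x y) \<and> range (chart s :: real^'m \<Rightarrow> real^'n) = affine hull s"
proof -
  have "s \<noteq> {}" using assms by auto
  then obtain a where a: "a \<in> s" by blast
  define S where "S = (\<lambda>x. -a + x) ` (affine hull s)"
  have ah: "a \<in> affine hull s" using a by (rule hull_inc)
  have sub: "subspace S" unfolding S_def by (rule affine_diffs_subspace[OF affine_affine_hull ah])
  have "int (dim S) = aff_dim s"
    using aff_dim_eq_dim[of a "affine hull s"] ah by (simp add: S_def hull_hull aff_dim_affine_hull)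
  then have dim: "dim (UNIV :: (real^'m) set) = dim S" using assms by simp
  obtain f :: "real^'m \<Rightarrow> real^'n" where f: "linear f" "f ` UNIV = S" "\<And>x. norm (f x) = norm x"
    using isometry_subspaces[OF subspace_UNIV sub dim] by auto
  have "dist (a + f x) (a + f y) = dist x y" for x y
    using f(3)[of "x - y"] by (simp add: dist_norm linear_diff[OF f(1)])
  moreover have "range (\<lambda>x. a + f x) = affine hull s"
  proof -
    have "range (\<lambda>x. a + f x) = (+) a ` S" using f(2) by (auto simp: image_image)
    also have "\<dots> = affine hull s" by (simp add: S_def image_image)
    finally show ?thesis .
  qed
  ultimately have "\<exists>\<phi>::real^'m \<Rightarrow> real^'n. (\<forall>x y. dist (\<phi> x) (\<phi> y) = dist x y) \<and> range \<phi> = affine hull s"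
    by (intro exI[of _ "\<lambda>x. a + f x"]) blast
  then show ?thesis unfolding chart_def by (rule someI_ex)
qed

lemma simple_cellD:
  assumes "simple_cell E S" shows "open E" "E \<noteq> {}" "bounded (\<Union>S)"
proof -
  have "compact (\<Union>S)" using assms homeomorphic_compactness[of "\<Union>S"] compact_sphere unfolding simple_cell_def by metis
  then show "open E" "E \<noteq> {}" "bounded (\<Union>S)"
    using assms open_inside compact_imp_closed compact_imp_bounded by (auto simp: simple_cell_def)
qed

lemma planar_polygon_face:
  fixes s :: "(real^'n) set"
  assumes s: "planar_polygon T s" and b: "bounded s"
  shows "open (face_dom s)" "bounded (face_dom s)"
    "\<And>x y. dist (chart s x :: real^'n) (chart s (y :: real^2)) = dist x y"
proof -
  have "aff_dim s = int CARD(2)" using s by (simp add: planar_polygon_def)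
  from chart_exists[where 'm = 2, OF this]
  show iso: "dist (chart s x :: real^'n) (chart s (y :: real^2)) = dist x y" for x y by blast
  show "open (face_dom s)" by (simp add: face_dom_def)
  have "bounded ((chart s :: real^2 \<Rightarrow> real^'n) -` s)"
  proof -
    obtain e where e: "\<And>y. y \<in> s \<Longrightarrow> dist (chart s (0 :: real^2)) y \<le> e"
      using b bounded_any_center[of s "chart s (0 :: real^2)"] by blast
    have "dist 0 y \<le> e" if "y \<in> (chart s :: real^2 \<Rightarrow> real^'n) -` s" for y
      using e[of "chart s y"] that by (simp add: iso)
    then show ?thesis unfolding bounded_def by blast
  qed
  then show "bounded (face_dom s)" unfolding face_dom_def by (rule bounded_subset[OF _ interior_subset])
qed

lemma vem_W_subset_H1: "vem_W p E S Vs \<subseteq> H1 E"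
  by (auto simp: vem_W_def)

text \<open>In two dimensions this concerns polynomials on an edge.  In three dimensions it is the statement for
  the two-dimensional virtual element space of the face, transported by the affine chart.\<close>

lemma iface_space_facts:
  fixes T :: "('n::finite) mesh"
  assumes s: "CARD('n) \<noteq> 2 \<Longrightarrow> planar_polygon T s" "bounded s"
    and P: "CARD('n) \<noteq> 2 \<Longrightarrow> vem_projection p C (face_dom s) (face_W p T s) (face_dofs p T s) (PF s)"
  shows "lin_closed (iface_space p T PF s)" "poly_fun p \<subseteq> iface_space p T PF s"
proof (atomize (full), cases "CARD('n) = 2")
  case True
  then show "lin_closed (iface_space p T PF s) \<and> poly_fun p \<subseteq> iface_space p T PF s"
    by (auto simp: iface_space_def lin_closed_edge_space poly_in_edge_space)
next
  case False
  note F = planar_polygon_face[OF s(1)[OF False] s(2)]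
  let ?V = "vem_V p (face_dom s) (face_W p T s) (PF s)"
  have V: "lin_closed ?V"
    by (rule lin_closed_vem_V[OF F(1,2) _ _ P[OF False]])
      (auto simp: face_W_def intro!: lin_closed_vem_W F lin_closed_edge_space subsetD[OF vem_W_subset_H1])
  have iface: "iface_space p T PF s = {g. g \<circ> chart s \<in> ?V}" using False by (simp add: iface_space_def)
  have "lin_closed (iface_space p T PF s)"
    unfolding iface lin_closed_def using lin_closedD[OF V] by (simp add: comp_def)
  moreover have "q \<in> iface_space p T PF s" if q: "q \<in> poly_fun p" for q
  proof -
    have qc: "q \<circ> (chart s :: real^2 \<Rightarrow> real^'n) \<in> poly_fun p"
      by (rule poly_fun_affine_comp[OF q isometry_components_poly[OF F(3)]])
    then have "q \<circ> chart s \<in> face_W p T s"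
      unfolding face_W_def by (intro poly_in_vem_W F poly_in_edge_space)
    from poly_in_vem_V[OF F(1,2) qc this P[OF False]] show ?thesis by (simp add: iface)
  qed
  ultimately show "lin_closed (iface_space p T PF s) \<and> poly_fun p \<subseteq> iface_space p T PF s" by blast
qed

lemma mesh_element:
  fixes T :: "('n::finite) mesh"
  assumes m: "is_mesh U T" and E: "E \<in> elems T"
  shows "open E" "E \<noteq> {}" "E \<subseteq> U"
    and "s \<in> ifaces T E \<Longrightarrow> bounded s" and "s \<in> ifaces T E \<Longrightarrow> CARD('n) \<noteq> 2 \<Longrightarrow> planar_polygon T s"
proof -
  have c: "simple_cell E (ifaces T E)"
    using m E by (auto simp: is_mesh_def simple_polygon_def split: if_splits)
  show "open E" "E \<noteq> {}" "s \<in> ifaces T E \<Longrightarrow> bounded s"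
    using simple_cellD[OF c] by (auto intro: bounded_subset)
  show "E \<subseteq> U" "s \<in> ifaces T E \<Longrightarrow> CARD('n) \<noteq> 2 \<Longrightarrow> planar_polygon T s"
    using m E by (auto simp: is_mesh_def)
qed

text \<open>Each interface space is closed under linear combinations and contains the polynomials, and the
  conditions on the Laplacian and on the moments inherit both properties.  So the local space
  contains \<open>\<Pi>\<^sup>0\<^sub>p v - v\<close> along with \<open>v\<close>.\<close>

lemma elem_V_facts:
  fixes T :: "('n::finite) mesh"
  assumes dim: "CARD('n) = 2 \<or> CARD('n) = 3" and m: "is_mesh U T" and U: "bounded U"
    and P: "vem_projections p C T PF PE" and E: "E \<in> elems T"
  shows "lin_closed (elem_V p T PF PE E)" "poly_fun p \<subseteq> elem_V p T PF PE E" "elem_V p T PF PE E \<subseteq> H1 E"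
proof -
  note M = mesh_element[OF m E]
  have bE: "bounded E" using U M(3) by (rule bounded_subset)
  have PE: "vem_projection p C E (elem_W p T PF E) (elem_dofs p T E) (PE E)"
    using P E by (simp add: vem_projections_def)
  have PF: "vem_projection p C (face_dom s) (face_W p T s) (face_dofs p T s) (PF s)"
    if "s \<in> ifaces T E" "CARD('n) \<noteq> 2" for s
    using P E dim that by (simp add: vem_projections_def)
  have I: "lin_closed (iface_space p T PF s)" "poly_fun p \<subseteq> iface_space p T PF s" if "s \<in> ifaces T E" for s
    using iface_space_facts[of T s p C PF] M(4,5)[OF that] PF[OF that] by blast+
  have W: "elem_W p T PF E \<subseteq> H1 E" unfolding elem_W_def by (rule vem_W_subset_H1)
  have lW: "lin_closed (elem_W p T PF E)" unfolding elem_W_def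
    by (rule lin_closed_vem_W[OF M(1) bE I(1)])
  show "lin_closed (elem_V p T PF PE E)" unfolding elem_V_def
    by (rule lin_closed_vem_V[OF M(1) bE lW W PE])
  have "q \<in> elem_V p T PF PE E" if q: "q \<in> poly_fun p" for q
  proof -
    have "q \<in> elem_W p T PF E" unfolding elem_W_def
      by (rule poly_in_vem_W[OF M(1) bE q]) (use I(2) q in blast)
    then show ?thesis unfolding elem_V_def by (rule poly_in_vem_V[OF M(1) bE q _ PE])
  qed
  then show "poly_fun p \<subseteq> elem_V p T PF PE E" by blast
  show "elem_V p T PF PE E \<subseteq> H1 E" using W by (auto simp: elem_V_def vem_V_def)
qed

section \<open>The estimate on one element\<close>

lemma Linf_AE:
  fixes f g :: "real^'n \<Rightarrow> 'b::euclidean_space"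
  assumes U: "U \<in> sets lebesgue" and f: "f \<in> Linf U" and eq: "AE x in lebesgue_on U. f x = g x"
  shows "g \<in> Linf U"
proof -
  obtain M where "AE x in lebesgue_on U. norm (f x) \<le> M" using f by (auto simp: Linf_def)
  then have "AE x in lebesgue_on U. norm (g x) \<le> M" using eq by eventually_elim simp
  then show ?thesis
    using measurable_AE_lebesgue_on[OF U _ eq] f by (auto simp: Linf_def)
qed

lemma Linf_add:
  fixes f g :: "real^'n \<Rightarrow> real"
  assumes "f \<in> Linf U" "g \<in> Linf U" shows "(\<lambda>x. f x + g x) \<in> Linf U"
proof -
  obtain M N where "AE x in lebesgue_on U. norm (f x) \<le> M" "AE x in lebesgue_on U. norm (g x) \<le> N"
    using assms by (auto simp: Linf_def)
  then have "AE x in lebesgue_on U. norm (f x + g x) \<le> M + N"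
    by eventually_elim (meson add_mono norm_triangle_ineq order_trans)
  then show ?thesis using assms by (auto simp: Linf_def)
qed

lemma Linf_scale:
  fixes f :: "real^'n \<Rightarrow> real"
  assumes "f \<in> Linf U" shows "(\<lambda>x. c * f x) \<in> Linf U"
proof -
  obtain M where "AE x in lebesgue_on U. norm (f x) \<le> M" using assms by (auto simp: Linf_def)
  then have "AE x in lebesgue_on U. norm (c * f x) \<le> \<bar>c\<bar> * M"
    by eventually_elim (simp add: abs_mult mult_left_mono)
  then show ?thesis using assms by (auto simp: Linf_def)
qed

lemma Linf_component:
  fixes f :: "real^'n \<Rightarrow> real^'m"
  assumes "f \<in> Linf U" shows "(\<lambda>x. f x $ i) \<in> Linf U"
proof -
  obtain M where M: "AE x in lebesgue_on U. norm (f x) \<le> M" using assms by (auto simp: Linf_def)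
  have "AE x in lebesgue_on U. norm (f x $ i) \<le> M"
    using M by eventually_elim (auto intro: order_trans[OF component_le_norm_cart])
  moreover have "(\<lambda>x. f x \<bullet> axis i 1) \<in> borel_measurable (lebesgue_on U)"
    using assms by (intro borel_measurable_inner) (auto simp: Linf_def)
  ultimately show ?thesis by (auto simp: Linf_def inner_axis)
qed

text \<open>\<open>wgrad\<close> is some weak gradient, hence almost everywhere equal to the bounded one that
  exists by assumption.\<close>

lemma wdiv_Linf:
  assumes U: "open U" and b: "b \<in> W1inf_vec U" shows "wdiv U b \<in> Linf U"
proof -
  have c: "(\<lambda>x. wgrad U (\<lambda>y. b y $ i) x $ j) \<in> Linf U" for i j
  proof -
    obtain G where G: "G \<in> Linf U" "has_wgrad U (\<lambda>y. b y $ i) G" using b by (auto simp: W1inf_vec_def)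
    show ?thesis by (rule Linf_component[OF Linf_AE[OF _ G(1) wgrad_AE[OF U G(2)]]]) (use U in simp)
  qed
  have "(\<lambda>x. \<Sum>i\<in>A. wgrad U (\<lambda>y. b y $ i) x $ i) \<in> Linf U" if "finite A" for A
    using that
  proof (induction A)
    case empty
    show ?case by (auto simp: Linf_def intro!: exI[of _ 0])
  next
    case (insert i A)
    then show ?case using Linf_add[OF c insert.IH] by simp
  qed
  then show ?thesis unfolding wdiv_def[abs_def] by simp
qed

lemma mu_of_Linf:
  assumes "open U" "\<gamma> \<in> Linf U" "\<beta> \<in> W1inf_vec U" shows "mu_of U \<gamma> \<beta> \<in> Linf U"
  using Linf_add[OF assms(2) Linf_scale[OF wdiv_Linf[OF assms(1,3)], of "-1/2"]]
  by (simp add: mu_of_def[abs_def])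

lemma measurable_matrix_vector_mult:
  fixes A :: "'a \<Rightarrow> real^'n^'m"
  assumes "A \<in> borel_measurable M" "v \<in> borel_measurable M"
  shows "(\<lambda>x. A x *v v x) \<in> borel_measurable M"
  using assms
  by (rule borel_measurable_continuous_Pair)
    (auto simp: matrix_vector_mult_def intro!: continuous_intros)

text \<open>The half of the stability bounds that controls the energy by the stabilisation.\<close>

lemma stab_form_lower:
  assumes "stab_form E K D C Q S" "v \<in> K" "0 < C" shows "Q v \<le> C * S v v"
proof -
  have "Q v / C \<le> S v v" using assms(1,2) unfolding stab_form_def by blast
  then show ?thesis using assms(3) by (simp add: divide_le_eq mult.commute)
qed

locale element_data =
  fixes E :: "(real^'n) set" and \<kappa> :: "real^'n \<Rightarrow> real^'n^'n" and \<beta> :: "real^'n \<Rightarrow> real^'n"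
    and \<mu> :: "real^'n \<Rightarrow> real" and \<kappa>min \<kappa>max \<mu>0 B M :: real
  assumes E: "open E" "E \<noteq> {}" "bounded E"
    and meas: "\<kappa> \<in> borel_measurable (lebesgue_on E)" "\<beta> \<in> borel_measurable (lebesgue_on E)"
      "\<mu> \<in> borel_measurable (lebesgue_on E)"
    and \<kappa>_sym: "AE x in lebesgue_on E. transpose (\<kappa> x) = \<kappa> x"
    and pos: "0 < \<kappa>min" "0 < \<kappa>max" "0 < \<mu>0"
    and \<kappa>_ell: "AE x in lebesgue_on E. \<forall>\<xi>. \<kappa>min * (norm \<xi>)\<^sup>2 \<le> \<xi> \<bullet> (\<kappa> x *v \<xi>) \<and>
                                        \<xi> \<bullet> (\<kappa> x *v \<xi>) \<le> \<kappa>max * (norm \<xi>)\<^sup>2"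
    and \<beta>_le: "AE x in lebesgue_on E. norm (\<beta> x) \<le> B"
    and \<mu>_ge: "AE x in lebesgue_on E. \<mu>0 \<le> \<mu> x"
    and \<mu>_le: "AE x in lebesgue_on E. norm (\<mu> x) \<le> M"
begin

lemma E_sets: "E \<in> sets lebesgue"
  using E by simp

lemma \<kappa>_AE: "AE x in lebesgue_on E. \<forall>\<xi>. norm (\<kappa> x *v \<xi>) \<le> \<kappa>max * norm \<xi> \<and>
    (norm (msqrt (\<kappa> x) *v \<xi>))\<^sup>2 = \<xi> \<bullet> (\<kappa> x *v \<xi>)"
  using \<kappa>_sym \<kappa>_ell
  by eventually_elim (use norm_elliptic_mult norm_msqrt_mult pos in blast)

lemma \<kappa>_mult:
  assumes v: "v \<in> L2 E"
  shows "(\<lambda>x. \<kappa> x *v v x) \<in> L2 E" "(L2norm E (\<lambda>x. \<kappa> x *v v x))\<^sup>2 \<le> \<kappa>max\<^sup>2 * (L2norm E v)\<^sup>2"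
proof -
  have m: "(\<lambda>x. \<kappa> x *v v x) \<in> borel_measurable (lebesgue_on E)"
    by (rule measurable_matrix_vector_mult[OF meas(1) L2_measurable[OF v]])
  have le: "AE x in lebesgue_on E. norm (\<kappa> x *v v x) \<le> \<kappa>max * norm (v x)"
    using \<kappa>_AE by eventually_elim blast
  show "(\<lambda>x. \<kappa> x *v v x) \<in> L2 E" "(L2norm E (\<lambda>x. \<kappa> x *v v x))\<^sup>2 \<le> \<kappa>max\<^sup>2 * (L2norm E v)\<^sup>2"
    by (rule L2_dominated[OF m v le])+
qed

lemma \<beta>_inner:
  assumes v: "v \<in> L2 E"
  shows "(\<lambda>x. \<beta> x \<bullet> v x) \<in> L2 E" "(L2norm E (\<lambda>x. \<beta> x \<bullet> v x))\<^sup>2 \<le> B\<^sup>2 * (L2norm E v)\<^sup>2"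
proof -
  have m: "(\<lambda>x. \<beta> x \<bullet> v x) \<in> borel_measurable (lebesgue_on E)"
    using meas(2) L2_measurable[OF v] by (rule borel_measurable_inner)
  have le: "AE x in lebesgue_on E. norm (\<beta> x \<bullet> v x) \<le> B * norm (v x)"
    using \<beta>_le
  proof eventually_elim
    case (elim x)
    have "norm (\<beta> x \<bullet> v x) \<le> norm (\<beta> x) * norm (v x)" by (simp add: Cauchy_Schwarz_ineq2)
    also have "\<dots> \<le> B * norm (v x)" using elim by (rule mult_right_mono) simp
    finally show ?case .
  qed
  show "(\<lambda>x. \<beta> x \<bullet> v x) \<in> L2 E" "(L2norm E (\<lambda>x. \<beta> x \<bullet> v x))\<^sup>2 \<le> B\<^sup>2 * (L2norm E v)\<^sup>2"
    by (rule L2_dominated[OF m v le])+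
qed

lemma \<beta>_scale:
  assumes v: "v \<in> L2 E"
  shows "(\<lambda>x. v x *\<^sub>R \<beta> x) \<in> L2 E" "(L2norm E (\<lambda>x. v x *\<^sub>R \<beta> x))\<^sup>2 \<le> B\<^sup>2 * (L2norm E v)\<^sup>2"
proof -
  have m: "(\<lambda>x. v x *\<^sub>R \<beta> x) \<in> borel_measurable (lebesgue_on E)"
    using L2_measurable[OF v] meas(2) by (rule borel_measurable_scaleR)
  have le: "AE x in lebesgue_on E. norm (v x *\<^sub>R \<beta> x) \<le> B * norm (v x)"
    using \<beta>_le by eventually_elim (simp add: mult.commute[of B] mult_left_mono)
  show "(\<lambda>x. v x *\<^sub>R \<beta> x) \<in> L2 E" "(L2norm E (\<lambda>x. v x *\<^sub>R \<beta> x))\<^sup>2 \<le> B\<^sup>2 * (L2norm E v)\<^sup>2"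
    by (rule L2_dominated[OF m v le])+
qed

lemma \<mu>_mult:
  assumes v: "v \<in> L2 E"
  shows "(\<lambda>x. \<mu> x * v x) \<in> L2 E" "(L2norm E (\<lambda>x. \<mu> x * v x))\<^sup>2 \<le> M\<^sup>2 * (L2norm E v)\<^sup>2"
proof -
  have m: "(\<lambda>x. \<mu> x * v x) \<in> borel_measurable (lebesgue_on E)"
    using meas(3) L2_measurable[OF v] by (rule borel_measurable_times)
  have le: "AE x in lebesgue_on E. norm (\<mu> x * v x) \<le> M * norm (v x)"
    using \<mu>_le by eventually_elim (simp add: abs_mult mult_right_mono)
  show "(\<lambda>x. \<mu> x * v x) \<in> L2 E" "(L2norm E (\<lambda>x. \<mu> x * v x))\<^sup>2 \<le> M\<^sup>2 * (L2norm E v)\<^sup>2"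
    by (rule L2_dominated[OF m v le])+
qed

text \<open>Holds since \<open>|\<surd>\<kappa> \<xi>|\<^sup>2 = \<xi> \<bullet> \<kappa> \<xi>\<close>.  Only
  this quadratic form is known to be measurable beforehand; the integrand with the root is
  measurable because it agrees with it almost everywhere.\<close>

lemma msqrt_lower:
  assumes v: "v \<in> L2 E"
  shows "\<kappa>min * (L2norm E v)\<^sup>2 \<le> (\<integral>x. (norm (msqrt (\<kappa> x) *v v x))\<^sup>2 \<partial>lebesgue_on E)"
proof -
  have i: "integrable (lebesgue_on E) (\<lambda>x. v x \<bullet> (\<kappa> x *v v x))"
    by (rule L2_inner_integrable[OF v \<kappa>_mult(1)[OF v]])
  have "\<kappa>min * (L2norm E v)\<^sup>2 = (\<integral>x. \<kappa>min * (norm (v x))\<^sup>2 \<partial>lebesgue_on E)" by (simp add: L2norm_sq)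
  also have "\<dots> \<le> (\<integral>x. v x \<bullet> (\<kappa> x *v v x) \<partial>lebesgue_on E)"
  proof (rule integral_mono_AE[OF _ i])
    show "integrable (lebesgue_on E) (\<lambda>x. \<kappa>min * (norm (v x))\<^sup>2)" using L2_integrable[OF v] by simp
    show "AE x in lebesgue_on E. \<kappa>min * (norm (v x))\<^sup>2 \<le> v x \<bullet> (\<kappa> x *v v x)"
      using \<kappa>_ell by eventually_elim blast
  qed
  also have "\<dots> = (\<integral>x. (norm (msqrt (\<kappa> x) *v v x))\<^sup>2 \<partial>lebesgue_on E)"
    by (rule integral_AE_lebesgue_on[OF E_sets borel_measurable_integrable[OF i]])
      (use \<kappa>_AE in eventually_elim, simp)
  finally show ?thesis .
qed

lemma \<mu>_lower:
  assumes v: "v \<in> L2 E"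
  shows "\<mu>0 * (L2norm E v)\<^sup>2 \<le> (\<integral>x. \<mu> x * (v x)\<^sup>2 \<partial>lebesgue_on E)"
    "(\<integral>x. \<mu> x * (v x)\<^sup>2 \<partial>lebesgue_on E) = (L2norm E (\<lambda>x. sqrt (\<mu> x) * v x))\<^sup>2"
proof -
  have i: "integrable (lebesgue_on E) (\<lambda>x. \<mu> x * (v x)\<^sup>2)"
    using L2_inner_integrable[OF \<mu>_mult(1)[OF v] v] by (simp add: power2_eq_square mult.assoc)
  have "\<mu>0 * (L2norm E v)\<^sup>2 = (\<integral>x. \<mu>0 * (v x)\<^sup>2 \<partial>lebesgue_on E)" by (simp add: L2norm_sq)
  also have "\<dots> \<le> (\<integral>x. \<mu> x * (v x)\<^sup>2 \<partial>lebesgue_on E)"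
  proof (rule integral_mono_AE[OF _ i])
    show "integrable (lebesgue_on E) (\<lambda>x. \<mu>0 * (v x)\<^sup>2)" using L2_integrable[OF v] by simp
    show "AE x in lebesgue_on E. \<mu>0 * (v x)\<^sup>2 \<le> \<mu> x * (v x)\<^sup>2"
      using \<mu>_ge by eventually_elim (simp add: mult_right_mono)
  qed
  finally show "\<mu>0 * (L2norm E v)\<^sup>2 \<le> (\<integral>x. \<mu> x * (v x)\<^sup>2 \<partial>lebesgue_on E)" .
  show "(\<integral>x. \<mu> x * (v x)\<^sup>2 \<partial>lebesgue_on E) = (L2norm E (\<lambda>x. sqrt (\<mu> x) * v x))\<^sup>2"
    unfolding L2norm_sq
  proof (rule integral_AE_lebesgue_on[OF E_sets borel_measurable_integrable[OF i]])
    show "AE x in lebesgue_on E. \<mu> x * (v x)\<^sup>2 = (norm (sqrt (\<mu> x) * v x))\<^sup>2"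
      using \<mu>_ge
    proof eventually_elim
      case (elim x)
      then have "0 \<le> \<mu> x" using pos(3) by linarith
      then show ?case by (simp add: power_mult_distrib)
    qed
  qed
qed

lemma energy_norm_lower:
  assumes v: "v \<in> H1 E"
  shows "\<kappa>min * (L2norm E (wgrad E v))\<^sup>2 \<le> (energy_norm E \<kappa> \<mu> v)\<^sup>2"
    "\<mu>0 * (L2norm E v)\<^sup>2 \<le> (energy_norm E \<kappa> \<mu> v)\<^sup>2"
proof -
  have en: "(energy_norm E \<kappa> \<mu> v)\<^sup>2 =
      (\<integral>x. (norm (msqrt (\<kappa> x) *v wgrad E v x))\<^sup>2 \<partial>lebesgue_on E) + (L2norm E (\<lambda>x. sqrt (\<mu> x) * v x))\<^sup>2"
    by (simp add: energy_norm_def L2norm_sq)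
  have "0 \<le> (\<integral>x. (norm (msqrt (\<kappa> x) *v wgrad E v x))\<^sup>2 \<partial>lebesgue_on E)" by simp
  then show "\<kappa>min * (L2norm E (wgrad E v))\<^sup>2 \<le> (energy_norm E \<kappa> \<mu> v)\<^sup>2"
    "\<mu>0 * (L2norm E v)\<^sup>2 \<le> (energy_norm E \<kappa> \<mu> v)\<^sup>2"
    using msqrt_lower[OF H1_D(3)[OF E(1) v]] \<mu>_lower[OF H1_D(1)[OF E(1) v]] en
      zero_le_power2[of "L2norm E (\<lambda>x. sqrt (\<mu> x) * v x)"] by linarith+
qed

text \<open>\<open>\<nabla>q\<close> is a polynomial of degree \<open>p - 1\<close>, so it competes in the best
  approximation of \<open>\<nabla>v\<close>.  With \<open>q = \<Pi>\<^sup>0\<^sub>p v\<close> the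
  right-hand side is what the stabilisation controls.\<close>

lemma projv_grad_best:
  assumes v: "v \<in> H1 E" and q: "q \<in> poly_fun p"
  shows "(L2norm E (\<lambda>x. projv (p - 1) E (wgrad E v) x - wgrad E v x))\<^sup>2 \<le>
         (L2norm E (wgrad E (\<lambda>x. q x - v x)))\<^sup>2"
proof -
  note V = H1_D(3)[OF E(1) v]
  note C = poly_fun_C1[OF q]
  have g: "grad q \<in> L2 E" by (intro L2_continuous_bounded C1_fun_grad[OF C] E E_sets)
  have "(L2norm E (\<lambda>x. projv (p - 1) E (wgrad E v) x - wgrad E v x))\<^sup>2 \<le> (L2norm E (\<lambda>x. grad q x - wgrad E v x))\<^sup>2"
    using oscv_best[OF E V poly_fun_grad[OF q]] by (simp add: oscv_def)
  also have "L2norm E (\<lambda>x. grad q x - wgrad E v x) = L2norm E (wgrad E (\<lambda>x. q x - v x))"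
  proof (rule L2_AE(2)[OF E_sets L2_diff(1)[OF g V]])
    have "AE x in lebesgue_on E. 1 *\<^sub>R wgrad E q x + (-1) *\<^sub>R wgrad E v x = wgrad E (\<lambda>x. 1 * q x + (-1) * v x) x"
      by (rule wgrad_lincomb[OF E(1) C1_H1[OF E(1,3) C] v])
    then show "AE x in lebesgue_on E. grad q x - wgrad E v x = wgrad E (\<lambda>x. q x - v x) x"
      using C1_wgrad[OF E(1,3) C] by eventually_elim simp
  qed
  finally show ?thesis .
qed

text \<open>Here \<open>d\<^sub>1, d\<^sub>0\<close> stand for the bounds that come from the stabilisation and
  \<open>e\<^sub>1, e\<^sub>0\<close> for those that come from the energy norm of the error;
  \<open>v\<close> is the discrete and \<open>u\<close> the exact solution.\<close>

lemma Psi_bounds: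
  assumes u: "u \<in> H1 E" and v: "v \<in> H1 E"
    and d1: "(L2norm E (wgrad E (\<lambda>x. proj p E v x - v x)))\<^sup>2 \<le> d1"
    and d0: "(L2norm E (\<lambda>x. proj p E v x - v x))\<^sup>2 \<le> d0"
    and e1: "(L2norm E (wgrad E (\<lambda>x. u x - v x)))\<^sup>2 \<le> e1"
    and e0: "(L2norm E (\<lambda>x. u x - v x))\<^sup>2 \<le> e0"
  shows "Psi1 p E \<kappa> v \<le> 2 * (oscv (p - 1) E (\<lambda>x. \<kappa> x *v wgrad E u x))\<^sup>2 + 2 * (\<kappa>max\<^sup>2 * (2 * d1 + 2 * e1))" (is ?P1)
    and "Psi2 p E \<beta> v \<le> (diameter E)\<^sup>2 * (2 * (osc p E (\<lambda>x. \<beta> x \<bullet> wgrad E u x))\<^sup>2 + 2 * (B\<^sup>2 * (2 * d1 + 2 * e1)))" (is ?P2)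
    and "Psi3 p E \<beta> v \<le> 2 * (oscv (p - 1) E (\<lambda>x. u x *\<^sub>R \<beta> x))\<^sup>2 + 2 * (B\<^sup>2 * (2 * d0 + 2 * e0))" (is ?P3)
    and "Psi4 p E \<mu> v \<le> (diameter E)\<^sup>2 * (2 * (osc p E (\<lambda>x. \<mu> x * u x))\<^sup>2 + 2 * (M\<^sup>2 * (2 * d0 + 2 * e0)))" (is ?P4)
proof -
  note V = H1_D[OF E(1) v] and W = H1_D[OF E(1) u]
  let ?q = "proj p E v" and ?g = "projv (p - 1) E (wgrad E v)"
  have q: "?q \<in> poly_fun p" "?q \<in> L2 E" using proj_poly[OF E V(1)] proj_L2[OF E V(1)] by auto
  have g: "?g \<in> L2 E" by (rule projv_L2[OF E V(3)])
  \<comment> \<open>Both discrete fields are compared with the exact ones through \<open>v\<close> and its gradient.\<close>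
  have "(L2norm E (\<lambda>x. ?q x - u x))\<^sup>2 = (L2norm E (\<lambda>x. (?q x - v x) - (u x - v x)))\<^sup>2" by simp
  also have "\<dots> \<le> 2 * d0 + 2 * e0"
    using L2_diff(2)[OF L2_diff(1)[OF q(2) V(1)] L2_diff(1)[OF W(1) V(1)]] d0 e0 by linarith
  finally have q0: "(L2norm E (\<lambda>x. ?q x - u x))\<^sup>2 \<le> 2 * d0 + 2 * e0" .
  have "AE x in lebesgue_on E. 1 *\<^sub>R wgrad E u x + (-1) *\<^sub>R wgrad E v x = wgrad E (\<lambda>x. 1 * u x + (-1) * v x) x"
    by (rule wgrad_lincomb[OF E(1) u v])
  then have "L2norm E (\<lambda>x. wgrad E u x - wgrad E v x) = L2norm E (wgrad E (\<lambda>x. u x - v x))"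
    by (intro L2_AE(2)[OF E_sets L2_diff(1)[OF W(3) V(3)]]) simp
  then have e1': "(L2norm E (\<lambda>x. wgrad E u x - wgrad E v x))\<^sup>2 \<le> e1" using e1 by simp
  have "(L2norm E (\<lambda>x. ?g x - wgrad E u x))\<^sup>2 =
      (L2norm E (\<lambda>x. (?g x - wgrad E v x) - (wgrad E u x - wgrad E v x)))\<^sup>2" by simp
  also have "\<dots> \<le> 2 * d1 + 2 * e1"
    using L2_diff(2)[OF L2_diff(1)[OF g V(3)] L2_diff(1)[OF W(3) V(3)]]
      projv_grad_best[OF v q(1)] d1 e1' by linarith
  finally have g0: "(L2norm E (\<lambda>x. ?g x - wgrad E u x))\<^sup>2 \<le> 2 * d1 + 2 * e1" .
  have gu: "(\<lambda>x. ?g x - wgrad E u x) \<in> L2 E" by (rule L2_diff(1)[OF g W(3)])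
  have qu: "(\<lambda>x. ?q x - u x) \<in> L2 E" by (rule L2_diff(1)[OF q(2) W(1)])
  show ?P1
    using oscv_perturb[OF E \<kappa>_mult(1)[OF g] \<kappa>_mult(1)[OF W(3)], of "p - 1"]
      \<kappa>_mult(2)[OF gu] mult_left_mono[OF g0, of "\<kappa>max\<^sup>2"]
    by (simp add: Psi1_def matrix_vector_mult_diff_distrib[symmetric])
  show ?P3
    using oscv_perturb[OF E \<beta>_scale(1)[OF q(2)] \<beta>_scale(1)[OF W(1)], of "p - 1"]
      \<beta>_scale(2)[OF qu] mult_left_mono[OF q0, of "B\<^sup>2"]
    by (simp add: Psi3_def scaleR_diff_left[symmetric])
  have "(osc p E (\<lambda>x. \<beta> x \<bullet> ?g x))\<^sup>2 \<le> 2 * (osc p E (\<lambda>x. \<beta> x \<bullet> wgrad E u x))\<^sup>2 + 2 * (B\<^sup>2 * (2 * d1 + 2 * e1))"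
    using osc_perturb[OF E \<beta>_inner(1)[OF g] \<beta>_inner(1)[OF W(3)], of p]
      \<beta>_inner(2)[OF gu] mult_left_mono[OF g0, of "B\<^sup>2"]
    by (simp add: inner_diff_right[symmetric])
  then show ?P2 unfolding Psi2_def by (intro mult_left_mono) auto
  have "(osc p E (\<lambda>x. \<mu> x * ?q x))\<^sup>2 \<le> 2 * (osc p E (\<lambda>x. \<mu> x * u x))\<^sup>2 + 2 * (M\<^sup>2 * (2 * d0 + 2 * e0))"
    using osc_perturb[OF E \<mu>_mult(1)[OF q(2)] \<mu>_mult(1)[OF W(1)], of p]
      \<mu>_mult(2)[OF qu] mult_left_mono[OF q0, of "M\<^sup>2"]
    by (simp add: right_diff_distrib[symmetric])
  then show ?P4 unfolding Psi4_def by (intro mult_left_mono) auto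
qed

text \<open>The constant depends only on the bounds of the coefficients, on \<open>H\<close> and on
  \<open>c\<^sub>1, c\<^sub>0\<close>, so it is uniform over all elements and meshes.\<close>

lemma Psi_estimate:
  assumes u: "u \<in> H1 E" and v: "v \<in> H1 E" and c: "0 \<le> c1" "0 \<le> c0" "0 \<le> s" "diameter E \<le> H"
    and d1: "(L2norm E (wgrad E (\<lambda>x. proj p E v x - v x)))\<^sup>2 \<le> c1 * s"
    and d0: "(L2norm E (\<lambda>x. proj p E v x - v x))\<^sup>2 \<le> c0 * s"
  shows "Psi p E \<kappa> \<beta> \<mu> v \<le>
     (2 + (2 * \<kappa>max\<^sup>2 + 2 * H\<^sup>2 * B\<^sup>2) * (2 * c1 + 2 / \<kappa>min) + (2 * B\<^sup>2 + 2 * H\<^sup>2 * M\<^sup>2) * (2 * c0 + 2 / \<mu>0)) *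
     ((energy_norm E \<kappa> \<mu> (\<lambda>x. u x - v x))\<^sup>2 + s
        + (oscv (p - 1) E (\<lambda>x. \<kappa> x *v wgrad E u x))\<^sup>2
        + (diameter E)\<^sup>2 * (osc p E (\<lambda>x. \<beta> x \<bullet> wgrad E u x))\<^sup>2
        + (oscv (p - 1) E (\<lambda>x. u x *\<^sub>R \<beta> x))\<^sup>2
        + (diameter E)\<^sup>2 * (osc p E (\<lambda>x. \<mu> x * u x))\<^sup>2)"
    (is "_ \<le> (2 + ?k1 * ?a1 + ?k0 * ?a0) * (?en + s + ?o1 + ?h * ?o2 + ?o3 + ?h * ?o4)")
proof -
  have uv: "(\<lambda>x. u x - v x) \<in> H1 E" using H1_lincomb[OF E(1) u v, of 1 "-1"] by simp
  have e1: "(L2norm E (wgrad E (\<lambda>x. u x - v x)))\<^sup>2 \<le> ?en / \<kappa>min"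
    using energy_norm_lower(1)[OF uv] pos by (simp add: field_simps)
  have e0: "(L2norm E (\<lambda>x. u x - v x))\<^sup>2 \<le> ?en / \<mu>0"
    using energy_norm_lower(2)[OF uv] pos by (simp add: field_simps)
  note b = Psi_bounds[OF u v d1 d0 e1 e0]
  have h: "0 \<le> ?h" "?h \<le> H\<^sup>2"
    using c(4) diameter_ge_0[OF E(3)] by (auto intro: power_mono)
  define X1 where "X1 = 2 * (c1 * s) + 2 * (?en / \<kappa>min)"
  define X0 where "X0 = 2 * (c0 * s) + 2 * (?en / \<mu>0)"
  have X: "0 \<le> X1" "0 \<le> X0" using c pos by (auto simp: X1_def X0_def)
  have "X1 \<le> ?a1 * (?en + s)" "X0 \<le> ?a0 * (?en + s)"
    using c pos by (auto simp: X1_def X0_def algebra_simps)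
  then have X': "?k1 * X1 \<le> ?k1 * (?a1 * (?en + s))" "?k0 * X0 \<le> ?k0 * (?a0 * (?en + s))"
    by (auto intro!: mult_left_mono)
  have "?h * (B\<^sup>2 * X1) \<le> H\<^sup>2 * (B\<^sup>2 * X1)" "?h * (M\<^sup>2 * X0) \<le> H\<^sup>2 * (M\<^sup>2 * X0)"
    using h X by (auto intro!: mult_right_mono)
  then have "Psi p E \<kappa> \<beta> \<mu> v \<le> 2 * (?o1 + ?h * ?o2 + ?o3 + ?h * ?o4) + ?k1 * X1 + ?k0 * X0"
    using b unfolding Psi_def X1_def[symmetric] X0_def[symmetric] by (simp add: algebra_simps)
  also have "\<dots> \<le> 2 * (?o1 + ?h * ?o2 + ?o3 + ?h * ?o4) + (?k1 * ?a1 + ?k0 * ?a0) * (?en + s)"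
    using X' by (simp add: distrib_right mult.assoc)
  also have "\<dots> \<le> (2 + (?k1 * ?a1 + ?k0 * ?a0)) * ((?en + s) + (?o1 + ?h * ?o2 + ?o3 + ?h * ?o4))"
  proof -
    have "0 \<le> ?k1 * ?a1 + ?k0 * ?a0" using c pos by (intro add_nonneg_nonneg mult_nonneg_nonneg) auto
    moreover have "0 \<le> ?en + s" "0 \<le> ?o1 + ?h * ?o2 + ?o3 + ?h * ?o4" using c h by auto
    ultimately have "0 \<le> (?k1 * ?a1 + ?k0 * ?a0) * (?o1 + ?h * ?o2 + ?o3 + ?h * ?o4)" "0 \<le> 2 * (?en + s)"
      by auto
    then show ?thesis unfolding distrib_right distrib_left by linarith
  qed
  finally show ?thesis by (simp add: add.assoc)
qed

end

section \<open>Uniform bound on all meshes\<close>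

theorem lemma18:
  fixes \<Omega> :: "(real^'n) set"
    and \<kappa> :: "real^'n \<Rightarrow> real^'n^'n" and \<beta> :: "real^'n \<Rightarrow> real^'n" and \<gamma> \<mu> :: "real^'n \<Rightarrow> real"
    and T :: "'i \<Rightarrow> 'n mesh"
    and PF :: "'i \<Rightarrow> (real^'n) set \<Rightarrow> (real^2 \<Rightarrow> real) \<Rightarrow> real^2 \<Rightarrow> real"
    and PE :: "'i \<Rightarrow> (real^'n) set \<Rightarrow> (real^'n \<Rightarrow> real) \<Rightarrow> real^'n \<Rightarrow> real"
    and S1 S0 S :: "'i \<Rightarrow> (real^'n) set \<Rightarrow> (real^'n \<Rightarrow> real) \<Rightarrow> (real^'n \<Rightarrow> real) \<Rightarrow> real"
    and p N :: nat and \<rho> \<kappa>min \<kappa>max \<mu>0 Cproj Cstab s1 s0 :: real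
  assumes dim: "CARD('n) = 2 \<or> CARD('n) = 3"
    and \<Omega>: "polytopal_domain \<Omega>"
    and \<gamma>: "\<gamma> \<in> Linf \<Omega>"
    and \<beta>: "\<beta> \<in> W1inf_vec \<Omega>"
    and \<kappa>: "\<kappa> \<in> Linf \<Omega>"
    and \<kappa>_sym: "AE x in lebesgue_on \<Omega>. transpose (\<kappa> x) = \<kappa> x"
    and \<kappa>_pos: "0 < \<kappa>min" "0 < \<kappa>max"
    and \<kappa>_ell: "AE x in lebesgue_on \<Omega>. \<forall>\<xi>. \<kappa>min * (norm \<xi>)\<^sup>2 \<le> \<xi> \<bullet> (\<kappa> x *v \<xi>) \<and>
                                        \<xi> \<bullet> (\<kappa> x *v \<xi>) \<le> \<kappa>max * (norm \<xi>)\<^sup>2"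
    and \<mu>: "\<mu> = mu_of \<Omega> \<gamma> \<beta>"
    and \<mu>_pos: "0 < \<mu>0" "AE x in lebesgue_on \<Omega>. \<mu>0 \<le> \<mu> x"
    and p: "1 \<le> p"
    and \<rho>: "0 < \<rho>"
    and mesh: "\<And>i. is_mesh \<Omega> (T i)" "\<And>i. regular_mesh \<rho> N (T i)"
    and proj: "\<And>i. vem_projections p Cproj (T i) (PF i) (PE i)"
    and stab_const: "0 < Cstab" "0 < s1" "0 < s0"
    and stab1: "\<And>i E. E \<in> elems (T i) \<Longrightarrow>
          stab_form E (stab_kernel p E (elem_V p (T i) (PF i) (PE i) E)) (elem_dofs p (T i) E) Cstab
            (\<lambda>v. \<integral>x. (norm (msqrt (\<kappa> x) *v wgrad E v x))\<^sup>2 \<partial>(lebesgue_on E)) (S1 i E)"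
    and stab0: "\<And>i E. E \<in> elems (T i) \<Longrightarrow>
          stab_form E (stab_kernel p E (elem_V p (T i) (PF i) (PE i) E)) (elem_dofs p (T i) E) Cstab
            (\<lambda>v. \<integral>x. \<mu> x * (v x)\<^sup>2 \<partial>(lebesgue_on E)) (S0 i E)"
    and S: "\<And>i E v w. S i E v w = s1 * S1 i E v w + s0 * S0 i E v w"
  shows "\<exists>C. \<forall>i f u uh.
           f \<in> Linf \<Omega> \<longrightarrow> weak_solution \<Omega> \<kappa> \<beta> \<mu> f u \<longrightarrow>
           discrete_solution p (T i) (global_V \<Omega> p (T i) (PF i) (PE i)) \<kappa> \<beta> \<mu> (S i) f uh \<longrightarrow>
           (\<forall>E\<in>elems (T i).
              Psi p E \<kappa> \<beta> \<mu> uh \<le>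
                C * ((energy_norm E \<kappa> \<mu> (\<lambda>x. u x - uh x))\<^sup>2
                   + S i E (\<lambda>x. proj p E uh x - uh x) (\<lambda>x. proj p E uh x - uh x)
                   + (oscv (p - 1) E (\<lambda>x. \<kappa> x *v wgrad E u x))\<^sup>2
                   + (diameter E)\<^sup>2 * (osc p E (\<lambda>x. \<beta> x \<bullet> wgrad E u x))\<^sup>2
                   + (oscv (p - 1) E (\<lambda>x. u x *\<^sub>R \<beta> x))\<^sup>2
                   + (diameter E)\<^sup>2 * (osc p E (\<lambda>x. \<mu> x * u x))\<^sup>2))"
proof -
  have U: "open \<Omega>" "bounded \<Omega>" and Us: "\<Omega> \<in> sets lebesgue"
    using \<Omega> by (auto simp: polytopal_domain_def)
  have \<mu>_Linf: "\<mu> \<in> Linf \<Omega>" unfolding \<mu> by (rule mu_of_Linf[OF U(1) \<gamma> \<beta>])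
  have \<beta>_Linf: "\<beta> \<in> Linf \<Omega>" using \<beta> by (simp add: W1inf_vec_def)
  obtain B where B: "AE x in lebesgue_on \<Omega>. norm (\<beta> x) \<le> B" using \<beta>_Linf by (auto simp: Linf_def)
  obtain M where M: "AE x in lebesgue_on \<Omega>. norm (\<mu> x) \<le> M" using \<mu>_Linf by (auto simp: Linf_def)
  \<comment> \<open>The constants in \<open>\<parallel>\<nabla>d\<parallel>\<^sup>2 \<le> c\<^sub>1 S\<^sup>E(d, d)\<close> and \<open>\<parallel>d\<parallel>\<^sup>2 \<le> c\<^sub>0 S\<^sup>E(d, d)\<close> for \<open>d\<close> in the domain of the stabilisation.\<close>
  define c1 where "c1 = Cstab / (s1 * \<kappa>min)"
  define c0 where "c0 = Cstab / (s0 * \<mu>0)"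
  have c: "0 \<le> c1" "0 \<le> c0" using stab_const \<kappa>_pos \<mu>_pos(1) by (auto simp: c1_def c0_def)
  define H where "H = diameter \<Omega>"
  show ?thesis
  proof (intro exI allI impI ballI)
    fix i f u uh E
    assume u: "weak_solution \<Omega> \<kappa> \<beta> \<mu> f u"
      and uh: "discrete_solution p (T i) (global_V \<Omega> p (T i) (PF i) (PE i)) \<kappa> \<beta> \<mu> (S i) f uh"
      and ET: "E \<in> elems (T i)"
    note m = mesh_element[OF mesh(1) ET]
    have bE: "bounded E" using U(2) m(3) by (rule bounded_subset)
    have Es: "E \<in> sets lebesgue" using m(1) by simp
    have sub: "AE x in lebesgue_on E. P x" if "AE x in lebesgue_on \<Omega>. P x" for P
      using AE_lebesgue_on_subset[OF that m(3) Es Us] .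
    interpret element_data E \<kappa> \<beta> \<mu> \<kappa>min \<kappa>max \<mu>0 B M
    proof
      show "\<kappa> \<in> borel_measurable (lebesgue_on E)" "\<beta> \<in> borel_measurable (lebesgue_on E)"
        "\<mu> \<in> borel_measurable (lebesgue_on E)"
        using \<kappa> \<beta>_Linf \<mu>_Linf m(3) by (auto simp: Linf_def intro: measurable_restrict_mono)
    qed (use m bE \<kappa>_pos \<mu>_pos(1) sub[OF \<kappa>_sym] sub[OF \<kappa>_ell] sub[OF B] sub[OF \<mu>_pos(2)] sub[OF M] in auto)
    let ?V = "elem_V p (T i) (PF i) (PE i) E"
    note V = elem_V_facts[OF dim mesh(1) U(2) proj ET]
    have uV: "uh \<in> ?V" using uh ET by (auto simp: discrete_solution_def global_V_def)
    then have uh1: "uh \<in> H1 E" using V(3) by blast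
    have u1: "u \<in> H1 E"
      using u H1_subset[OF U(1) m(1,3)] by (auto simp: weak_solution_def H10_def)
    define d where "d = (\<lambda>x. proj p E uh x - uh x)"
    have L: "uh \<in> L2 E" by (rule H1_D(1)[OF m(1) uh1])
    have "d \<in> ?V"
      using lin_closedD[OF V(1) _ uV, of "proj p E uh" 1 "-1"] V(2) proj_poly[OF m(1,2) bE L, of p]
      by (auto simp: d_def)
    moreover from this have d1: "d \<in> H1 E" using V(3) by blast
    moreover have "proj p E d = (\<lambda>x. 0)"
      unfolding d_def by (rule proj_of_proj_diff[OF m(1,2) bE L])
    ultimately have dK: "d \<in> stab_kernel p E ?V" by (simp add: stab_kernel_def)
    have S1: "(\<integral>x. (norm (msqrt (\<kappa> x) *v wgrad E d x))\<^sup>2 \<partial>(lebesgue_on E)) \<le> Cstab * S1 i E d d"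
      by (rule stab_form_lower[OF stab1[OF ET] dK stab_const(1)])
    have S0: "(\<integral>x. \<mu> x * (d x)\<^sup>2 \<partial>(lebesgue_on E)) \<le> Cstab * S0 i E d d"
      by (rule stab_form_lower[OF stab0[OF ET] dK stab_const(1)])
    have D1: "\<kappa>min * (L2norm E (wgrad E d))\<^sup>2 \<le> Cstab * S1 i E d d"
      using msqrt_lower[OF H1_D(3)[OF m(1) d1]] S1 by linarith
    have D0: "\<mu>0 * (L2norm E d)\<^sup>2 \<le> Cstab * S0 i E d d"
      using \<mu>_lower(1)[OF H1_D(1)[OF m(1) d1]] S0 by linarith
    have "0 \<le> Cstab * S1 i E d d" "0 \<le> Cstab * S0 i E d d"
      using D1 D0 \<kappa>_pos(1) \<mu>_pos(1) by (meson mult_nonneg_nonneg less_imp_le order_trans zero_le_power2)+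
    then have nn: "0 \<le> S1 i E d d" "0 \<le> S0 i E d d" using stab_const(1) by (auto simp: zero_le_mult_iff)
    have le: "s1 * S1 i E d d \<le> S i E d d" "s0 * S0 i E d d \<le> S i E d d" and Snn: "0 \<le> S i E d d"
      using nn stab_const by (auto simp: S)
    have "(L2norm E (wgrad E d))\<^sup>2 \<le> c1 * S i E d d"
    proof -
      have "s1 * (\<kappa>min * (L2norm E (wgrad E d))\<^sup>2) \<le> s1 * (Cstab * S1 i E d d)"
        using D1 stab_const(2) by (intro mult_left_mono) auto
      also have "\<dots> \<le> Cstab * S i E d d"
        using mult_left_mono[OF le(1), of Cstab] stab_const(1) by (simp add: mult.left_commute)
      finally show ?thesis using stab_const \<kappa>_pos by (simp add: c1_def field_simps)
    qed
    moreover have "(L2norm E d)\<^sup>2 \<le> c0 * S i E d d"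
    proof -
      have "s0 * (\<mu>0 * (L2norm E d)\<^sup>2) \<le> s0 * (Cstab * S0 i E d d)"
        using D0 stab_const(3) by (intro mult_left_mono) auto
      also have "\<dots> \<le> Cstab * S i E d d"
        using mult_left_mono[OF le(2), of Cstab] stab_const(1) by (simp add: mult.left_commute)
      finally show ?thesis using stab_const \<mu>_pos(1) by (simp add: c0_def field_simps)
    qed
    moreover have "diameter E \<le> H" unfolding H_def by (rule diameter_subset[OF m(3) U(2)])
    ultimately show "Psi p E \<kappa> \<beta> \<mu> uh \<le>
      (2 + (2 * \<kappa>max\<^sup>2 + 2 * H\<^sup>2 * B\<^sup>2) * (2 * c1 + 2 / \<kappa>min) + (2 * B\<^sup>2 + 2 * H\<^sup>2 * M\<^sup>2) * (2 * c0 + 2 / \<mu>0)) *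
       ((energy_norm E \<kappa> \<mu> (\<lambda>x. u x - uh x))\<^sup>2
                   + S i E (\<lambda>x. proj p E uh x - uh x) (\<lambda>x. proj p E uh x - uh x)
                   + (oscv (p - 1) E (\<lambda>x. \<kappa> x *v wgrad E u x))\<^sup>2
                   + (diameter E)\<^sup>2 * (osc p E (\<lambda>x. \<beta> x \<bullet> wgrad E u x))\<^sup>2
                   + (oscv (p - 1) E (\<lambda>x. u x *\<^sub>R \<beta> x))\<^sup>2
                   + (diameter E)\<^sup>2 * (osc p E (\<lambda>x. \<mu> x * u x))\<^sup>2)"
      using Psi_estimate[OF u1 uh1 c Snn] unfolding d_def by blast
  qed
qed

end
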